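(* Every countable group $G$ that is McDuff is inner amenable.
   Context: All probability spaces are standard. A II$_1$ factor $M$ is McDuff if $M \cong M \mathbin{\overline{\otimes}} R$, where $R$ is the hyperfinite II$_1$ factor (equivalently, the central sequence algebra $M' \cap M^\omega$ is non abelian). A countable group $G$ is McDuff if it admits an (essentially) free ergodic probability measure preserving action $G \curvearrowright (X,\mu)$ such that the crossed product $L^\infty(X) \rtimes G$ is a McDuff II$_1$ factor. A countable group $G$ is inner amenable if there exists a conjugation invariant mean $m$ on $G$ (a finitely additive probability measure on all subsets of $G$) such that $m(\mathcal{U}) = 0$ for every finite subset $\mathcal{U} \subset G$. (Weight zero is required on all finite subsets, not only on $\{e\}$; $G$ is not assumed to be icc.) *)

theory Defs
  imports "HOL-Probability.Probability" "HOL-Algebra.Group_Action"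
begin

section \<open>Operator algebras on a complex Hilbert space\<close>

text \<open>
  A Hilbert space is given by an explicit carrier and operations, so that it can depend on a
  measure. The inner product is linear in the first variable.
\<close>

record 'h hilbert =
  vecs :: "'h set"
  vadd :: "'h \<Rightarrow> 'h \<Rightarrow> 'h"
  vzero :: "'h"
  vscale :: "complex \<Rightarrow> 'h \<Rightarrow> 'h"
  vinner :: "'h \<Rightarrow> 'h \<Rightarrow> complex"

definition vnorm :: "'h hilbert \<Rightarrow> 'h \<Rightarrow> real" where
  "vnorm H x = sqrt (Re (vinner H x x))"

text \<open>Operators are extensional (undefined outside the carrier), so that equality of operators
  is equality of functions.\<close>

definition bounded_ops :: "'h hilbert \<Rightarrow> ('h \<Rightarrow> 'h) set" where
  "bounded_ops H = {T \<in> vecs H \<rightarrow>\<^sub>E vecs H.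
     (\<forall>x\<in>vecs H. \<forall>y\<in>vecs H. T (vadd H x y) = vadd H (T x) (T y)) \<and>
     (\<forall>c. \<forall>x\<in>vecs H. T (vscale H c x) = vscale H c (T x)) \<and>
     (\<exists>C. \<forall>x\<in>vecs H. vnorm H (T x) \<le> C * vnorm H x)}"

definition op_one :: "'h hilbert \<Rightarrow> 'h \<Rightarrow> 'h" where
  "op_one H = (\<lambda>x\<in>vecs H. x)"

definition op_zero :: "'h hilbert \<Rightarrow> 'h \<Rightarrow> 'h" where
  "op_zero H = (\<lambda>x\<in>vecs H. vzero H)"

definition op_add :: "'h hilbert \<Rightarrow> ('h \<Rightarrow> 'h) \<Rightarrow> ('h \<Rightarrow> 'h) \<Rightarrow> 'h \<Rightarrow> 'h" where
  "op_add H S T = (\<lambda>x\<in>vecs H. vadd H (S x) (T x))"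

definition op_scale :: "'h hilbert \<Rightarrow> complex \<Rightarrow> ('h \<Rightarrow> 'h) \<Rightarrow> 'h \<Rightarrow> 'h" where
  "op_scale H c T = (\<lambda>x\<in>vecs H. vscale H c (T x))"

definition op_mult :: "'h hilbert \<Rightarrow> ('h \<Rightarrow> 'h) \<Rightarrow> ('h \<Rightarrow> 'h) \<Rightarrow> 'h \<Rightarrow> 'h" where
  "op_mult H S T = compose (vecs H) S T"

definition adjoint_op :: "'h hilbert \<Rightarrow> ('h \<Rightarrow> 'h) \<Rightarrow> 'h \<Rightarrow> 'h" where
  "adjoint_op H T = (THE S. S \<in> bounded_ops H \<and>
     (\<forall>x\<in>vecs H. \<forall>y\<in>vecs H. vinner H (T x) y = vinner H x (S y)))"

definition commutant :: "'h hilbert \<Rightarrow> ('h \<Rightarrow> 'h) set \<Rightarrow> ('h \<Rightarrow> 'h) set" where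
  "commutant H A = {T \<in> bounded_ops H. \<forall>S\<in>A. op_mult H T S = op_mult H S T}"

definition von_neumann_algebra :: "'h hilbert \<Rightarrow> ('h \<Rightarrow> 'h) set \<Rightarrow> bool" where
  "von_neumann_algebra H A \<longleftrightarrow>
     A \<subseteq> bounded_ops H \<and> adjoint_op H ` A \<subseteq> A \<and> commutant H (commutant H A) = A"

definition vn_generated :: "'h hilbert \<Rightarrow> ('h \<Rightarrow> 'h) set \<Rightarrow> ('h \<Rightarrow> 'h) set" where
  "vn_generated H S = commutant H (commutant H (S \<union> adjoint_op H ` S))"

definition factor :: "'h hilbert \<Rightarrow> ('h \<Rightarrow> 'h) set \<Rightarrow> bool" where
  "factor H A \<longleftrightarrow> von_neumann_algebra H A \<and> op_one H \<noteq> op_zero H \<and>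
     A \<inter> commutant H A = {op_scale H c (op_one H) | c. True}"

definition projections :: "'h hilbert \<Rightarrow> ('h \<Rightarrow> 'h) set \<Rightarrow> ('h \<Rightarrow> 'h) set" where
  "projections H A = {p \<in> A. op_mult H p p = p \<and> adjoint_op H p = p}"

definition minimal_projection :: "'h hilbert \<Rightarrow> ('h \<Rightarrow> 'h) set \<Rightarrow> ('h \<Rightarrow> 'h) \<Rightarrow> bool" where
  "minimal_projection H A p \<longleftrightarrow> p \<in> projections H A \<and> p \<noteq> op_zero H \<and>
     (\<forall>q\<in>projections H A. op_mult H p q = q \<longrightarrow> q = op_zero H \<or> q = p)"

text \<open>Every isometry in the algebra is unitary.\<close>

definition finite_vn :: "'h hilbert \<Rightarrow> ('h \<Rightarrow> 'h) set \<Rightarrow> bool" where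
  "finite_vn H A \<longleftrightarrow> (\<forall>v\<in>A. op_mult H (adjoint_op H v) v = op_one H \<longrightarrow>
     op_mult H v (adjoint_op H v) = op_one H)"

text \<open>A factor is of type II if it is semifinite without minimal projections; type II\<open>\<^sub>1\<close> is the
  case in which it is finite.\<close>

definition II1_factor :: "'h hilbert \<Rightarrow> ('h \<Rightarrow> 'h) set \<Rightarrow> bool" where
  "II1_factor H A \<longleftrightarrow> factor H A \<and> finite_vn H A \<and> (\<nexists>p. minimal_projection H A p)"

definition star_isomorphic ::
  "'h hilbert \<Rightarrow> ('h \<Rightarrow> 'h) set \<Rightarrow> 'k hilbert \<Rightarrow> ('k \<Rightarrow> 'k) set \<Rightarrow> bool" where
  "star_isomorphic H A K B \<longleftrightarrow> (\<exists>\<theta>. bij_betw \<theta> A B \<and>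
     (\<forall>S\<in>A. \<forall>T\<in>A. \<theta> (op_add H S T) = op_add K (\<theta> S) (\<theta> T)) \<and>
     (\<forall>c. \<forall>T\<in>A. \<theta> (op_scale H c T) = op_scale K c (\<theta> T)) \<and>
     (\<forall>S\<in>A. \<forall>T\<in>A. \<theta> (op_mult H S T) = op_mult K (\<theta> S) (\<theta> T)) \<and>
     (\<forall>T\<in>A. \<theta> (adjoint_op H T) = adjoint_op K (\<theta> T)))"


section \<open>The Hilbert space of square integrable functions\<close>

definition l2_functions :: "'a measure \<Rightarrow> ('a \<Rightarrow> complex) set" where
  "l2_functions \<mu> = {f \<in> borel_measurable \<mu>. integrable \<mu> (\<lambda>x. (cmod (f x))\<^sup>2)}"

definition l2_class :: "'a measure \<Rightarrow> ('a \<Rightarrow> complex) \<Rightarrow> ('a \<Rightarrow> complex) set" where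
  "l2_class \<mu> f = {g \<in> l2_functions \<mu>. AE x in \<mu>. g x = f x}"

definition l2_rep :: "('a \<Rightarrow> complex) set \<Rightarrow> 'a \<Rightarrow> complex" where
  "l2_rep F = (SOME f. f \<in> F)"

definition L2 :: "'a measure \<Rightarrow> ('a \<Rightarrow> complex) set hilbert" where
  "L2 \<mu> = \<lparr>vecs = l2_class \<mu> ` l2_functions \<mu>,
     vadd = (\<lambda>F G. l2_class \<mu> (\<lambda>x. l2_rep F x + l2_rep G x)),
     vzero = l2_class \<mu> (\<lambda>_. 0),
     vscale = (\<lambda>c F. l2_class \<mu> (\<lambda>x. c * l2_rep F x)),
     vinner = (\<lambda>F G. \<integral>x. l2_rep F x * cnj (l2_rep G x) \<partial>\<mu>)\<rparr>"

text \<open>The operator induced by a transformation of functions compatible with equality almost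
  everywhere.\<close>

definition l2_op ::
  "'a measure \<Rightarrow> (('a \<Rightarrow> complex) \<Rightarrow> 'a \<Rightarrow> complex) \<Rightarrow>
    ('a \<Rightarrow> complex) set \<Rightarrow> ('a \<Rightarrow> complex) set" where
  "l2_op \<mu> \<Phi> = (\<lambda>F\<in>vecs (L2 \<mu>). l2_class \<mu> (\<Phi> (l2_rep F)))"

definition l2_tensor ::
  "'a measure \<Rightarrow> 'b measure \<Rightarrow> ('a \<Rightarrow> complex) set \<Rightarrow> ('b \<Rightarrow> complex) set \<Rightarrow>
    ('a \<times> 'b \<Rightarrow> complex) set" where
  "l2_tensor \<mu> \<nu> F G = l2_class (\<mu> \<Otimes>\<^sub>M \<nu>) (\<lambda>(x, y). l2_rep F x * l2_rep G y)"

text \<open>The von Neumann algebra tensor product, for sigma-finite \<open>\<mu>\<close> and \<open>\<nu>\<close>: the Hilbert space tensor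
  product of the two \<open>L\<^sup>2\<close> spaces is the \<open>L\<^sup>2\<close> space of the product measure, and the generators
  are the operators \<open>S \<otimes> T\<close>.\<close>

definition vn_tensor ::
  "'a measure \<Rightarrow> 'b measure \<Rightarrow>
    (('a \<Rightarrow> complex) set \<Rightarrow> ('a \<Rightarrow> complex) set) set \<Rightarrow>
    (('b \<Rightarrow> complex) set \<Rightarrow> ('b \<Rightarrow> complex) set) set \<Rightarrow>
    (('a \<times> 'b \<Rightarrow> complex) set \<Rightarrow> ('a \<times> 'b \<Rightarrow> complex) set) set" where
  "vn_tensor \<mu> \<nu> A B = vn_generated (L2 (\<mu> \<Otimes>\<^sub>M \<nu>))
     {W \<in> bounded_ops (L2 (\<mu> \<Otimes>\<^sub>M \<nu>)). \<exists>S\<in>A. \<exists>T\<in>B.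
        \<forall>F\<in>vecs (L2 \<mu>). \<forall>G\<in>vecs (L2 \<nu>).
          W (l2_tensor \<mu> \<nu> F G) = l2_tensor \<mu> \<nu> (S F) (T G)}"


section \<open>McDuff factors\<close>

text \<open>The group von Neumann algebra, generated by the left regular representation.\<close>

definition group_vn ::
  "('g, 'm) monoid_scheme \<Rightarrow> (('g \<Rightarrow> complex) set \<Rightarrow> ('g \<Rightarrow> complex) set) set" where
  "group_vn G = vn_generated (L2 (count_space (carrier G)))
     {l2_op (count_space (carrier G)) (\<lambda>\<xi> h. \<xi> (inv\<^bsub>G\<^esub> g \<otimes>\<^bsub>G\<^esub> h)) | g. g \<in> carrier G}"

definition finitary_sym_group :: "(nat \<Rightarrow> nat) monoid" where
  "finitary_sym_group =
     \<lparr>carrier = {p. bij p \<and> finite {n. p n \<noteq> n}}, mult = (\<circ>), one = id\<rparr>"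

text \<open>The hyperfinite II\<open>\<^sub>1\<close> factor, unique up to isomorphism by Murray and von Neumann, in its
  realization as the von Neumann algebra of the group of finitely supported permutations of the
  naturals: this group is icc, so that its von Neumann algebra is a II\<open>\<^sub>1\<close> factor, and it is an
  increasing union of finite groups, so that this factor is generated by an increasing sequence of
  finite dimensional \<open>*\<close>-subalgebras.\<close>

abbreviation R_space :: "(nat \<Rightarrow> nat) measure" where
  "R_space \<equiv> count_space (carrier finitary_sym_group)"

definition hyperfinite_R ::
  "(((nat \<Rightarrow> nat) \<Rightarrow> complex) set \<Rightarrow> ((nat \<Rightarrow> nat) \<Rightarrow> complex) set) set" where
  "hyperfinite_R = group_vn finitary_sym_group"

definition McDuff_factor ::
  "'a measure \<Rightarrow> (('a \<Rightarrow> complex) set \<Rightarrow> ('a \<Rightarrow> complex) set) set \<Rightarrow> bool" where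
  "McDuff_factor \<mu> A \<longleftrightarrow> II1_factor (L2 \<mu>) A \<and>
     star_isomorphic (L2 \<mu>) A (L2 (\<mu> \<Otimes>\<^sub>M R_space)) (vn_tensor \<mu> R_space A hyperfinite_R)"


section \<open>Free ergodic actions and crossed products\<close>

definition standard_prob_space :: "'x measure \<Rightarrow> bool" where
  "standard_prob_space \<mu> \<longleftrightarrow> prob_space \<mu> \<and>
     (\<exists>T. completely_metrizable_space T \<and> second_countable T \<and> topspace T = space \<mu> \<and>
        sets \<mu> = sigma_sets (topspace T) {U. openin T U})"

definition pmp_action ::
  "('g, 'm) monoid_scheme \<Rightarrow> 'x measure \<Rightarrow> ('g \<Rightarrow> 'x \<Rightarrow> 'x) \<Rightarrow> bool" where
  "pmp_action G \<mu> \<phi> \<longleftrightarrow> standard_prob_space \<mu> \<and> group_action G (space \<mu>) \<phi> \<and>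
     (\<forall>g\<in>carrier G. \<phi> g \<in> measurable \<mu> \<mu> \<and> distr \<mu> \<mu> (\<phi> g) = \<mu>)"

definition essentially_free ::
  "('g, 'm) monoid_scheme \<Rightarrow> 'x measure \<Rightarrow> ('g \<Rightarrow> 'x \<Rightarrow> 'x) \<Rightarrow> bool" where
  "essentially_free G \<mu> \<phi> \<longleftrightarrow> (\<forall>g\<in>carrier G. g \<noteq> \<one>\<^bsub>G\<^esub> \<longrightarrow> (AE x in \<mu>. \<phi> g x \<noteq> x))"

definition ergodic_action ::
  "('g, 'm) monoid_scheme \<Rightarrow> 'x measure \<Rightarrow> ('g \<Rightarrow> 'x \<Rightarrow> 'x) \<Rightarrow> bool" where
  "ergodic_action G \<mu> \<phi> \<longleftrightarrow>
     (\<forall>A\<in>sets \<mu>. (\<forall>g\<in>carrier G. \<phi> g ` A = A) \<longrightarrow> measure \<mu> A = 0 \<or> measure \<mu> A = 1)"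

definition essentially_bounded :: "'x measure \<Rightarrow> ('x \<Rightarrow> complex) set" where
  "essentially_bounded \<mu> = {a \<in> borel_measurable \<mu>. \<exists>C. AE x in \<mu>. cmod (a x) \<le> C}"

abbreviation crossed_space ::
  "('g, 'm) monoid_scheme \<Rightarrow> 'x measure \<Rightarrow> ('x \<times> 'g) measure" where
  "crossed_space G \<mu> \<equiv> \<mu> \<Otimes>\<^sub>M count_space (carrier G)"

text \<open>
  The crossed product acts on \<open>L\<^sup>2(X \<times> G)\<close>. It is generated by the operators
  \<open>a \<otimes> 1\<close> for \<open>a \<in> L\<^sup>\<infinity>(X)\<close> and the unitaries \<open>u\<^sub>g = \<sigma>\<^sub>g \<otimes> \<lambda>\<^sub>g\<close>, where
  \<open>\<sigma>\<^sub>g\<close> is the Koopman representation and \<open>\<lambda>\<close> the left regular one. They satisfy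
  \<open>u\<^sub>g a u\<^sub>g* = a(g\<inverse> \<cdot>)\<close>, and the trace is the vector state of \<open>1 \<otimes> \<delta>\<^sub>e\<close>.
\<close>

definition crossed_product ::
  "('g, 'm) monoid_scheme \<Rightarrow> 'x measure \<Rightarrow> ('g \<Rightarrow> 'x \<Rightarrow> 'x) \<Rightarrow>
    (('x \<times> 'g \<Rightarrow> complex) set \<Rightarrow> ('x \<times> 'g \<Rightarrow> complex) set) set" where
  "crossed_product G \<mu> \<phi> = vn_generated (L2 (crossed_space G \<mu>))
     ({l2_op (crossed_space G \<mu>) (\<lambda>\<xi> (x, h). a x * \<xi> (x, h)) | a. a \<in> essentially_bounded \<mu>} \<union>
      {l2_op (crossed_space G \<mu>) (\<lambda>\<xi> (x, h). \<xi> (\<phi> (inv\<^bsub>G\<^esub> g) x, inv\<^bsub>G\<^esub> g \<otimes>\<^bsub>G\<^esub> h)) | g.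
         g \<in> carrier G})"

text \<open>The type argument is the type of the points of the probability space; HOL cannot quantify
  over it inside the definition.\<close>

definition McDuff_group :: "'x itself \<Rightarrow> ('g, 'm) monoid_scheme \<Rightarrow> bool" where
  "McDuff_group (_ :: 'x itself) G \<longleftrightarrow> (\<exists>(\<mu> :: 'x measure) \<phi>.
     pmp_action G \<mu> \<phi> \<and> essentially_free G \<mu> \<phi> \<and> ergodic_action G \<mu> \<phi> \<and>
     McDuff_factor (crossed_space G \<mu>) (crossed_product G \<mu> \<phi>))"


section \<open>Inner amenability\<close>

definition inner_amenable :: "('g, 'm) monoid_scheme \<Rightarrow> bool" where
  "inner_amenable G \<longleftrightarrow> (\<exists>m :: 'g set \<Rightarrow> real.
     (\<forall>A\<in>Pow (carrier G). 0 \<le> m A) \<and> m (carrier G) = 1 \<and>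
     (\<forall>A\<in>Pow (carrier G). \<forall>B\<in>Pow (carrier G). A \<inter> B = {} \<longrightarrow> m (A \<union> B) = m A + m B) \<and>
     (\<forall>g\<in>carrier G. \<forall>A\<in>Pow (carrier G). m ((\<lambda>x. g \<otimes>\<^bsub>G\<^esub> x \<otimes>\<^bsub>G\<^esub> inv\<^bsub>G\<^esub> g) ` A) = m A) \<and>
     (\<forall>U\<in>Pow (carrier G). finite U \<longrightarrow> m U = 0))"

end

theory Submission
  imports Defs
begin

text \<open>
  Let \<open>M\<close> be the crossed product with its trace vector \<open>\<xi> = 1 \<otimes> \<delta>\<^sub>e\<close>, let \<open>N = M \<otimes> R\<close>, and let
  \<open>\<theta> : M \<rightarrow> N\<close> be an isomorphism. The adjacent transpositions \<open>s\<^sub>n = (n  n+1)\<close> are unitaries \<open>1 \<otimes> s\<^sub>n\<close> of \<open>N\<close>.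
  Every finitely supported permutation commutes with \<open>s\<^sub>n\<close> for large \<open>n\<close>, so these unitaries commute
  asymptotically with all of \<open>N\<close> (\<open>conjugation_tendsto\<close>), whereas \<open>s\<^sub>n\<close> and \<open>s\<^sub>n\<^sub>+\<^sub>1\<close> never commute. Their preimages
  \<open>x\<^sub>n\<close> and \<open>y\<^sub>n\<close> in \<open>M\<close> are two central sequences that do not commute asymptotically
  (\<open>McDuff_central_sequences\<close>).

  For this transfer between \<open>N\<close> and \<open>M\<close>, the isomorphism and its inverse, which are given only
  algebraically, have to be continuous: a bounded sequence that tends to zero at a separating vector is
  mapped to a sequence that tends to zero strongly (\<open>hom_normal\<close>). The order of \<open>M\<close> is encoded in the
  invertibility of the elements \<open>T + t\<close> and thus preserved by \<open>\<theta>\<close>, and suprema of monotone sequences are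
  determined by the order. The elements \<open>1 - (1 + \<Sum> z\<^sub>k\<^sup>* z\<^sub>k)\<^sup>-\<^sup>1\<close> replace a summable sequence
  \<open>z\<^sub>k\<^sup>* z\<^sub>k\<close> by bounded monotone ones. The separating vectors come from right multiplications: these lie in the
  commutant and move the trace vector to a total set. All generators and all right multiplications are weighted
  composition operators on \<open>L\<^sup>2\<close> spaces.

  An isometry \<open>x \<in> M\<close> has Fourier coefficients \<open>E(x u\<^sub>h\<^sup>*)\<close>, and \<open>|x \<xi>|\<^sup>2\<close> distributes a unit mass over
  \<open>G\<close>. For a central sequence \<open>x\<^sub>n\<close> this mass becomes invariant under conjugation
  (\<open>central_mass_conjugation\<close>). The mass at any \<open>h \<noteq> e\<close> tends to zero (\<open>central_mass_singleton\<close>), because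
  commutation with \<open>L\<^sup>\<infinity>(X)\<close> forces the coefficient at \<open>h\<close> to vanish where \<open>h\<close> moves points, which is
  almost everywhere. The mass at \<open>e\<close> cannot tend to one for both \<open>x\<^sub>n\<close> and \<open>y\<^sub>n\<close>: then both would be
  close to elements of the abelian algebra \<open>L\<^sup>\<infinity>(X)\<close> and would commute asymptotically
  (\<open>commutator_le_defects\<close>). So for one of them a fixed amount of mass stays off \<open>e\<close> along a subsequence. A
  cluster point of the mass distributions in \<open>[0, 1]\<close>-valued functions on the subsets of \<open>G\<close>, restricted to the
  complement of \<open>e\<close> and normalized, is the required mean.
\<close>

section \<open>Hilbert spaces given by a carrier\<close>

text \<open>The vector space laws are consequences of the linearity of the inner product, because vectors with equal
  inner products are equal. Equations between vectors and between operators are therefore proved below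
  by comparing inner products.\<close>

locale hilbert_space =
  fixes H :: "'h hilbert"
  assumes vadd_closed: "\<lbrakk>x \<in> vecs H; y \<in> vecs H\<rbrakk> \<Longrightarrow> vadd H x y \<in> vecs H"
    and vzero_closed: "vzero H \<in> vecs H"
    and vscale_closed: "x \<in> vecs H \<Longrightarrow> vscale H c x \<in> vecs H"
    and inner_add_left: "\<lbrakk>x \<in> vecs H; y \<in> vecs H; z \<in> vecs H\<rbrakk> \<Longrightarrow>
      vinner H (vadd H x y) z = vinner H x z + vinner H y z"
    and inner_scale_left: "\<lbrakk>x \<in> vecs H; z \<in> vecs H\<rbrakk> \<Longrightarrow>
      vinner H (vscale H c x) z = c * vinner H x z"
    and inner_zero_left: "z \<in> vecs H \<Longrightarrow> vinner H (vzero H) z = 0"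
    and inner_commute: "\<lbrakk>x \<in> vecs H; y \<in> vecs H\<rbrakk> \<Longrightarrow> vinner H y x = cnj (vinner H x y)"
    and inner_nonneg: "x \<in> vecs H \<Longrightarrow> 0 \<le> Re (vinner H x x)"
    and inner_ext: "\<lbrakk>x \<in> vecs H; y \<in> vecs H; \<And>z. z \<in> vecs H \<Longrightarrow> vinner H x z = vinner H y z\<rbrakk>
      \<Longrightarrow> x = y"
    and complete: "\<lbrakk>\<And>n. X n \<in> vecs H;
      \<And>e. 0 < e \<Longrightarrow> \<exists>N. \<forall>m\<ge>N. \<forall>n\<ge>N. vnorm H (vadd H (X m) (vscale H (-1) (X n))) < e\<rbrakk>
      \<Longrightarrow> \<exists>L\<in>vecs H. (\<lambda>n. vnorm H (vadd H (X n) (vscale H (-1) L))) \<longlonglongrightarrow> 0"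
begin

abbreviation V where "V \<equiv> vecs H"
abbreviation ip where "ip \<equiv> vinner H"
abbreviation ops where "ops \<equiv> bounded_ops H"

definition vsub where "vsub x y = vadd H x (vscale H (-1) y)"

lemma vsub_closed: "\<lbrakk>x \<in> V; y \<in> V\<rbrakk> \<Longrightarrow> vsub x y \<in> V"
  by (simp add: vsub_def vadd_closed vscale_closed)

lemma inner_sub_left: "\<lbrakk>x \<in> V; y \<in> V; z \<in> V\<rbrakk> \<Longrightarrow> ip (vsub x y) z = ip x z - ip y z"
  by (simp add: vsub_def inner_add_left inner_scale_left vscale_closed)

lemma inner_add_right:
  assumes "x \<in> V" "y \<in> V" "z \<in> V"
  shows "ip z (vadd H x y) = ip z x + ip z y"
  using inner_commute[of "vadd H x y" z] inner_commute[of x z] inner_commute[of y z] assms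
  by (simp add: inner_add_left vadd_closed)

lemma inner_scale_right:
  assumes "x \<in> V" "z \<in> V"
  shows "ip z (vscale H c x) = cnj c * ip z x"
  using inner_commute[of "vscale H c x" z] inner_commute[of x z] assms
  by (simp add: inner_scale_left vscale_closed)

lemma inner_zero_right: "z \<in> V \<Longrightarrow> ip z (vzero H) = 0"
  using inner_commute[of "vzero H" z] by (simp add: inner_zero_left vzero_closed)

lemma inner_sub_right: "\<lbrakk>x \<in> V; y \<in> V; z \<in> V\<rbrakk> \<Longrightarrow> ip z (vsub x y) = ip z x - ip z y"
  by (simp add: vsub_def inner_add_right inner_scale_right vscale_closed)

lemmas inner_simps = inner_add_left inner_add_right inner_scale_left inner_scale_right
  inner_zero_left inner_zero_right inner_sub_left inner_sub_right
lemmas closed = vadd_closed vzero_closed vscale_closed vsub_closed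

lemma inner_self: "x \<in> V \<Longrightarrow> ip x x = of_real (Re (ip x x))"
  using inner_commute[of x x] by (simp add: complex_eq_iff)

lemma inner_ext_right:
  assumes "x \<in> V" "y \<in> V" "\<And>z. z \<in> V \<Longrightarrow> ip z x = ip z y"
  shows "x = y"
  using assms inner_ext[of x y] inner_commute by metis

lemma norm_sq: "x \<in> V \<Longrightarrow> (vnorm H x)\<^sup>2 = Re (ip x x)"
  by (simp add: vnorm_def inner_nonneg)

lemma norm_nonneg: "x \<in> V \<Longrightarrow> 0 \<le> vnorm H x"
  by (simp add: vnorm_def inner_nonneg)

lemma Re_inner_commute: "\<lbrakk>x \<in> V; y \<in> V\<rbrakk> \<Longrightarrow> Re (ip y x) = Re (ip x y)"
  using inner_commute[of x y] by simp


subsection \<open>Bounded operators\<close>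

lemma op_closed: "\<lbrakk>T \<in> ops; x \<in> V\<rbrakk> \<Longrightarrow> T x \<in> V"
  by (auto simp: bounded_ops_def)

lemma op_vadd: "\<lbrakk>T \<in> ops; x \<in> V; y \<in> V\<rbrakk> \<Longrightarrow> T (vadd H x y) = vadd H (T x) (T y)"
  by (auto simp: bounded_ops_def)

lemma op_vscale: "\<lbrakk>T \<in> ops; x \<in> V\<rbrakk> \<Longrightarrow> T (vscale H c x) = vscale H c (T x)"
  by (auto simp: bounded_ops_def)

lemma op_vsub: "\<lbrakk>T \<in> ops; x \<in> V; y \<in> V\<rbrakk> \<Longrightarrow> T (vsub x y) = vsub (T x) (T y)"
  by (simp add: vsub_def op_vadd op_vscale vscale_closed)

lemma op_ext: "\<lbrakk>S \<in> ops; T \<in> ops; \<And>x. x \<in> V \<Longrightarrow> S x = T x\<rbrakk> \<Longrightarrow> S = T"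
  unfolding bounded_ops_def by (auto intro: PiE_ext)

lemma op_inner_ext:
  assumes "S \<in> ops" "T \<in> ops" "\<And>x y. \<lbrakk>x \<in> V; y \<in> V\<rbrakk> \<Longrightarrow> ip (S x) y = ip (T x) y"
  shows "S = T"
  using assms by (intro op_ext inner_ext) (auto intro: op_closed)

lemma op_bound:
  assumes "T \<in> ops"
  obtains C where "0 \<le> C" "\<And>x. x \<in> V \<Longrightarrow> Re (ip (T x) (T x)) \<le> C * Re (ip x x)"
proof -
  obtain C where C: "\<forall>x\<in>V. vnorm H (T x) \<le> C * vnorm H x"
    using assms by (auto simp: bounded_ops_def)
  have "Re (ip (T x) (T x)) \<le> C\<^sup>2 * Re (ip x x)" if "x \<in> V" for x
    using power_mono[of "vnorm H (T x)" "C * vnorm H x" 2] C that op_closed[OF assms that]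
    by (simp add: norm_nonneg power_mult_distrib norm_sq)
  then show ?thesis using that[of "C\<^sup>2"] by simp
qed

lemma op_bound':
  assumes "T \<in> ops"
  obtains C where "0 < C" "\<And>x. x \<in> V \<Longrightarrow> Re (ip (T x) (T x)) \<le> C * Re (ip x x)"
proof -
  obtain C where C: "0 \<le> C" "\<And>x. x \<in> V \<Longrightarrow> Re (ip (T x) (T x)) \<le> C * Re (ip x x)"
    using op_bound[OF assms] by blast
  have "Re (ip (T x) (T x)) \<le> (C + 1) * Re (ip x x)" if "x \<in> V" for x
    using C(2)[OF that] inner_nonneg[OF that] by (simp add: algebra_simps)
  then show ?thesis using that[of "C + 1"] C(1) by simp
qed

lemma opsI:
  assumes "\<And>x. x \<in> V \<Longrightarrow> T x \<in> V" "T \<in> extensional V"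
    and "\<And>x y. \<lbrakk>x \<in> V; y \<in> V\<rbrakk> \<Longrightarrow> T (vadd H x y) = vadd H (T x) (T y)"
    and "\<And>c x. x \<in> V \<Longrightarrow> T (vscale H c x) = vscale H c (T x)"
    and "\<And>x. x \<in> V \<Longrightarrow> Re (ip (T x) (T x)) \<le> C * Re (ip x x)"
  shows "T \<in> ops"
proof -
  have "vnorm H (T x) \<le> sqrt \<bar>C\<bar> * vnorm H x" if "x \<in> V" for x
  proof -
    have "Re (ip (T x) (T x)) \<le> \<bar>C\<bar> * Re (ip x x)"
      using assms(5)[OF that] inner_nonneg[OF that]
      by (meson abs_ge_self mult_right_mono order_trans)
    then show ?thesis unfolding vnorm_def real_sqrt_mult[symmetric] by simp
  qed
  then show ?thesis
    unfolding bounded_ops_def using assms(1-4) by (auto simp: PiE_iff)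
qed

text \<open>Linearity can be checked on matrix coefficients, because vectors are determined by their
  inner products.\<close>

lemma opsI_inner:
  assumes cl: "\<And>x. x \<in> V \<Longrightarrow> T x \<in> V" and ext: "T \<in> extensional V"
    and add: "\<And>x y z. \<lbrakk>x \<in> V; y \<in> V; z \<in> V\<rbrakk> \<Longrightarrow> ip (T (vadd H x y)) z = ip (T x) z + ip (T y) z"
    and scl: "\<And>c x z. \<lbrakk>x \<in> V; z \<in> V\<rbrakk> \<Longrightarrow> ip (T (vscale H c x)) z = c * ip (T x) z"
    and bd: "\<And>x. x \<in> V \<Longrightarrow> Re (ip (T x) (T x)) \<le> C * Re (ip x x)"
  shows "T \<in> ops"
proof (rule opsI[OF cl ext _ _ bd])
  show "T (vadd H x y) = vadd H (T x) (T y)" if "x \<in> V" "y \<in> V" for x y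
    using that by (intro inner_ext) (auto simp: add inner_simps cl closed)
  show "T (vscale H c x) = vscale H c (T x)" if "x \<in> V" for c x
    using that by (intro inner_ext) (auto simp: scl inner_simps cl closed)
qed

definition hermitian where
  "hermitian T \<longleftrightarrow> (\<forall>x\<in>V. \<forall>y\<in>V. ip (T x) y = ip x (T y))"

abbreviation qf where "qf T x \<equiv> Re (ip (T x) x)"

lemma qf_diff_scale:
  assumes T: "T \<in> ops" "hermitian T" and x: "x \<in> V" and y: "y \<in> V"
  shows "qf T (vsub x (vscale H s y)) = qf T x - 2 * Re (cnj s * ip (T x) y) + (cmod s)\<^sup>2 * qf T y"
proof -
  have "ip (T y) x = cnj (ip (T x) y)"
    using T(2) x y inner_commute[of "T x" y] op_closed[OF T(1) x] by (simp add: hermitian_def)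
  moreover have "(cmod s)\<^sup>2 = Re s * Re s + Im s * Im s"
    unfolding cmod_power2 by (simp add: power2_eq_square)
  ultimately show ?thesis
    using x y
    by (simp add: op_vsub[OF T(1)] op_vscale[OF T(1)] closed inner_simps op_closed[OF T(1)]
        algebra_simps)
qed

text \<open>The polynomial is the form of a positive operator at \<open>x - t \<langle>T x, y\<rangle> y\<close>, with \<open>a\<close> and \<open>d\<close> its values at
  \<open>x\<close> and \<open>y\<close> and \<open>c = |\<langle>T x, y\<rangle>|\<^sup>2\<close>. It is minimal at \<open>t = 1/d\<close>, and linear when \<open>d = 0\<close>.\<close>

lemma discriminant_bound:
  fixes a c d :: real
  assumes ineq: "\<And>t. 0 \<le> a - 2 * t * c + t\<^sup>2 * (c * d)" and "0 \<le> c" "0 \<le> d" "0 \<le> a"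
  shows "c \<le> a * d"
proof (cases "d = 0")
  case True
  show ?thesis
  proof (rule ccontr)
    assume "\<not> c \<le> a * d"
    then have "0 < c" using True by simp
    then show False using ineq[of "(a + 1) / (2 * c)"] True by (simp add: field_simps)
  qed
next
  case False
  then have "0 < d" using assms by simp
  then show ?thesis using ineq[of "1 / d"] by (simp add: field_simps power2_eq_square)
qed

lemma form_cauchy_schwarz:
  assumes T: "T \<in> ops" "hermitian T" "\<And>x. x \<in> V \<Longrightarrow> 0 \<le> qf T x"
    and x: "x \<in> V" and y: "y \<in> V"
  shows "(cmod (ip (T x) y))\<^sup>2 \<le> qf T x * qf T y"
proof (rule discriminant_bound)
  fix t :: real
  let ?b = "ip (T x) y"
  have "0 \<le> qf T (vsub x (vscale H (of_real t * ?b) y))"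
    using x y by (intro T(3) closed)
  also have "\<dots> = qf T x - 2 * Re (cnj (of_real t * ?b) * ?b) + (cmod (of_real t * ?b))\<^sup>2 * qf T y"
    by (rule qf_diff_scale[OF T(1,2) x y])
  also have "Re (cnj (of_real t * ?b) * ?b) = t * (cmod ?b)\<^sup>2"
    unfolding cmod_power2 by (simp add: power2_eq_square algebra_simps)
  finally show "0 \<le> qf T x - 2 * t * (cmod ?b)\<^sup>2 + t\<^sup>2 * ((cmod ?b)\<^sup>2 * qf T y)"
    by (simp add: norm_mult power_mult_distrib algebra_simps)
qed (use T(3) x y in auto)

lemma op_one_apply: "x \<in> V \<Longrightarrow> op_one H x = x"
  by (simp add: op_one_def)

lemma op_one_in_ops: "op_one H \<in> ops"
  by (rule opsI[where C = 1]) (auto simp: op_one_def closed)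

lemma hermitian_one: "hermitian (op_one H)"
  by (simp add: hermitian_def op_one_apply)

lemma cauchy_schwarz:
  assumes "x \<in> V" "y \<in> V"
  shows "(cmod (ip x y))\<^sup>2 \<le> Re (ip x x) * Re (ip y y)"
  using form_cauchy_schwarz[OF op_one_in_ops hermitian_one, of x y] assms
  by (simp add: op_one_apply inner_nonneg)

lemma cauchy_schwarz_norm:
  assumes "x \<in> V" "y \<in> V"
  shows "cmod (ip x y) \<le> vnorm H x * vnorm H y"
  using cauchy_schwarz[OF assms] assms
  by (intro power2_le_imp_le[of "cmod (ip x y)"])
    (auto simp: power_mult_distrib norm_sq norm_nonneg)

lemma norm_vadd_le:
  assumes x: "x \<in> V" and y: "y \<in> V"
  shows "vnorm H (vadd H x y) \<le> vnorm H x + vnorm H y"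
proof (rule power2_le_imp_le)
  have "Re (ip x y) \<le> vnorm H x * vnorm H y"
    using cauchy_schwarz_norm[OF x y] complex_Re_le_cmod order_trans by blast
  then show "(vnorm H (vadd H x y))\<^sup>2 \<le> (vnorm H x + vnorm H y)\<^sup>2"
    using x y Re_inner_commute[OF x y]
    by (simp add: norm_sq closed inner_simps power2_sum)
qed (use x y norm_nonneg in auto)

lemma norm_vscale:
  assumes "x \<in> V"
  shows "vnorm H (vscale H c x) = cmod c * vnorm H x"
proof (rule power2_eq_imp_eq)
  have "Im (ip x x) = 0" using inner_commute[OF assms assms] by (simp add: complex_eq_iff)
  moreover have "(cmod c)\<^sup>2 = Re c * Re c + Im c * Im c"
    unfolding cmod_power2 by (simp add: power2_eq_square)
  ultimately show "(vnorm H (vscale H c x))\<^sup>2 = (cmod c * vnorm H x)\<^sup>2"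
    using assms by (simp add: norm_sq closed inner_simps power_mult_distrib algebra_simps)
qed (use assms in \<open>auto simp: closed norm_nonneg\<close>)

lemma norm_vsub_triangle:
  assumes x: "x \<in> V" and y: "y \<in> V" and z: "z \<in> V"
  shows "vnorm H (vsub x z) \<le> vnorm H (vsub x y) + vnorm H (vsub y z)"
proof -
  have "vsub x z = vadd H (vsub x y) (vsub y z)"
    using assms by (intro inner_ext) (auto simp: inner_simps closed)
  then show ?thesis using norm_vadd_le[of "vsub x y" "vsub y z"] assms by (simp add: closed)
qed

lemma norm_zero_iff:
  assumes "x \<in> V" shows "vnorm H x = 0 \<longleftrightarrow> x = vzero H"
proof
  assume "vnorm H x = 0"
  then have "ip x z = 0" if "z \<in> V" for z
    using cauchy_schwarz_norm[OF assms that] by simp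
  then show "x = vzero H" using assms by (intro inner_ext) (auto simp: closed inner_simps)
next
  assume "x = vzero H"
  then show "vnorm H x = 0" by (simp add: vnorm_def inner_zero_left vzero_closed)
qed

lemma inner_self_zero:
  assumes "x \<in> V" "Re (ip x x) = 0" shows "x = vzero H"
  using norm_zero_iff[OF assms(1)] assms(2) by (simp add: vnorm_def)

lemma op_zero_vec: "T \<in> ops \<Longrightarrow> T (vzero H) = vzero H"
proof -
  assume T: "T \<in> ops"
  have "vzero H = vscale H 0 (vzero H)"
    by (intro inner_ext) (auto simp: closed inner_simps)
  then have "T (vzero H) = vscale H 0 (T (vzero H))"
    using op_vscale[OF T vzero_closed] by metis
  also have "\<dots> = vzero H" using op_closed[OF T vzero_closed]
    by (intro inner_ext) (auto simp: closed inner_simps)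
  finally show ?thesis .
qed


subsection \<open>The Riesz representation theorem and adjoints\<close>

text \<open>The quadratic functional \<open>J x = \<langle>T x, x\<rangle> - 2 Re f(x)\<close> of a coercive form is bounded below, and by
  the parallelogram law its minimizing sequences are Cauchy sequences. Perturbing an almost minimal
  vector \<open>x\<^sub>n\<close> shows that \<open>\<langle>T x, x\<^sub>n\<rangle>\<close> is almost \<open>f x\<close>. For \<open>T = 1\<close> this gives the Riesz
  representation theorem, in general it solves \<open>T u = v\<close>.\<close>

lemma coercive_representation:
  assumes T: "T \<in> ops" "hermitian T" and t: "0 < t"
    and coercive: "\<And>x. x \<in> V \<Longrightarrow> t * Re (ip x x) \<le> qf T x"
    and f_add: "\<And>x y. \<lbrakk>x \<in> V; y \<in> V\<rbrakk> \<Longrightarrow> f (vadd H x y) = f x + f y"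
    and f_scale: "\<And>c x. x \<in> V \<Longrightarrow> f (vscale H c x) = c * f x"
    and f_bound: "\<And>x. x \<in> V \<Longrightarrow> cmod (f x) \<le> C * vnorm H x"
  shows "\<exists>u\<in>V. \<forall>x\<in>V. ip (T x) u = f x"
proof -
  have pos: "0 \<le> qf T x" if "x \<in> V" for x
    using coercive[OF that] inner_nonneg[OF that] t
    by (meson mult_nonneg_nonneg less_imp_le order_trans)
  define J where "J x = qf T x - 2 * Re (f x)" for x
  have lower: "- (C\<^sup>2 / t) \<le> J x" if x: "x \<in> V" for x
  proof -
    have "Re (f x) \<le> C * vnorm H x"
      using f_bound[OF x] complex_Re_le_cmod order_trans by blast
    moreover have "t * (vnorm H x)\<^sup>2 \<le> qf T x" using coercive[OF x] x by (simp add: norm_sq)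
    moreover have "t * (vnorm H x - C / t)\<^sup>2 = t * (vnorm H x)\<^sup>2 - 2 * (C * vnorm H x) + C\<^sup>2 / t"
      using t by (simp add: power2_diff field_simps power2_eq_square)
    moreover have "0 \<le> t * (vnorm H x - C / t)\<^sup>2" using t by simp
    ultimately show ?thesis unfolding J_def by linarith
  qed
  define i where "i = Inf (J ` V)"
  have bdd: "bdd_below (J ` V)" using lower by (auto intro!: bdd_belowI2)
  have iJ: "i \<le> J x" if "x \<in> V" for x
    unfolding i_def using bdd that by (auto intro: cInf_lower)
  have "\<exists>x\<in>V. J x < i + inverse (Suc n)" for n
  proof (rule ccontr)
    assume "\<not> ?thesis"
    then have "i + inverse (Suc n) \<le> i"
      unfolding i_def using vzero_closed by (intro cInf_greatest) (auto simp: not_less)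
    moreover have "0 < inverse (real (Suc n))" by simp
    ultimately show False by linarith
  qed
  then obtain X where X: "\<And>n. X n \<in> V" "\<And>n. J (X n) < i + inverse (Suc n)" by metis
  have parallelogram: "t * Re (ip (vsub x y) (vsub x y)) \<le> 2 * (J x + J y - 2 * i)"
    if x: "x \<in> V" and y: "y \<in> V" for x y
  proof -
    let ?m = "vscale H (1/2) (vadd H x y)"
    have Tyx: "Re (ip (T y) x) = Re (ip (T x) y)"
      using T(2) x y Re_inner_commute[OF op_closed[OF T(1) x] y] by (simp add: hermitian_def)
    have "i \<le> J ?m" using x y by (intro iJ closed)
    moreover have "4 * J ?m = qf T x + qf T y + 2 * Re (ip (T x) y) - 4 * Re (f x) - 4 * Re (f y)"
      unfolding J_def using x y
      by (simp add: f_add f_scale closed inner_simps op_vadd[OF T(1)] op_vscale[OF T(1)]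
          op_closed[OF T(1)] Tyx algebra_simps)
    moreover have "qf T (vsub x y) = qf T x + qf T y - 2 * Re (ip (T x) y)"
      using x y by (simp add: op_vsub[OF T(1)] op_closed[OF T(1)] closed inner_simps Tyx)
    moreover have "t * Re (ip (vsub x y) (vsub x y)) \<le> qf T (vsub x y)"
      using x y by (intro coercive closed)
    ultimately show ?thesis by (simp add: J_def)
  qed
  have "\<exists>L\<in>V. (\<lambda>n. vnorm H (vsub (X n) L)) \<longlonglongrightarrow> 0"
    unfolding vsub_def
  proof (rule complete[OF X(1)], fold vsub_def)
    fix e :: real assume e: "0 < e"
    obtain N where N: "inverse (real (Suc N)) < t * e\<^sup>2 / 4"
      using reals_Archimedean[of "t * e\<^sup>2 / 4"] t e by auto
    have "vnorm H (vsub (X m) (X n)) < e" if mn: "N \<le> m" "N \<le> n" for m n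
    proof -
      define r where "r k = inverse (real (Suc k))" for k
      have "r m \<le> r N" "r n \<le> r N" using mn by (auto simp: r_def intro!: le_imp_inverse_le)
      moreover have "J (X m) < i + r m" "J (X n) < i + r n" "4 * r N < t * e\<^sup>2"
        using X(2)[of m] X(2)[of n] N by (auto simp: r_def)
      ultimately have "2 * (J (X m) + J (X n) - 2 * i) < t * e\<^sup>2" by argo
      then have "t * Re (ip (vsub (X m) (X n)) (vsub (X m) (X n))) < t * e\<^sup>2"
        using parallelogram[OF X(1) X(1), of m n] by (rule le_less_trans[rotated])
      then have "(vnorm H (vsub (X m) (X n)))\<^sup>2 < e\<^sup>2"
        using t X(1) by (simp add: norm_sq closed)
      then show ?thesis using e by (simp add: power2_less_imp_less)
    qed
    then show "\<exists>N. \<forall>m\<ge>N. \<forall>n\<ge>N. vnorm H (vsub (X m) (X n)) < e" by blast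
  qed
  then obtain u where u: "u \<in> V" "(\<lambda>n. vnorm H (vsub (X n) u)) \<longlonglongrightarrow> 0" by blast
  have "ip (T x) u = f x" if x: "x \<in> V" for x
  proof -
    define d where "d n = ip (T x) (X n) - f x" for n
    have d_small: "(cmod (d n))\<^sup>2 \<le> inverse (Suc n) * qf T x" for n
    proof (rule discriminant_bound)
      fix s :: real
      let ?z = "vscale H (of_real s * cnj (d n)) x"
      have TX: "ip (T (X n)) x = cnj (ip (T x) (X n))"
        using T(2) x X(1) inner_commute[of "T x" "X n"] op_closed[OF T(1) x]
        by (simp add: hermitian_def)
      have fsub: "f (vsub (X n) ?z) = f (X n) - of_real s * cnj (d n) * f x"
        using x X(1) by (simp add: vsub_def f_add f_scale closed)
      have "i \<le> J (vsub (X n) ?z)" using x X(1) by (intro iJ closed)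
      also have "\<dots> = J (X n) - 2 * Re (of_real s * d n * cnj (d n))
          + s\<^sup>2 * ((cmod (d n))\<^sup>2 * qf T x)"
      proof -
        have "(cmod (of_real s * cnj (d n)))\<^sup>2 = s\<^sup>2 * (cmod (d n))\<^sup>2"
          by (simp add: norm_mult power_mult_distrib)
        then show ?thesis
          unfolding J_def qf_diff_scale[OF T X(1) x] fsub TX by (simp add: d_def algebra_simps)
      qed
      also have "Re (of_real s * d n * cnj (d n)) = s * (cmod (d n))\<^sup>2"
        unfolding cmod_power2 by (simp add: power2_eq_square algebra_simps)
      finally show "0 \<le> inverse (Suc n) - 2 * s * (cmod (d n))\<^sup>2 + s\<^sup>2 * ((cmod (d n))\<^sup>2 * qf T x)"
        using X(2)[of n] by simp
    qed (use pos x in auto)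
    have "(\<lambda>n. (cmod (d n))\<^sup>2) \<longlonglongrightarrow> 0"
    proof (rule Lim_null_comparison)
      show "\<forall>\<^sub>F n in sequentially. norm ((cmod (d n))\<^sup>2) \<le> inverse (Suc n) * qf T x"
        using d_small by (intro always_eventually allI) simp
      show "(\<lambda>n. inverse (Suc n) * qf T x) \<longlonglongrightarrow> 0"
        by (rule tendsto_mult_left_zero[OF LIMSEQ_inverse_real_of_nat])
    qed
    then have "(\<lambda>n. sqrt ((cmod (d n))\<^sup>2)) \<longlonglongrightarrow> sqrt 0" by (rule tendsto_real_sqrt)
    then have d0: "d \<longlonglongrightarrow> 0" by (intro tendsto_norm_zero_cancel[of d]) simp
    have "(\<lambda>n. ip (T x) (X n)) \<longlonglongrightarrow> ip (T x) u"
    proof (rule LIM_zero_cancel, rule Lim_null_comparison)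
      show "\<forall>\<^sub>F n in sequentially.
          cmod (ip (T x) (X n) - ip (T x) u) \<le> vnorm H (T x) * vnorm H (vsub (X n) u)"
      proof (intro always_eventually allI)
        fix n
        show "cmod (ip (T x) (X n) - ip (T x) u) \<le> vnorm H (T x) * vnorm H (vsub (X n) u)"
          using cauchy_schwarz_norm[OF op_closed[OF T(1) x], of "vsub (X n) u"] x X(1) u(1)
            op_closed[OF T(1) x]
          by (simp add: inner_sub_right closed)
      qed
      show "(\<lambda>n. vnorm H (T x) * vnorm H (vsub (X n) u)) \<longlonglongrightarrow> 0"
        using tendsto_mult[OF tendsto_const u(2)] by simp
    qed
    moreover have "(\<lambda>n. ip (T x) (X n)) \<longlonglongrightarrow> f x"
      using d0 unfolding d_def by (rule LIM_zero_cancel)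
    ultimately show ?thesis using LIMSEQ_unique by blast
  qed
  then show ?thesis using u(1) by blast
qed

lemma riesz_representation:
  assumes "\<And>x y. \<lbrakk>x \<in> V; y \<in> V\<rbrakk> \<Longrightarrow> f (vadd H x y) = f x + f y"
    and "\<And>c x. x \<in> V \<Longrightarrow> f (vscale H c x) = c * f x"
    and "\<And>x. x \<in> V \<Longrightarrow> cmod (f x) \<le> C * vnorm H x"
  shows "\<exists>u\<in>V. \<forall>x\<in>V. ip x u = f x"
  using coercive_representation[OF op_one_in_ops hermitian_one, of 1 f C] assms
  by (simp add: op_one_apply)

lemma op_norm_bound:
  assumes "T \<in> ops"
  obtains C where "0 \<le> C" "\<And>x. x \<in> V \<Longrightarrow> vnorm H (T x) \<le> C * vnorm H x"
proof -
  obtain C where C: "\<forall>x\<in>V. vnorm H (T x) \<le> C * vnorm H x"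
    using assms by (auto simp: bounded_ops_def)
  have "vnorm H (T x) \<le> \<bar>C\<bar> * vnorm H x" if "x \<in> V" for x
    using C that norm_nonneg[OF that] by (meson abs_ge_self mult_right_mono order_trans)
  then show ?thesis using that[of "\<bar>C\<bar>"] by simp
qed

text \<open>The vector \<open>T\<^sup>* y\<close> represents the functional \<open>x \<mapsto> \<langle>T x, y\<rangle>\<close>. The estimate
  \<open>\<parallel>T\<^sup>* y\<parallel>\<^sup>2 = \<langle>T T\<^sup>* y, y\<rangle> \<le> C \<parallel>T\<^sup>* y\<parallel> \<parallel>y\<parallel>\<close> bounds it.\<close>

lemma adjoint_exists:
  assumes T: "T \<in> ops"
  shows "\<exists>S\<in>ops. \<forall>x\<in>V. \<forall>y\<in>V. ip (T x) y = ip x (S y)"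
proof -
  obtain C where C: "0 \<le> C" "\<And>x. x \<in> V \<Longrightarrow> vnorm H (T x) \<le> C * vnorm H x"
    using op_norm_bound[OF T] by blast
  have "\<exists>u\<in>V. \<forall>x\<in>V. ip x u = ip (T x) y" if y: "y \<in> V" for y
  proof (rule riesz_representation)
    fix x assume x: "x \<in> V"
    have "cmod (ip (T x) y) \<le> vnorm H (T x) * vnorm H y"
      using x y T op_closed by (intro cauchy_schwarz_norm) auto
    also have "\<dots> \<le> (C * vnorm H x) * vnorm H y"
      by (intro mult_right_mono C x norm_nonneg y)
    finally show "cmod (ip (T x) y) \<le> (C * vnorm H y) * vnorm H x" by (simp add: mult_ac)
  qed (use y T in \<open>auto simp: inner_simps op_vadd op_vscale op_closed\<close>)
  then obtain S0 where S0: "\<And>y. y \<in> V \<Longrightarrow> S0 y \<in> V" 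
      "\<And>x y. \<lbrakk>x \<in> V; y \<in> V\<rbrakk> \<Longrightarrow> ip x (S0 y) = ip (T x) y" by metis
  define S where "S = restrict S0 V"
  have S: "S y \<in> V" "\<And>x. x \<in> V \<Longrightarrow> ip x (S y) = ip (T x) y" if "y \<in> V" for y
    using S0 that by (auto simp: S_def)
  have S': "ip (S y) x = ip y (T x)" if "x \<in> V" "y \<in> V" for x y
    using inner_commute[of x "S y"] inner_commute[of "T x" y] S that op_closed[OF T] by simp
  have "S \<in> ops"
  proof (rule opsI_inner)
    show "S \<in> extensional V" by (simp add: S_def)
    fix y assume y: "y \<in> V"
    have "(vnorm H (S y))\<^sup>2 = Re (ip (T (S y)) y)"
      using S[OF y] by (simp add: norm_sq)
    also have "\<dots> \<le> cmod (ip (T (S y)) y)" by (rule complex_Re_le_cmod)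
    also have "\<dots> \<le> vnorm H (T (S y)) * vnorm H y"
      using S[OF y] y op_closed[OF T] by (intro cauchy_schwarz_norm) auto
    also have "\<dots> \<le> (C * vnorm H (S y)) * vnorm H y"
      using S[OF y] y by (intro mult_right_mono C norm_nonneg)
    finally have *: "vnorm H (S y) * vnorm H (S y) \<le> vnorm H (S y) * (C * vnorm H y)"
      by (simp add: power2_eq_square mult_ac)
    have "vnorm H (S y) \<le> C * vnorm H y"
    proof (cases "vnorm H (S y) = 0")
      case True then show ?thesis using C(1) norm_nonneg[OF y] by simp
    next
      case False
      then have "0 < vnorm H (S y)" using norm_nonneg[OF S(1)[OF y]] by simp
      with * show ?thesis by simp
    qed
    then have "(vnorm H (S y))\<^sup>2 \<le> (C * vnorm H y)\<^sup>2"
      using norm_nonneg[OF S(1)[OF y]] by (intro power_mono)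
    then show "Re (ip (S y) (S y)) \<le> C\<^sup>2 * Re (ip y y)"
      using S(1)[OF y] y by (simp add: norm_sq power_mult_distrib)
  qed (use S T in \<open>auto simp: S' inner_simps closed op_closed\<close>)
  then show ?thesis using S by (intro bexI[of _ S]) auto
qed

lemma adjoint_unique:
  assumes T: "T \<in> ops" and S: "S \<in> ops" "\<And>x y. \<lbrakk>x \<in> V; y \<in> V\<rbrakk> \<Longrightarrow> ip (T x) y = ip x (S y)"
  shows "adjoint_op H T = S"
  unfolding adjoint_op_def
proof (rule the_equality)
  show "S' = S" if "S' \<in> ops \<and> (\<forall>x\<in>V. \<forall>y\<in>V. ip (T x) y = ip x (S' y))" for S'
    using that S by (intro op_ext inner_ext_right) (auto simp: op_closed)
qed (use S in auto)

lemma adjoint_props: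
  assumes T: "T \<in> ops"
  shows adjoint_in_ops: "adjoint_op H T \<in> ops"
    and adjoint_inner: "\<And>x y. \<lbrakk>x \<in> V; y \<in> V\<rbrakk> \<Longrightarrow> ip (T x) y = ip x (adjoint_op H T y)"
proof -
  obtain S where S: "S \<in> ops" "\<forall>x\<in>V. \<forall>y\<in>V. ip (T x) y = ip x (S y)"
    using adjoint_exists[OF T] by blast
  then have "adjoint_op H T = S" using adjoint_unique[OF T] by blast
  with S show "adjoint_op H T \<in> ops"
    and "\<And>x y. \<lbrakk>x \<in> V; y \<in> V\<rbrakk> \<Longrightarrow> ip (T x) y = ip x (adjoint_op H T y)" by auto
qed

lemma adjoint_inner':
  assumes "T \<in> ops" "x \<in> V" "y \<in> V"
  shows "ip (adjoint_op H T x) y = ip x (T y)"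
  using adjoint_inner[OF assms(1,3,2)] assms inner_commute op_closed[OF assms(1)]
    op_closed[OF adjoint_in_ops[OF assms(1)]] by metis

lemma adjoint_adjoint: "T \<in> ops \<Longrightarrow> adjoint_op H (adjoint_op H T) = T"
  by (intro adjoint_unique adjoint_in_ops) (auto simp: adjoint_inner')

lemma hermitian_iff: "T \<in> ops \<Longrightarrow> hermitian T \<longleftrightarrow> adjoint_op H T = T"
  using adjoint_unique[of T T] adjoint_inner[of T] by (auto simp: hermitian_def)

end

context hilbert_space begin

subsection \<open>The algebra of bounded operators and commutants\<close>

lemma op_apply:
  assumes "x \<in> V"
  shows op_add_apply: "op_add H S T x = vadd H (S x) (T x)"
    and op_scale_apply: "op_scale H c T x = vscale H c (T x)"
    and op_mult_apply: "op_mult H S T x = S (T x)"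
    and op_zero_apply: "op_zero H x = vzero H"
  using assms by (auto simp: op_add_def op_scale_def op_mult_def op_zero_def compose_def)

lemma op_zero_in_ops: "op_zero H \<in> ops"
  by (rule opsI_inner[where C = 0]) (auto simp: op_zero_def inner_simps closed)

lemma op_add_in_ops:
  assumes S: "S \<in> ops" and T: "T \<in> ops"
  shows "op_add H S T \<in> ops"
proof -
  obtain C where C: "0 \<le> C" "\<And>x. x \<in> V \<Longrightarrow> vnorm H (S x) \<le> C * vnorm H x"
    using op_norm_bound[OF S] by blast
  obtain D where D: "0 \<le> D" "\<And>x. x \<in> V \<Longrightarrow> vnorm H (T x) \<le> D * vnorm H x"
    using op_norm_bound[OF T] by blast
  show ?thesis
  proof (rule opsI_inner)
    show "op_add H S T \<in> extensional V" by (simp add: op_add_def)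
    show "Re (ip (op_add H S T x) (op_add H S T x)) \<le> (C + D)\<^sup>2 * Re (ip x x)" if x: "x \<in> V" for x
    proof -
      have "vnorm H (op_add H S T x) \<le> (C + D) * vnorm H x"
        using norm_vadd_le[of "S x" "T x"] C(2)[OF x] D(2)[OF x] x S T
        by (simp add: op_apply op_closed algebra_simps)
      then have "(vnorm H (op_add H S T x))\<^sup>2 \<le> ((C + D) * vnorm H x)\<^sup>2"
        using x S T by (intro power_mono) (auto simp: op_apply op_closed closed norm_nonneg)
      then show ?thesis
        using x S T by (simp add: norm_sq power_mult_distrib op_apply op_closed closed)
    qed
  qed (use S T in \<open>auto simp: op_apply closed op_closed inner_simps op_vadd op_vscale algebra_simps\<close>)
qed

lemma op_scale_in_ops:
  assumes T: "T \<in> ops"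
  shows "op_scale H c T \<in> ops"
proof -
  obtain C where C: "0 \<le> C" "\<And>x. x \<in> V \<Longrightarrow> Re (ip (T x) (T x)) \<le> C * Re (ip x x)"
    using op_bound[OF T] by blast
  show ?thesis
  proof (rule opsI_inner)
    show "op_scale H c T \<in> extensional V" by (simp add: op_scale_def)
    show "Re (ip (op_scale H c T x) (op_scale H c T x)) \<le> (cmod c)\<^sup>2 * C * Re (ip x x)"
      if x: "x \<in> V" for x
    proof -
      have "Re (ip (op_scale H c T x) (op_scale H c T x)) = (vnorm H (vscale H c (T x)))\<^sup>2"
        using x T by (simp add: op_apply norm_sq closed op_closed)
      also have "\<dots> = (cmod c)\<^sup>2 * Re (ip (T x) (T x))"
        using x T by (simp add: norm_vscale op_closed power_mult_distrib norm_sq)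
      also have "\<dots> \<le> (cmod c)\<^sup>2 * (C * Re (ip x x))"
        using C(2)[OF x] by (intro mult_left_mono) auto
      finally show ?thesis by (simp add: mult_ac)
    qed
  qed (use T in \<open>auto simp: op_apply closed op_closed inner_simps op_vadd op_vscale algebra_simps\<close>)
qed

lemma op_mult_in_ops:
  assumes S: "S \<in> ops" and T: "T \<in> ops"
  shows "op_mult H S T \<in> ops"
proof -
  obtain C where C: "0 \<le> C" "\<And>x. x \<in> V \<Longrightarrow> Re (ip (S x) (S x)) \<le> C * Re (ip x x)"
    using op_bound[OF S] by blast
  obtain D where D: "0 \<le> D" "\<And>x. x \<in> V \<Longrightarrow> Re (ip (T x) (T x)) \<le> D * Re (ip x x)"
    using op_bound[OF T] by blast
  show ?thesis
  proof (rule opsI_inner)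
    show "op_mult H S T \<in> extensional V" by (simp add: op_mult_def compose_def)
    show "Re (ip (op_mult H S T x) (op_mult H S T x)) \<le> C * D * Re (ip x x)" if x: "x \<in> V" for x
      using C(2)[OF op_closed[OF T x]] mult_left_mono[OF D(2)[OF x] C(1)] x
      by (simp add: op_apply mult_ac)
  qed (use S T in \<open>auto simp: op_apply closed op_closed inner_simps op_vadd op_vscale algebra_simps\<close>)
qed

lemmas ops_closed = op_one_in_ops op_zero_in_ops op_add_in_ops op_scale_in_ops op_mult_in_ops
  adjoint_in_ops

lemma adjoint_mult:
  "\<lbrakk>S \<in> ops; T \<in> ops\<rbrakk> \<Longrightarrow>
    adjoint_op H (op_mult H S T) = op_mult H (adjoint_op H T) (adjoint_op H S)"
  by (rule adjoint_unique) (auto simp: ops_closed op_apply op_closed adjoint_inner)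

lemma commutant_iff:
  assumes "A \<subseteq> ops"
  shows "T \<in> commutant H A \<longleftrightarrow> T \<in> ops \<and> (\<forall>S\<in>A. \<forall>x\<in>V. T (S x) = S (T x))"
proof -
  have "op_mult H T S = op_mult H S T \<longleftrightarrow> (\<forall>x\<in>V. T (S x) = S (T x))" if "T \<in> ops" "S \<in> A" for S
  proof
    assume "op_mult H T S = op_mult H S T"
    then show "\<forall>x\<in>V. T (S x) = S (T x)"
      using op_mult_apply[of _ T S] op_mult_apply[of _ S T] by simp
  next
    assume "\<forall>x\<in>V. T (S x) = S (T x)"
    then show "op_mult H T S = op_mult H S T"
      using that assms by (intro op_ext op_mult_in_ops) (auto simp: op_mult_apply)
  qed
  then show ?thesis by (auto simp: commutant_def)
qed

lemma commutant_subset_ops: "commutant H A \<subseteq> ops"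
  by (auto simp: commutant_def)

lemma commutantD:
  assumes "T \<in> commutant H A" "S \<in> A" "x \<in> V"
  shows "T (S x) = S (T x)"
proof -
  have "op_mult H T S = op_mult H S T" using assms(1,2) by (auto simp: commutant_def)
  then show ?thesis using op_mult_apply[OF assms(3), of T S] op_mult_apply[OF assms(3), of S T] by simp
qed

lemma commutant_closed:
  assumes "A \<subseteq> ops"
  shows "op_one H \<in> commutant H A"
    and "\<lbrakk>S \<in> commutant H A; T \<in> commutant H A\<rbrakk> \<Longrightarrow> op_add H S T \<in> commutant H A"
    and "T \<in> commutant H A \<Longrightarrow> op_scale H c T \<in> commutant H A"
    and "\<lbrakk>S \<in> commutant H A; T \<in> commutant H A\<rbrakk> \<Longrightarrow> op_mult H S T \<in> commutant H A"
  using assms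
  by (auto simp: commutant_iff ops_closed op_apply op_one_apply op_closed op_vadd op_vscale subset_eq)

lemma commutes_adjoint:
  assumes "T \<in> ops" "S \<in> ops" "\<And>x. x \<in> V \<Longrightarrow> adjoint_op H T (S x) = S (adjoint_op H T x)" "x \<in> V"
  shows "T (adjoint_op H S x) = adjoint_op H S (T x)"
proof (rule inner_ext)
  fix z assume z: "z \<in> V"
  have "ip (T (adjoint_op H S x)) z = ip x (S (adjoint_op H T z))"
    using assms z by (simp add: adjoint_inner adjoint_inner' adjoint_adjoint adjoint_in_ops op_closed)
  also have "\<dots> = ip x (adjoint_op H T (S z))" using assms(3)[OF z] by simp
  also have "\<dots> = ip (adjoint_op H S (T x)) z"
    using assms z by (simp add: adjoint_inner adjoint_inner' adjoint_adjoint adjoint_in_ops op_closed)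
  finally show "ip (T (adjoint_op H S x)) z = ip (adjoint_op H S (T x)) z" .
qed (use assms in \<open>auto simp: op_closed adjoint_in_ops\<close>)

lemma commutant_adjoint:
  assumes A: "A \<subseteq> ops" "adjoint_op H ` A \<subseteq> A" and T: "T \<in> commutant H A"
  shows "adjoint_op H T \<in> commutant H A"
proof -
  have T': "T \<in> ops" using T commutant_subset_ops by blast
  have "adjoint_op H T (S x) = S (adjoint_op H T x)" if "S \<in> A" "x \<in> V" for S x
  proof -
    have S: "S \<in> ops" "adjoint_op H S \<in> A" using that A by auto
    have "S (adjoint_op H T x) = adjoint_op H T (S x)"
      using commutes_adjoint[OF S(1) T' _ that(2)] commutantD[OF T S(2)] by simp
    then show ?thesis by simp
  qed
  then show ?thesis using A T' by (simp add: commutant_iff adjoint_in_ops)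
qed

lemma vn_ops: "\<lbrakk>von_neumann_algebra H A; T \<in> A\<rbrakk> \<Longrightarrow> T \<in> ops"
  by (auto simp: von_neumann_algebra_def)

lemma vn_memI:
  assumes "von_neumann_algebra H A" "T \<in> ops"
    and "\<And>S x. \<lbrakk>S \<in> commutant H A; x \<in> V\<rbrakk> \<Longrightarrow> T (S x) = S (T x)"
  shows "T \<in> A"
proof -
  have "T \<in> commutant H (commutant H A)"
    using assms(2,3) by (simp add: commutant_iff[OF commutant_subset_ops])
  then show ?thesis using assms(1) by (simp add: von_neumann_algebra_def)
qed

lemma vn_closed:
  assumes "von_neumann_algebra H A"
  shows "op_one H \<in> A"
    and "\<lbrakk>S \<in> A; T \<in> A\<rbrakk> \<Longrightarrow> op_add H S T \<in> A"
    and "T \<in> A \<Longrightarrow> op_scale H c T \<in> A"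
    and "\<lbrakk>S \<in> A; T \<in> A\<rbrakk> \<Longrightarrow> op_mult H S T \<in> A"
    and "T \<in> A \<Longrightarrow> adjoint_op H T \<in> A"
proof -
  have A: "commutant H (commutant H A) = A" using assms by (simp add: von_neumann_algebra_def)
  note * = commutant_closed[OF commutant_subset_ops[of A], unfolded A]
  show "op_one H \<in> A" by (rule *)
  show "op_add H S T \<in> A" if "S \<in> A" "T \<in> A" using that by (rule *)
  show "op_scale H c T \<in> A" if "T \<in> A" using that by (rule *)
  show "op_mult H S T \<in> A" if "S \<in> A" "T \<in> A" using that by (rule *)
  show "adjoint_op H T \<in> A" if "T \<in> A" using that assms by (auto simp: von_neumann_algebra_def)
qed

lemma commutant_mono: "A \<subseteq> B \<Longrightarrow> commutant H B \<subseteq> commutant H A"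
  by (auto simp: commutant_def)

lemma subset_bicommutant: "A \<subseteq> ops \<Longrightarrow> A \<subseteq> commutant H (commutant H A)"
  by (auto simp: commutant_def)

lemma vn_generated_superset: "S \<subseteq> ops \<Longrightarrow> S \<subseteq> vn_generated H S"
  using subset_bicommutant[of "S \<union> adjoint_op H ` S"] adjoint_in_ops
  by (auto simp: vn_generated_def)

lemma von_neumann_vn_generated:
  assumes "S \<subseteq> ops"
  shows "von_neumann_algebra H (vn_generated H S)"
proof -
  let ?X = "S \<union> adjoint_op H ` S"
  have X: "?X \<subseteq> ops" using assms adjoint_in_ops by auto
  have "adjoint_op H ` ?X \<subseteq> ?X" using adjoint_adjoint assms by (force simp: subset_eq)
  then have "adjoint_op H ` commutant H ?X \<subseteq> commutant H ?X"
    using commutant_adjoint[OF X] by blast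
  then have "adjoint_op H ` vn_generated H S \<subseteq> vn_generated H S"
    unfolding vn_generated_def using commutant_adjoint[OF commutant_subset_ops] by blast
  moreover have "commutant H (commutant H (commutant H ?X)) = commutant H ?X"
    using subset_bicommutant[OF commutant_subset_ops] commutant_mono[OF subset_bicommutant[OF X]]
    by blast
  ultimately show ?thesis
    by (simp add: von_neumann_algebra_def vn_generated_def commutant_subset_ops)
qed

text \<open>Commuting with \<open>W\<^sup>*\<close> is the same as having an adjoint that commutes with \<open>W\<close>. In this form the condition
  involves only the generators.\<close>

lemma commutant_vn_generatedI:
  assumes S: "S \<subseteq> ops" and T: "T \<in> ops"
    and "\<And>W x. \<lbrakk>W \<in> S; x \<in> V\<rbrakk> \<Longrightarrow> T (W x) = W (T x)"
    and "\<And>W x. \<lbrakk>W \<in> S; x \<in> V\<rbrakk> \<Longrightarrow> adjoint_op H T (W x) = W (adjoint_op H T x)"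
  shows "T \<in> commutant H (vn_generated H S)"
proof -
  have "S \<union> adjoint_op H ` S \<subseteq> ops" using S adjoint_in_ops by auto
  moreover have "T (adjoint_op H W x) = adjoint_op H W (T x)" if "W \<in> S" "x \<in> V" for W x
    using assms(4)[OF that(1)] that S by (intro commutes_adjoint[OF T]) auto
  ultimately have "T \<in> commutant H (S \<union> adjoint_op H ` S)"
    using assms by (auto simp: commutant_iff)
  then show ?thesis
    unfolding vn_generated_def using subset_bicommutant[OF commutant_subset_ops] by blast
qed


subsection \<open>Hermitian operators, resolvents and monotone limits\<close>

lemma hermitian_add: "\<lbrakk>S \<in> ops; T \<in> ops; hermitian S; hermitian T\<rbrakk> \<Longrightarrow> hermitian (op_add H S T)"
  by (simp add: hermitian_def op_apply inner_simps op_closed)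

lemma hermitian_scale: "\<lbrakk>T \<in> ops; hermitian T\<rbrakk> \<Longrightarrow> hermitian (op_scale H (of_real c) T)"
  by (simp add: hermitian_def op_apply inner_simps op_closed)

lemma qf_one: "x \<in> V \<Longrightarrow> qf (op_one H) x = Re (ip x x)"
  by (simp add: op_one_apply)

lemma qf_add: "\<lbrakk>S \<in> ops; T \<in> ops; x \<in> V\<rbrakk> \<Longrightarrow> qf (op_add H S T) x = qf S x + qf T x"
  by (simp add: op_apply inner_simps op_closed)

lemma qf_scale: "\<lbrakk>T \<in> ops; x \<in> V\<rbrakk> \<Longrightarrow> qf (op_scale H (of_real c) T) x = c * qf T x"
  by (simp add: op_apply inner_simps op_closed)

definition op_diff where "op_diff S T = op_add H S (op_scale H (-1) T)"

lemma op_diff_in_ops: "\<lbrakk>S \<in> ops; T \<in> ops\<rbrakk> \<Longrightarrow> op_diff S T \<in> ops"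
  by (simp add: op_diff_def ops_closed)

lemma op_diff_apply: "x \<in> V \<Longrightarrow> op_diff S T x = vsub (S x) (T x)"
  by (simp add: op_diff_def vsub_def op_apply)

lemma qf_diff: "\<lbrakk>S \<in> ops; T \<in> ops; x \<in> V\<rbrakk> \<Longrightarrow> qf (op_diff S T) x = qf S x - qf T x"
  by (simp add: op_diff_apply inner_simps op_closed)

lemma hermitian_diff: "\<lbrakk>S \<in> ops; T \<in> ops; hermitian S; hermitian T\<rbrakk> \<Longrightarrow> hermitian (op_diff S T)"
  by (simp add: hermitian_def op_diff_apply inner_simps op_closed)

lemma vn_diff: "\<lbrakk>von_neumann_algebra H A; S \<in> A; T \<in> A\<rbrakk> \<Longrightarrow> op_diff S T \<in> A"
  by (simp add: op_diff_def vn_closed)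

lemma positive_zero_vec:
  assumes T: "T \<in> ops" "hermitian T" "\<And>x. x \<in> V \<Longrightarrow> 0 \<le> qf T x" and x: "x \<in> V" "qf T x = 0"
  shows "T x = vzero H"
  using form_cauchy_schwarz[OF T x(1)] x T
  by (intro inner_ext) (auto simp: closed op_closed inner_simps)

text \<open>The resolvent \<open>(1 + S)\<^sup>-\<^sup>1\<close> of a positive \<open>S\<close>. As a Hermitian right inverse of the Hermitian operator
  \<open>1 + S\<close> it is also a left inverse.\<close>

definition resolvent where
  "resolvent S R \<longleftrightarrow> R \<in> ops \<and> hermitian R \<and> (\<forall>x\<in>V. vadd H (R x) (S (R x)) = x)"

context
  fixes A S
  assumes A: "von_neumann_algebra H A" and S: "S \<in> A" "hermitian S" "\<And>x. x \<in> V \<Longrightarrow> 0 \<le> qf S x"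
begin

lemma S_ops: "S \<in> ops" using vn_ops[OF A S(1)] .

lemma one_plus_bounded_below:
  assumes u: "u \<in> V"
  shows "Re (ip u u) \<le> Re (ip (vadd H u (S u)) (vadd H u (S u)))"
  using S(3)[OF u] inner_nonneg[OF op_closed[OF S_ops u]] u S_ops Re_inner_commute[of "S u" u]
  by (simp add: inner_simps op_closed closed)

lemma one_plus_inj:
  assumes u: "u \<in> V" and v: "v \<in> V" and eq: "vadd H u (S u) = vadd H v (S v)"
  shows "u = v"
proof -
  have w: "vsub u v \<in> V" using u v closed by auto
  have "vadd H (vsub u v) (S (vsub u v)) = vsub (vadd H u (S u)) (vadd H v (S v))"
    using u v S_ops by (intro inner_ext) (auto simp: inner_simps op_vsub op_closed closed)
  also have "\<dots> = vzero H" using u v S_ops unfolding eq 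
    by (intro inner_ext) (auto simp: inner_simps op_closed closed)
  finally have "vadd H (vsub u v) (S (vsub u v)) = vzero H" .
  then have "Re (ip (vsub u v) (vsub u v)) \<le> 0"
    using one_plus_bounded_below[OF w] by (simp add: inner_zero_left closed)
  then have "vsub u v = vzero H"
    using inner_nonneg[OF w] inner_self_zero[OF w] by simp
  then have "ip (vsub u v) z = 0" if "z \<in> V" for z using that by (simp add: inner_zero_left)
  then show ?thesis using u v by (intro inner_ext) (auto simp: inner_simps)
qed

lemma one_plus_surj:
  assumes v: "v \<in> V"
  shows "\<exists>u\<in>V. vadd H u (S u) = v"
proof -
  let ?T = "op_add H (op_one H) S"
  have T: "?T \<in> ops" "hermitian ?T"
    using S S_ops by (auto intro!: ops_closed hermitian_add hermitian_one)
  have "\<exists>u\<in>V. \<forall>x\<in>V. ip (?T x) u = ip x v"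
  proof (rule coercive_representation[OF T, of 1])
    show "1 * Re (ip x x) \<le> qf ?T x" if "x \<in> V" for x
      using S(3)[OF that] that S_ops by (simp add: op_apply op_one_apply inner_simps op_closed)
    show "cmod (ip x v) \<le> vnorm H v * vnorm H x" if "x \<in> V" for x
      using cauchy_schwarz_norm[OF that v] by (simp add: mult.commute)
  qed (use v in \<open>auto simp: inner_simps\<close>)
  then obtain u where u: "u \<in> V" "\<And>x. x \<in> V \<Longrightarrow> ip (?T x) u = ip x v" by blast
  have "ip x (vadd H u (S u)) = ip x v" if "x \<in> V" for x
    using T(2) u that by (simp add: hermitian_def op_apply op_one_apply)
  then show ?thesis using u v S_ops by (intro bexI[of _ u] inner_ext_right) (auto simp: closed op_closed)
qed

text \<open>Uniqueness of the solution of \<open>u + S u = v\<close> makes the solution operator linear, and makes it commute with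
  everything that commutes with \<open>S\<close>, so that it lies in the von Neumann algebra.\<close>

lemma resolvent_exists:
  shows "\<exists>R\<in>A. resolvent S R"
proof -
  obtain R0 where R0: "\<And>v. v \<in> V \<Longrightarrow> R0 v \<in> V" "\<And>v. v \<in> V \<Longrightarrow> vadd H (R0 v) (S (R0 v)) = v"
    using one_plus_surj by metis
  define R where "R = restrict R0 V"
  have R: "R v \<in> V" "vadd H (R v) (S (R v)) = v" if "v \<in> V" for v
    using R0 that by (auto simp: R_def)
  have RS: "ip (R v) z + ip (S (R v)) z = ip v z" if "v \<in> V" "z \<in> V" for v z
    using inner_add_left[OF R(1) _ that(2), of v "S (R v)"] R that S_ops by (simp add: op_closed)
  have Rops: "R \<in> ops"
  proof (rule opsI)
    show "R \<in> extensional V" by (simp add: R_def)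
    show "R (vadd H x y) = vadd H (R x) (R y)" if xy: "x \<in> V" "y \<in> V" for x y
    proof (rule one_plus_inj)
      have "vadd H (vadd H (R x) (R y)) (S (vadd H (R x) (R y)))
        = vadd H (vadd H (R x) (S (R x))) (vadd H (R y) (S (R y)))"
        using xy R(1) S_ops by (intro inner_ext) (auto simp: op_vadd op_closed closed inner_simps)
      then show "vadd H (R (vadd H x y)) (S (R (vadd H x y))) =
          vadd H (vadd H (R x) (R y)) (S (vadd H (R x) (R y)))"
        using xy R by (simp add: closed)
    qed (use R xy closed in auto)
    show "R (vscale H c x) = vscale H c (R x)" if x: "x \<in> V" for c x
    proof (rule one_plus_inj)
      have "vadd H (vscale H c (R x)) (S (vscale H c (R x))) = vscale H c (vadd H (R x) (S (R x)))"
        using x R(1) S_ops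
        by (intro inner_ext) (auto simp: op_vscale op_closed closed inner_simps algebra_simps)
      then show "vadd H (R (vscale H c x)) (S (R (vscale H c x))) =
          vadd H (vscale H c (R x)) (S (vscale H c (R x)))"
        using x R by (simp add: closed)
    qed (use R x closed in auto)
    show "Re (ip (R x) (R x)) \<le> 1 * Re (ip x x)" if x: "x \<in> V" for x
      using one_plus_bounded_below[OF R(1)[OF x]] R(2)[OF x] by simp
  qed (use R in auto)
  have "hermitian R"
    unfolding hermitian_def
  proof (intro ballI)
    fix x y assume xy: "x \<in> V" "y \<in> V"
    have "ip (R x) y = ip (R x) (vadd H (R y) (S (R y)))" using R xy by simp
    also have "\<dots> = ip (vadd H (R x) (S (R x))) (R y)"
      using S(2) xy R(1) S_ops by (simp add: inner_simps op_closed hermitian_def)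
    also have "\<dots> = ip x (R y)" using R xy by simp
    finally show "ip (R x) y = ip x (R y)" .
  qed
  moreover have "R \<in> A"
  proof (rule vn_memI[OF A Rops])
    fix T x assume T: "T \<in> commutant H A" and x: "x \<in> V"
    have T': "T \<in> ops" using T commutant_subset_ops by blast
    show "R (T x) = T (R x)"
    proof (rule one_plus_inj)
      have "vadd H (T (R x)) (S (T (R x))) = T (vadd H (R x) (S (R x)))"
        using commutantD[OF T S(1) R(1)[OF x]] R(1) x T' S_ops by (simp add: op_vadd op_closed)
      then show "vadd H (R (T x)) (S (R (T x))) = vadd H (T (R x)) (S (T (R x)))"
        using R x T' by (simp add: op_closed)
    qed (use R x T' op_closed in auto)
  qed
  ultimately show ?thesis using Rops R unfolding resolvent_def by blast
qed

end

lemma resolvent_left_inverse: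
  assumes S: "S \<in> ops" "hermitian S" and R: "resolvent S R" and x: "x \<in> V"
  shows "R (vadd H x (S x)) = x"
proof (rule inner_ext)
  fix z assume z: "z \<in> V"
  have Rz: "R z \<in> V" and Rops: "R \<in> ops" using R z by (auto simp: resolvent_def op_closed)
  have "ip (R (vadd H x (S x))) z = ip (vadd H x (S x)) (R z)"
    using R x z S by (simp add: resolvent_def hermitian_def closed op_closed)
  also have "\<dots> = ip x (vadd H (R z) (S (R z)))"
    using x z S Rz by (simp add: hermitian_def inner_simps op_closed)
  also have "\<dots> = ip x z" using R z by (simp add: resolvent_def)
  finally show "ip (R (vadd H x (S x))) z = ip x z" .
qed (use assms in \<open>auto simp: resolvent_def closed op_closed\<close>)

text \<open>With \<open>u = R x\<close> all forms become explicit in \<open>u\<close>: \<open>\<langle>(1 - R) x, x\<rangle> = \<langle>S u, u\<rangle> + \<parallel>S u\<parallel>\<^sup>2\<close> and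
  \<open>\<langle>S x, x\<rangle> = \<langle>S u, u\<rangle> + 2 \<parallel>S u\<parallel>\<^sup>2 + \<langle>S S u, S u\<rangle>\<close>.\<close>

lemma resolvent_forms:
  assumes S: "S \<in> ops" "hermitian S" "\<And>x. x \<in> V \<Longrightarrow> 0 \<le> qf S x" and R: "resolvent S R"
    and x: "x \<in> V"
  shows resolvent_nonneg: "0 \<le> qf R x"
    and resolvent_le_one: "qf R x \<le> Re (ip x x)"
    and one_minus_resolvent_le: "Re (ip x x) - qf R x \<le> qf S x"
    and le_one_minus_resolvent: "(\<And>y. y \<in> V \<Longrightarrow> qf S y \<le> C * Re (ip y y)) \<Longrightarrow> 0 \<le> C \<Longrightarrow>
      qf S x \<le> (2 + C) * (Re (ip x x) - qf R x)"
proof -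
  define u where "u = R x"
  have u: "u \<in> V" and xu: "x = vadd H u (S u)"
    using R x by (auto simp: u_def resolvent_def op_closed)
  have Su: "S u \<in> V" "S (S u) \<in> V" using u S(1) by (auto simp: op_closed)
  have c1: "Re (ip u (S u)) = qf S u" using Re_inner_commute[OF u Su(1)] by simp
  have c2: "ip (S (S u)) u = ip (S u) (S u)" using S(2) u Su by (simp add: hermitian_def)
  have xx: "Re (ip x x) = Re (ip u u) + 2 * qf S u + Re (ip (S u) (S u))"
    unfolding xu using u Su c1 by (simp add: inner_simps closed)
  have R': "qf R x = Re (ip u u) + qf S u"
  proof -
    have "qf R x = Re (ip u x)" by (simp add: u_def)
    also have "\<dots> = Re (ip u u) + qf S u"
      unfolding xu using u Su c1 by (simp add: inner_simps)
    finally show ?thesis .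
  qed
  have S': "qf S x = qf S u + 2 * Re (ip (S u) (S u)) + qf S (S u)"
    unfolding xu using u Su S(1) c2 by (simp add: op_vadd inner_simps closed)
  note pos = S(3)[OF u] S(3)[OF Su(1)] inner_nonneg[OF Su(1)] inner_nonneg[OF u]
  show "0 \<le> qf R x" "qf R x \<le> Re (ip x x)" "Re (ip x x) - qf R x \<le> qf S x"
    using pos unfolding R' xx S' by auto
  assume C: "\<And>y. y \<in> V \<Longrightarrow> qf S y \<le> C * Re (ip y y)" "0 \<le> C"
  have "0 \<le> (1 + C) * qf S u" using pos C(2) by simp
  then show "qf S x \<le> (2 + C) * (Re (ip x x) - qf R x)"
    using C(1)[OF Su(1)] pos unfolding R' xx S' by (simp add: algebra_simps)
qed

text \<open>For \<open>u\<^sub>i = R\<^sub>i x\<close> the Cauchy--Schwarz inequality for the form of \<open>1 + S\<^sub>1\<close> gives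
  \<open>\<langle>x, u\<^sub>2\<rangle>\<^sup>2 = \<langle>(1 + S\<^sub>1) u\<^sub>1, u\<^sub>2\<rangle>\<^sup>2 \<le> \<langle>x, u\<^sub>1\<rangle> \<langle>(1 + S\<^sub>2) u\<^sub>2, u\<^sub>2\<rangle> = \<langle>x, u\<^sub>1\<rangle> \<langle>x, u\<^sub>2\<rangle>\<close>.\<close>

lemma resolvent_antimono:
  assumes S1: "S1 \<in> ops" "hermitian S1" "\<And>x. x \<in> V \<Longrightarrow> 0 \<le> qf S1 x" "resolvent S1 R1"
    and S2: "S2 \<in> ops" "hermitian S2" "\<And>x. x \<in> V \<Longrightarrow> 0 \<le> qf S2 x" "resolvent S2 R2"
    and le: "\<And>x. x \<in> V \<Longrightarrow> qf S1 x \<le> qf S2 x" and x: "x \<in> V"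
  shows "qf R2 x \<le> qf R1 x"
proof -
  define u1 u2 where "u1 = R1 x" and "u2 = R2 x"
  have u: "u1 \<in> V" "u2 \<in> V" "vadd H u1 (S1 u1) = x" "vadd H u2 (S2 u2) = x"
    using S1(4) S2(4) x by (auto simp: u1_def u2_def resolvent_def op_closed)
  let ?T = "op_add H (op_one H) S1"
  have T: "?T \<in> ops" "hermitian ?T"
    using S1 by (auto intro!: ops_closed hermitian_add hermitian_one)
  have Tq: "qf ?T y = Re (ip y y) + qf S1 y" if "y \<in> V" for y
    using that S1(1) by (simp add: op_apply op_one_apply inner_simps op_closed)
  have Tu1: "?T u1 = x" using u by (simp add: op_apply op_one_apply)
  have r: "qf R1 x = Re (ip x u1)" "qf R2 x = Re (ip x u2)"
    using Re_inner_commute[OF x u(1)] Re_inner_commute[OF x u(2)] by (auto simp: u1_def u2_def)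
  have "(Re (ip x u2))\<^sup>2 \<le> (cmod (ip x u2))\<^sup>2" by (simp add: cmod_power2)
  also have "\<dots> = (cmod (ip (?T u1) u2))\<^sup>2" using Tu1 by simp
  also have "\<dots> \<le> qf ?T u1 * qf ?T u2"
  proof (rule form_cauchy_schwarz[OF T _ u(1,2)])
    show "0 \<le> qf ?T y" if "y \<in> V" for y using that S1(3) inner_nonneg by (simp add: Tq)
  qed
  also have "qf ?T u1 = qf R1 x" using Tu1 r by simp
  also have "qf ?T u2 \<le> Re (ip (vadd H u2 (S2 u2)) u2)"
    using le[OF u(2)] u(1,2) S2(1) by (simp add: Tq inner_simps op_closed)
  also have "\<dots> = qf R2 x" using u r by simp
  finally have *: "(qf R2 x)\<^sup>2 \<le> qf R1 x * qf R2 x"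
    using r resolvent_nonneg[OF S1 x] by (simp add: mult_left_mono)
  show ?thesis
  proof (cases "qf R2 x = 0")
    case True then show ?thesis using resolvent_nonneg[OF S1 x] by simp
  next
    case False
    then have "0 < qf R2 x" using resolvent_nonneg[OF S2 x] by simp
    with * show ?thesis by (simp add: power2_eq_square)
  qed
qed

text \<open>A bounded increasing sequence of Hermitian operators has convergent matrix coefficients, by
  Cauchy--Schwarz for the forms of its differences, and the limits are the matrix coefficients of an
  operator by Riesz representation.\<close>

lemma monotone_limit:
  assumes A: "von_neumann_algebra H A"
    and T: "\<And>n. T n \<in> A" "\<And>n. hermitian (T n)"
    and bounds: "\<And>n x. x \<in> V \<Longrightarrow> 0 \<le> qf (T n) x" "\<And>n x. x \<in> V \<Longrightarrow> qf (T n) x \<le> Re (ip x x)"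
    and mono: "\<And>n x. x \<in> V \<Longrightarrow> qf (T n) x \<le> qf (T (Suc n)) x"
  shows "\<exists>L\<in>A. hermitian L \<and> (\<forall>x\<in>V. (\<lambda>n. qf (T n) x) \<longlonglongrightarrow> qf L x)"
proof -
  have Tops: "T n \<in> ops" for n using vn_ops[OF A T(1)] .
  have inc: "incseq (\<lambda>n. qf (T n) x)" if "x \<in> V" for x
    using mono[OF that] by (intro incseq_SucI)
  have convq: "convergent (\<lambda>n. qf (T n) x)" if x: "x \<in> V" for x
  proof (rule Bseq_mono_convergent)
    show "Bseq (\<lambda>n. qf (T n) x)"
      using bounds[OF x] by (intro BseqI'[of _ "Re (ip x x)"]) auto
  qed (use inc[OF x] in \<open>auto simp: incseq_def\<close>)
  have conv: "convergent (\<lambda>n. ip (T n x) y)" if x: "x \<in> V" and y: "y \<in> V" for x y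
  proof -
    have *: "(cmod (ip (T m x) y - ip (T n x) y))\<^sup>2 \<le> \<bar>qf (T m) x - qf (T n) x\<bar> * Re (ip y y)"
      if "n \<le> m" for m n
    proof -
      let ?D = "op_diff (T m) (T n)"
      have D: "?D \<in> ops" "hermitian ?D"
        using Tops T by (auto intro!: op_diff_in_ops hermitian_diff)
      have Dq: "qf ?D z = qf (T m) z - qf (T n) z" if "z \<in> V" for z
        using that Tops by (intro qf_diff)
      have "(cmod (ip (?D x) y))\<^sup>2 \<le> qf ?D x * qf ?D y"
        using inc that by (intro form_cauchy_schwarz[OF D _ x y]) (simp add: Dq incseq_def)
      also have "\<dots> \<le> \<bar>qf (T m) x - qf (T n) x\<bar> * Re (ip y y)"
      proof (intro mult_mono)
        show "0 \<le> qf ?D y" using inc[OF y] that y by (simp add: Dq incseq_def)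
        show "qf ?D y \<le> Re (ip y y)" using bounds(1)[OF y, of n] bounds(2)[OF y, of m] Dq[OF y] by simp
      qed (use Dq[OF x] in auto)
      finally show ?thesis
        using x y Tops by (simp add: op_diff_apply inner_simps op_closed)
    qed
    have *: "(cmod (ip (T m x) y - ip (T n x) y))\<^sup>2 \<le> \<bar>qf (T m) x - qf (T n) x\<bar> * Re (ip y y)" for m n
      using *[of m n] *[of n m] by (cases "n \<le> m") (auto simp: norm_minus_commute abs_minus_commute)
    have "Cauchy (\<lambda>n. ip (T n x) y)"
    proof (rule metric_CauchyI)
      fix e :: real assume e: "0 < e"
      define k where "k = Re (ip y y) + 1"
      have k: "0 < k" using inner_nonneg[OF y] by (simp add: k_def)
      have "Cauchy (\<lambda>n. qf (T n) x)" using convq[OF x] by (rule convergent_Cauchy)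
      from metric_CauchyD[OF this, of "e\<^sup>2 / k"] e k obtain N
        where N: "\<And>m n. \<lbrakk>N \<le> m; N \<le> n\<rbrakk> \<Longrightarrow> \<bar>qf (T m) x - qf (T n) x\<bar> < e\<^sup>2 / k"
        by (auto simp: dist_real_def)
      have "cmod (ip (T m x) y - ip (T n x) y) < e" if "N \<le> m" "N \<le> n" for m n
      proof -
        have "(cmod (ip (T m x) y - ip (T n x) y))\<^sup>2 \<le> \<bar>qf (T m) x - qf (T n) x\<bar> * k"
          by (rule order_trans[OF *]) (simp add: k_def mult_left_mono)
        also have "\<dots> < e\<^sup>2" using N[OF that] k by (simp add: field_simps)
        finally show ?thesis using e by (simp add: power2_less_imp_less)
      qed
      then show "\<exists>N. \<forall>m\<ge>N. \<forall>n\<ge>N. dist (ip (T m x) y) (ip (T n x) y) < e"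
        by (auto simp: dist_norm)
    qed
    then show ?thesis by (rule Cauchy_convergent)
  qed
  define B where "B x y = lim (\<lambda>n. ip (T n x) y)" for x y
  have B: "(\<lambda>n. ip (T n x) y) \<longlonglongrightarrow> B x y" if "x \<in> V" "y \<in> V" for x y
    using conv[OF that] by (simp add: B_def convergent_LIMSEQ_iff)
  have Tbound: "vnorm H (T n x) \<le> vnorm H x" if x: "x \<in> V" for n x
  proof -
    have "(vnorm H (T n x))\<^sup>2 * (vnorm H (T n x))\<^sup>2 = (cmod (ip (T n x) (T n x)))\<^sup>2"
      using inner_self[OF op_closed[OF Tops x], of n] op_closed[OF Tops x, of n]
      by (metis abs_of_nonneg inner_nonneg norm_of_real norm_sq power2_eq_square)
    also have "\<dots> \<le> qf (T n) x * qf (T n) (T n x)"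
      using form_cauchy_schwarz[OF Tops T(2) bounds(1) x op_closed[OF Tops x]] .
    also have "\<dots> \<le> Re (ip x x) * Re (ip (T n x) (T n x))"
      using bounds x op_closed[OF Tops x, of n] inner_nonneg[OF x] by (intro mult_mono) auto
    also have "\<dots> = (vnorm H x)\<^sup>2 * (vnorm H (T n x))\<^sup>2"
      using x op_closed[OF Tops x, of n] by (simp add: norm_sq)
    finally have "(vnorm H (T n x))\<^sup>2 \<le> (vnorm H x)\<^sup>2 \<or> (vnorm H (T n x))\<^sup>2 = 0"
      by (metis mult_right_le_imp_le zero_le_power2 less_eq_real_def)
    then show ?thesis
      using norm_nonneg[OF x] by (auto intro: power2_le_imp_le)
  qed
  have Bbound: "cmod (B x y) \<le> vnorm H x * vnorm H y" if x: "x \<in> V" and y: "y \<in> V" for x y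
  proof (rule LIMSEQ_le_const2[OF tendsto_norm[OF B[OF x y]]])
    have "cmod (ip (T n x) y) \<le> vnorm H x * vnorm H y" for n
      using cauchy_schwarz_norm[OF op_closed[OF Tops x] y, of n]
        mult_right_mono[OF Tbound[OF x] norm_nonneg[OF y], of n] by linarith
    then show "\<exists>N. \<forall>n\<ge>N. cmod (ip (T n x) y) \<le> vnorm H x * vnorm H y" by blast
  qed
  have BaddL: "B (vadd H x y) z = B x z + B y z" if "x \<in> V" "y \<in> V" "z \<in> V" for x y z
    using that Tops by (intro LIMSEQ_unique[OF B]) (auto simp: closed op_vadd inner_simps op_closed
        intro!: tendsto_add B)
  have BaddR: "B z (vadd H x y) = B z x + B z y" if "x \<in> V" "y \<in> V" "z \<in> V" for x y z
    using that Tops by (intro LIMSEQ_unique[OF B]) (auto simp: closed inner_simps op_closed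
        intro!: tendsto_add B)
  have BscL: "B (vscale H c x) z = c * B x z" if "x \<in> V" "z \<in> V" for c x z
    using that Tops by (intro LIMSEQ_unique[OF B]) (auto simp: closed op_vscale inner_simps op_closed
        intro!: tendsto_mult B)
  have BscR: "B z (vscale H c x) = cnj c * B z x" if "x \<in> V" "z \<in> V" for c x z
    using that Tops by (intro LIMSEQ_unique[OF B]) (auto simp: closed inner_simps op_closed
        intro!: tendsto_mult B)
  have "\<exists>u\<in>V. \<forall>y\<in>V. ip y u = cnj (B x y)" if x: "x \<in> V" for x
    using Bbound[OF x] x by (intro riesz_representation[where C = "vnorm H x"]) (auto simp: BaddR BscR)
  then obtain L0 where L0: "\<And>x. x \<in> V \<Longrightarrow> L0 x \<in> V"
      "\<And>x y. \<lbrakk>x \<in> V; y \<in> V\<rbrakk> \<Longrightarrow> ip y (L0 x) = cnj (B x y)" by metis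
  define L where "L = restrict L0 V"
  have L: "L x \<in> V" if "x \<in> V" for x using L0 that by (simp add: L_def)
  have LB: "ip (L x) y = B x y" if "x \<in> V" "y \<in> V" for x y
    using L0 that inner_commute[of y "L0 x"] by (simp add: L_def)
  have Lops: "L \<in> ops"
  proof (rule opsI_inner)
    show "L \<in> extensional V" by (simp add: L_def)
    show "Re (ip (L x) (L x)) \<le> 1 * Re (ip x x)" if x: "x \<in> V" for x
    proof -
      have "Re (ip (L x) (L x)) \<le> cmod (B x (L x))"
        using LB[OF x L[OF x]] complex_Re_le_cmod[of "B x (L x)"] by simp
      also have "\<dots> \<le> vnorm H x * vnorm H (L x)" by (rule Bbound[OF x L[OF x]])
      finally have "(vnorm H (L x))\<^sup>2 \<le> vnorm H x * vnorm H (L x)" using L[OF x] by (simp add: norm_sq)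
      then have "vnorm H (L x) \<le> vnorm H x"
        using norm_nonneg[OF L[OF x]] norm_nonneg[OF x]
        by (cases "vnorm H (L x) = 0") (auto simp: power2_eq_square)
      then have "(vnorm H (L x))\<^sup>2 \<le> (vnorm H x)\<^sup>2"
        using norm_nonneg[OF L[OF x]] by (intro power_mono)
      then show ?thesis using x L[OF x] by (simp add: norm_sq)
    qed
  qed (auto simp: L LB closed BaddL BscL)
  have "hermitian L"
    unfolding hermitian_def
  proof (intro ballI)
    fix x y assume xy: "x \<in> V" "y \<in> V"
    have "(\<lambda>n. ip (T n x) y) = (\<lambda>n. cnj (ip (T n y) x))"
      using T(2) xy inner_commute[OF op_closed[OF Tops xy(2)] xy(1)] by (auto simp: hermitian_def)
    then have "B x y = cnj (B y x)"
      using B[OF xy] tendsto_cnj[OF B[OF xy(2,1)]] LIMSEQ_unique by metis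
    then show "ip (L x) y = ip x (L y)"
      using LB xy inner_commute[OF L[OF xy(2)] xy(1)] by simp
  qed
  moreover have "L \<in> A"
  proof (rule vn_memI[OF A Lops])
    fix S x assume S: "S \<in> commutant H A" and x: "x \<in> V"
    have S': "S \<in> ops" using S commutant_subset_ops by blast
    show "L (S x) = S (L x)"
    proof (rule inner_ext)
      fix y assume y: "y \<in> V"
      have "ip (T n (S x)) y = ip (T n x) (adjoint_op H S y)" for n
        using commutantD[OF S T(1) x, of n] adjoint_inner[OF S' op_closed[OF Tops x] y, of n] by simp
      then have "B (S x) y = B x (adjoint_op H S y)"
        by (simp add: B_def)
      then show "ip (L (S x)) y = ip (S (L x)) y"
        using x y S' by (simp add: LB L op_closed adjoint_in_ops adjoint_inner)
    qed (use x S' L op_closed in auto)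
  qed
  moreover have "(\<lambda>n. qf (T n) x) \<longlonglongrightarrow> qf L x" if "x \<in> V" for x
    using tendsto_Re[OF B[OF that that]] LB[OF that that] by simp
  ultimately show ?thesis by blast
qed

end

section \<open>Isomorphisms of von Neumann algebras are normal\<close>

definition star_iso ::
  "'h hilbert \<Rightarrow> ('h \<Rightarrow> 'h) set \<Rightarrow> 'k hilbert \<Rightarrow> ('k \<Rightarrow> 'k) set \<Rightarrow> (('h \<Rightarrow> 'h) \<Rightarrow> 'k \<Rightarrow> 'k) \<Rightarrow> bool"
  where
  "star_iso H A K B \<theta> \<longleftrightarrow> bij_betw \<theta> A B \<and>
     (\<forall>S\<in>A. \<forall>T\<in>A. \<theta> (op_add H S T) = op_add K (\<theta> S) (\<theta> T)) \<and>
     (\<forall>c. \<forall>T\<in>A. \<theta> (op_scale H c T) = op_scale K c (\<theta> T)) \<and>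
     (\<forall>S\<in>A. \<forall>T\<in>A. \<theta> (op_mult H S T) = op_mult K (\<theta> S) (\<theta> T)) \<and>
     (\<forall>T\<in>A. \<theta> (adjoint_op H T) = adjoint_op K (\<theta> T))"

lemma star_isomorphic_iff: "star_isomorphic H A K B \<longleftrightarrow> (\<exists>\<theta>. star_iso H A K B \<theta>)"
  by (simp add: star_isomorphic_def star_iso_def)

locale vn_isomorphism =
  H: hilbert_space H + K: hilbert_space K for H :: "'h hilbert" and K :: "'k hilbert" +
  fixes A B \<theta>
  assumes A: "von_neumann_algebra H A" and B: "von_neumann_algebra K B"
    and iso: "star_iso H A K B \<theta>"
begin

lemma bij: "bij_betw \<theta> A B" using iso by (simp add: star_iso_def)

lemma hom:
  shows hom_mem: "T \<in> A \<Longrightarrow> \<theta> T \<in> B"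
    and hom_add: "\<lbrakk>S \<in> A; T \<in> A\<rbrakk> \<Longrightarrow> \<theta> (op_add H S T) = op_add K (\<theta> S) (\<theta> T)"
    and hom_scale: "T \<in> A \<Longrightarrow> \<theta> (op_scale H c T) = op_scale K c (\<theta> T)"
    and hom_mult: "\<lbrakk>S \<in> A; T \<in> A\<rbrakk> \<Longrightarrow> \<theta> (op_mult H S T) = op_mult K (\<theta> S) (\<theta> T)"
    and hom_adjoint: "T \<in> A \<Longrightarrow> \<theta> (adjoint_op H T) = adjoint_op K (\<theta> T)"
  using iso bij_betwE[OF bij] by (auto simp: star_iso_def)

lemma hom_surj: "S \<in> B \<Longrightarrow> \<exists>T\<in>A. S = \<theta> T"
  using bij by (auto simp: bij_betw_def)

lemma hom_diff: "\<lbrakk>S \<in> A; T \<in> A\<rbrakk> \<Longrightarrow> \<theta> (H.op_diff S T) = K.op_diff (\<theta> S) (\<theta> T)"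
  by (simp add: H.op_diff_def K.op_diff_def hom H.vn_closed[OF A])

lemma hom_one: "\<theta> (op_one H) = op_one K"
proof -
  obtain T where T: "T \<in> A" "op_one K = \<theta> T" using hom_surj K.vn_closed(1)[OF B] by blast
  have 1: "op_one H \<in> A" using H.vn_closed(1)[OF A] .
  have "op_mult H T (op_one H) = T"
    using H.vn_ops[OF A T(1)] by (intro H.op_ext H.ops_closed) (auto simp: H.op_apply H.op_one_apply)
  then have "op_mult K (op_one K) (\<theta> (op_one H)) = op_one K" using hom_mult[OF T(1) 1] T by simp
  moreover have "op_mult K (op_one K) (\<theta> (op_one H)) = \<theta> (op_one H)"
    using K.vn_ops[OF B hom_mem[OF 1]]
    by (intro K.op_ext K.ops_closed) (auto simp: K.op_apply K.op_one_apply K.op_closed)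
  ultimately show ?thesis by simp
qed

lemma vn_isomorphism_inverse: "vn_isomorphism K H B A (inv_into A \<theta>)"
proof
  let ?\<phi> = "inv_into A \<theta>"
  have \<phi>: "?\<phi> S \<in> A" "\<theta> (?\<phi> S) = S" if "S \<in> B" for S
    using that bij by (auto simp: bij_betw_def inv_into_into f_inv_into_f)
  have \<phi>': "?\<phi> S = T" if "T \<in> A" "\<theta> T = S" for S T
    using that bij by (auto simp: bij_betw_def)
  show "star_iso K B H A ?\<phi>"
    unfolding star_iso_def
    using bij_betw_inv_into[OF bij] \<phi>
    by (auto intro!: \<phi>' simp: hom H.vn_closed[OF A])
qed (rule B A)+

lemma hom_hermitian: "\<lbrakk>T \<in> A; H.hermitian T\<rbrakk> \<Longrightarrow> K.hermitian (\<theta> T)"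
  using H.hermitian_iff[OF H.vn_ops[OF A]] K.hermitian_iff[OF K.vn_ops[OF B hom_mem]] hom_adjoint
  by metis

text \<open>Order is visible in the algebra: a Hermitian \<open>T\<close> is positive iff \<open>T + t\<close> is invertible for all
  \<open>t > 0\<close>. Indeed if \<open>c < 0\<close> is the largest lower bound of the form of \<open>T\<close>, then \<open>T - c\<close> is positive,
  and its invertibility would bound its form away from zero.\<close>

lemma hom_positive:
  assumes T: "T \<in> A" "H.hermitian T" "\<And>x. x \<in> vecs H \<Longrightarrow> 0 \<le> Re (vinner H (T x) x)"
    and y: "y \<in> vecs K"
  shows "0 \<le> Re (vinner K (\<theta> T y) y)"
proof (rule ccontr)
  assume neg: "\<not> 0 \<le> Re (vinner K (\<theta> T y) y)"
  let ?T = "\<theta> T"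
  have T': "?T \<in> K.ops" "K.hermitian ?T" "T \<in> H.ops"
    using hom_mem[OF T(1)] K.vn_ops[OF B] hom_hermitian[OF T(1,2)] H.vn_ops[OF A T(1)] by auto
  define L where "L = {c. \<forall>y\<in>vecs K. c * Re (vinner K y y) \<le> Re (vinner K (?T y) y)}"
  obtain C where C: "0 \<le> C" "\<And>x. x \<in> vecs K \<Longrightarrow> vnorm K (?T x) \<le> C * vnorm K x"
    using K.op_norm_bound[OF T'(1)] by blast
  have "- C \<in> L"
    unfolding L_def
  proof (intro CollectI ballI)
    fix y assume y: "y \<in> vecs K"
    have "\<bar>Re (vinner K (?T y) y)\<bar> \<le> cmod (vinner K (?T y) y)" by (rule abs_Re_le_cmod)
    also have "\<dots> \<le> vnorm K (?T y) * vnorm K y"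
      using y T'(1) by (intro K.cauchy_schwarz_norm) (auto simp: K.op_closed)
    also have "\<dots> \<le> (C * vnorm K y) * vnorm K y"
      using C(2)[OF y] K.norm_nonneg[OF y] by (intro mult_right_mono)
    also have "\<dots> = C * Re (vinner K y y)"
      using K.norm_sq[OF y] by (simp add: power2_eq_square)
    finally show "- C * Re (vinner K y y) \<le> Re (vinner K (?T y) y)" by simp
  qed
  moreover have L0: "c < 0" if "c \<in> L" for c
  proof (rule ccontr)
    assume "\<not> c < 0"
    then have "0 \<le> c * Re (vinner K y y)" using K.inner_nonneg[OF y] by simp
    then show False using that y neg by (auto simp: L_def)
  qed
  ultimately have Lne: "L \<noteq> {}" and Lbdd: "bdd_above L"
    by (auto intro!: bdd_aboveI[of _ 0] less_imp_le)
  define c where "c = Sup L"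
  have "c \<in> L"
    unfolding L_def
  proof (intro CollectI ballI)
    fix y assume y: "y \<in> vecs K"
    show "c * Re (vinner K y y) \<le> Re (vinner K (?T y) y)"
    proof (cases "Re (vinner K y y) = 0")
      case True
      then have "y = vzero K" using K.inner_self_zero[OF y] by simp
      then show ?thesis using True y T'(1) by (simp add: K.inner_zero_right K.op_closed)
    next
      case False
      then have pos: "0 < Re (vinner K y y)" using K.inner_nonneg[OF y] by simp
      have "c \<le> Re (vinner K (?T y) y) / Re (vinner K y y)"
        unfolding c_def using Lne pos y by (intro cSup_least) (auto simp: L_def field_simps)
      then show ?thesis using pos by (simp add: field_simps)
    qed
  qed
  then have c: "c < 0" using L0 by blast
  \<comment> \<open>The factor is chosen so that \<open>1 + s \<theta>(T)\<close> is the multiple \<open>s (\<theta>(T) - c)\<close> of the critical operator.\<close>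
  define s where "s = - 1 / c"
  have s: "0 < s" "s * c = - 1" using c by (auto simp: s_def)
  let ?S = "op_scale H (of_real s) T"
  have S: "?S \<in> A" "H.hermitian ?S" "\<And>x. x \<in> vecs H \<Longrightarrow> 0 \<le> Re (vinner H (?S x) x)"
    using T T' s by (auto simp: H.vn_closed[OF A] H.hermitian_scale H.qf_scale)
  obtain R where R: "R \<in> A" "H.resolvent ?S R" using H.resolvent_exists[OF A S] by blast
  have Sops: "?S \<in> H.ops" using S(1) H.vn_ops[OF A] by blast
  let ?P = "op_add K (op_one K) (op_scale K (of_real s) ?T)"
  have "op_mult H R (op_add H (op_one H) ?S) = op_one H"
    using H.resolvent_left_inverse[OF Sops S(2) R(2)] Sops H.vn_ops[OF A R(1)] T'(3)
    by (intro H.op_ext H.ops_closed) (auto simp: H.op_apply H.op_one_apply)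
  then have "op_mult K (\<theta> R) ?P = op_one K"
    using hom_mult[OF R(1), of "op_add H (op_one H) ?S"] S(1) T(1)
    by (simp add: hom_add hom_scale hom_one H.vn_closed[OF A])
  then have RP: "\<theta> R (?P y) = y" if "y \<in> vecs K" for y
    using that K.op_mult_apply K.op_one_apply by metis
  have P: "?P \<in> K.ops" "K.hermitian ?P"
    using T' by (auto intro!: K.ops_closed K.hermitian_add K.hermitian_one K.hermitian_scale)
  have Pq: "Re (vinner K (?P y) y) = s * (Re (vinner K (?T y) y) - c * Re (vinner K y y))"
    if y: "y \<in> vecs K" for y
  proof -
    have "Re (vinner K (?P y) y) = Re (vinner K y y) + s * Re (vinner K (?T y) y)"
      using that T' by (simp add: K.qf_add K.qf_scale K.ops_closed K.op_one_apply)
    also have "\<dots> = - (s * c) * Re (vinner K y y) + s * Re (vinner K (?T y) y)" by (simp add: s)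
    finally show ?thesis by (simp add: algebra_simps)
  qed
  have Ppos: "0 \<le> Re (vinner K (?P y) y)" if "y \<in> vecs K" for y
    using that \<open>c \<in> L\<close> s by (auto simp: Pq L_def)
  obtain C1 where C1: "0 < C1"
      "\<And>x. x \<in> vecs K \<Longrightarrow> Re (vinner K (\<theta> R x) (\<theta> R x)) \<le> C1 * Re (vinner K x x)"
    using K.op_bound'[OF K.vn_ops[OF B hom_mem[OF R(1)]]] by blast
  obtain C2 where C2: "0 < C2"
      "\<And>x. x \<in> vecs K \<Longrightarrow> vnorm K (?P x) \<le> C2 * vnorm K x"
  proof -
    obtain C where C: "0 \<le> C" "\<And>x. x \<in> vecs K \<Longrightarrow> vnorm K (?P x) \<le> C * vnorm K x"
      using K.op_norm_bound[OF P(1)] by blast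
    have "vnorm K (?P x) \<le> (C + 1) * vnorm K x" if "x \<in> vecs K" for x
      using C(2)[OF that] K.norm_nonneg[OF that] by (simp add: algebra_simps)
    then show ?thesis using that[of "C + 1"] C(1) by simp
  qed
  have sq: "Re (vinner K (?P y) (?P y)) \<le> C2 * Re (vinner K (?P y) y)" if y: "y \<in> vecs K" for y
  proof -
    let ?n = "Re (vinner K (?P y) (?P y))" and ?q = "Re (vinner K (?P y) y)"
    have Py: "?P y \<in> vecs K" "?P (?P y) \<in> vecs K" using P y by (auto simp: K.op_closed)
    have "Re (vinner K (?P (?P y)) (?P y)) \<le> cmod (vinner K (?P (?P y)) (?P y))"
      by (rule complex_Re_le_cmod)
    also have "\<dots> \<le> vnorm K (?P (?P y)) * vnorm K (?P y)"
      using Py by (intro K.cauchy_schwarz_norm)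
    also have "\<dots> \<le> (C2 * vnorm K (?P y)) * vnorm K (?P y)"
      using C2(2)[OF Py(1)] K.norm_nonneg[OF Py(1)] by (intro mult_right_mono)
    finally have q2: "Re (vinner K (?P (?P y)) (?P y)) \<le> C2 * ?n"
      using K.norm_sq[OF Py(1)] by (simp add: power2_eq_square mult.assoc)
    have "?n\<^sup>2 \<le> (cmod (vinner K (?P y) (?P y)))\<^sup>2" by (simp add: cmod_power2)
    also have "\<dots> \<le> ?q * Re (vinner K (?P (?P y)) (?P y))"
      using K.form_cauchy_schwarz[OF P Ppos y Py(1)] .
    also have "\<dots> \<le> ?q * (C2 * ?n)" using q2 Ppos[OF y] by (intro mult_left_mono)
    finally have *: "?n * ?n \<le> ?n * (C2 * ?q)" by (simp add: power2_eq_square mult_ac)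
    show ?thesis
    proof (cases "?n = 0")
      case True then show ?thesis using C2(1) Ppos[OF y] by simp
    next
      case False
      then have "0 < ?n" using K.inner_nonneg[OF Py(1)] by simp
      with * show ?thesis by simp
    qed
  qed
  \<comment> \<open>With \<open>P = s (\<theta>(T) - c)\<close> one has \<open>\<parallel>y\<parallel>\<^sup>2 \<le> C1 \<parallel>P y\<parallel>\<^sup>2 \<le> C1 C2 \<langle>P y, y\<rangle>\<close>, so \<open>c\<close> can be raised by \<open>d\<close>.\<close>
  define d where "d = 1 / (C1 * C2 * s)"
  have d: "0 < d" using C1 C2 s by (simp add: d_def)
  have "c + d \<in> L"
    unfolding L_def
  proof (intro CollectI ballI)
    fix y assume y: "y \<in> vecs K"
    have "Re (vinner K y y) = Re (vinner K (\<theta> R (?P y)) (\<theta> R (?P y)))" using RP[OF y] by simp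
    also have "\<dots> \<le> C1 * Re (vinner K (?P y) (?P y))"
      using K.op_closed[OF P(1) y] by (rule C1(2))
    also have "\<dots> \<le> C1 * (C2 * (s * (Re (vinner K (?T y) y) - c * Re (vinner K y y))))"
      using mult_left_mono[OF sq[OF y], of C1] C1(1) unfolding Pq[OF y] by simp
    finally have "d * Re (vinner K y y) \<le> Re (vinner K (?T y) y) - c * Re (vinner K y y)"
      using C1 C2 s by (simp add: d_def field_simps)
    then show "(c + d) * Re (vinner K y y) \<le> Re (vinner K (?T y) y)"
      by (simp add: algebra_simps)
  qed
  then have "c + d \<le> c" unfolding c_def using Lbdd by (rule cSup_upper)
  then show False using d by simp
qed

lemma hom_mono:
  assumes "S \<in> A" "H.hermitian S" "T \<in> A" "H.hermitian T"
    and "\<And>x. x \<in> vecs H \<Longrightarrow> Re (vinner H (S x) x) \<le> Re (vinner H (T x) x)" and y: "y \<in> vecs K"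
  shows "Re (vinner K (\<theta> S y) y) \<le> Re (vinner K (\<theta> T y) y)"
proof -
  have ops: "S \<in> H.ops" "T \<in> H.ops" "\<theta> S \<in> K.ops" "\<theta> T \<in> K.ops"
    using assms H.vn_ops[OF A] K.vn_ops[OF B] hom_mem by auto
  have "0 \<le> Re (vinner K (\<theta> (H.op_diff T S) y) y)"
    using assms ops by (intro hom_positive) (auto simp: H.vn_diff[OF A] H.hermitian_diff H.qf_diff)
  then show ?thesis using assms ops by (simp add: hom_diff K.qf_diff)
qed

lemma form_sum_operator:
  assumes "finite I" and z: "\<And>k. k \<in> I \<Longrightarrow> z k \<in> A"
  shows "\<exists>S\<in>A. H.hermitian S \<and>
    (\<forall>x\<in>vecs H. Re (vinner H (S x) x) = (\<Sum>k\<in>I. Re (vinner H (z k x) (z k x))))"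
  using assms
proof (induction I rule: finite_induct)
  case empty
  let ?Z = "op_scale H (of_real 0) (op_one H)"
  have "?Z \<in> A" "H.hermitian ?Z"
    using H.vn_closed[OF A] by (blast, intro H.hermitian_scale H.op_one_in_ops H.hermitian_one)
  moreover have "Re (vinner H (?Z x) x) = 0" if "x \<in> vecs H" for x
    using that by (subst H.qf_scale) (auto simp: H.op_one_in_ops)
  ultimately show ?case by (intro bexI[of _ ?Z]) auto
next
  case (insert k I)
  then obtain S where S: "S \<in> A" "H.hermitian S"
      "\<And>x. x \<in> vecs H \<Longrightarrow> Re (vinner H (S x) x) = (\<Sum>k\<in>I. Re (vinner H (z k x) (z k x)))"
    by auto
  define a where "a = op_mult H (adjoint_op H (z k)) (z k)"
  have zk: "z k \<in> A" "z k \<in> H.ops" using insert.prems H.vn_ops[OF A] by auto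
  have a: "a \<in> A" "a \<in> H.ops" "S \<in> H.ops"
    using zk S(1) H.vn_ops[OF A] by (auto simp: a_def H.vn_closed[OF A])
  have ah: "vinner H (a x) y = vinner H (z k x) (z k y)" if "x \<in> vecs H" "y \<in> vecs H" for x y
    using that zk by (simp add: a_def H.op_apply H.adjoint_inner' H.op_closed)
  have "H.hermitian a"
    unfolding H.hermitian_def
  proof (intro ballI)
    fix x y assume xy: "x \<in> vecs H" "y \<in> vecs H"
    have "vinner H x (a y) = cnj (vinner H (a y) x)"
      using H.inner_commute[OF H.op_closed[OF a(2) xy(2)] xy(1)] .
    also have "\<dots> = vinner H (a x) y"
      using ah xy H.inner_commute[of "z k y" "z k x"] zk H.op_closed by simp
    finally show "vinner H (a x) y = vinner H x (a y)" by simp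
  qed
  then have "H.hermitian (op_add H a S)" using a S by (intro H.hermitian_add)
  then show ?case
    using a S insert.hyps
    by (intro bexI[of _ "op_add H a S"]) (auto simp: H.qf_add ah H.vn_closed[OF A])
qed

lemma resolvent_complement:
  assumes S: "S \<in> A" "H.hermitian S" "\<And>x. x \<in> vecs H \<Longrightarrow> 0 \<le> Re (vinner H (S x) x)"
    and R: "R \<in> A" "H.resolvent S R"
  defines "F \<equiv> H.op_diff (op_one H) R"
  shows "F \<in> A" "H.hermitian F"
    and "x \<in> vecs H \<Longrightarrow> Re (vinner H (F x) x) = Re (vinner H x x) - Re (vinner H (R x) x)"
  using R H.vn_ops[OF A R(1)]
  by (auto simp: F_def H.vn_diff[OF A] H.vn_closed[OF A] H.resolvent_def H.op_one_in_ops
      H.qf_diff H.qf_one intro!: H.hermitian_diff H.hermitian_one)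

lemma hom_norm_sq:
  assumes "z \<in> A" "y \<in> vecs K"
  shows "Re (vinner K (\<theta> (op_mult H (adjoint_op H z) z) y) y) = Re (vinner K (\<theta> z y) (\<theta> z y))"
proof -
  have z: "\<theta> z \<in> K.ops" using assms hom_mem K.vn_ops[OF B] by blast
  have "\<theta> (op_mult H (adjoint_op H z) z) y = adjoint_op K (\<theta> z) (\<theta> z y)"
    using assms by (simp add: hom H.vn_closed[OF A] K.op_apply)
  then show ?thesis using z assms by (simp add: K.adjoint_inner' K.op_closed)
qed

text \<open>The heart of normality. The elements \<open>F\<^sub>I = 1 - (1 + \<Sum>\<^bsub>k\<in>I\<^esub> z\<^sub>k\<^sup>* z\<^sub>k)\<^sup>-\<^sup>1\<close> are bounded by \<open>1\<close>, increase
  with \<open>I\<close>, dominate a multiple of each \<open>z\<^sub>k\<^sup>* z\<^sub>k\<close> with \<open>k \<in> I\<close>, and are dominated by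
  \<open>\<Sum>\<^bsub>k\<in>I\<^esub> z\<^sub>k\<^sup>* z\<^sub>k\<close>. So \<open>f\<^sub>n = sup\<^sub>m F\<^bsub>{n..<m}\<^esub>\<close> decreases to an element that annihilates the separating vector,
  hence to \<open>0\<close>. Since \<open>\<theta>\<close> preserves the order and suprema are determined by the order, \<open>\<theta> (f\<^sub>n)\<close>
  decreases to \<open>0\<close> as well, and it dominates a multiple of \<open>\<theta> (z\<^sub>n)\<^sup>* \<theta> (z\<^sub>n)\<close>.\<close>

lemma summable_sequence_not_bounded_below:
  assumes \<xi>: "\<xi> \<in> vecs H" "\<And>T. \<lbrakk>T \<in> A; T \<xi> = vzero H\<rbrakk> \<Longrightarrow> T = op_zero H"
    and z: "\<And>n. z n \<in> A"
    and C: "0 \<le> C" "\<And>n x. x \<in> vecs H \<Longrightarrow> Re (vinner H (z n x) (z n x)) \<le> C * Re (vinner H x x)"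
    and summable: "\<And>n. Re (vinner H (z n \<xi>) (z n \<xi>)) \<le> (1/2) ^ n"
    and \<eta>: "\<eta> \<in> vecs K" "0 < \<delta>" "\<And>n. \<delta> \<le> Re (vinner K (\<theta> (z n) \<eta>) (\<theta> (z n) \<eta>))"
  shows False
proof -
  define q where "q k x = Re (vinner H (z k x) (z k x))" for k x
  have q0: "0 \<le> q k x" if "x \<in> vecs H" for k x
    using H.inner_nonneg[OF H.op_closed[OF H.vn_ops[OF A z] that]] by (simp add: q_def)
  define P where "P I S R \<longleftrightarrow> S \<in> A \<and> H.hermitian S \<and>
    (\<forall>x\<in>vecs H. Re (vinner H (S x) x) = (\<Sum>k\<in>I. q k x)) \<and> R \<in> A \<and> H.resolvent S R" for I S R
  have "\<exists>S R. P I S R" if I: "finite I" for I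
  proof -
    obtain S where S: "S \<in> A" "H.hermitian S"
        "\<forall>x\<in>vecs H. Re (vinner H (S x) x) = (\<Sum>k\<in>I. q k x)"
      using form_sum_operator[OF I, of z] z unfolding q_def by blast
    have "0 \<le> Re (vinner H (S x) x)" if "x \<in> vecs H" for x
      using S(3) that q0[OF that] by (simp add: sum_nonneg)
    then show ?thesis using H.resolvent_exists[OF A S(1,2)] S unfolding P_def by blast
  qed
  then obtain S R where SR: "\<And>I. finite I \<Longrightarrow> P I (S I) (R I)" by metis
  have S: "S I \<in> A" "H.hermitian (S I)" and R: "R I \<in> A" "H.resolvent (S I) (R I)"
    and Sq: "\<And>x. x \<in> vecs H \<Longrightarrow> Re (vinner H (S I x) x) = (\<Sum>k\<in>I. q k x)" if "finite I" for I
    using SR[OF that] by (auto simp: P_def)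
  have Sops: "S I \<in> H.ops" if "finite I" for I using H.vn_ops[OF A S(1)[OF that]] .
  have S0: "0 \<le> Re (vinner H (S I x) x)" if "finite I" "x \<in> vecs H" for I x
    using that q0 by (simp add: Sq sum_nonneg)
  define F where "F I = H.op_diff (op_one H) (R I)" for I
  have F: "F I \<in> A" "H.hermitian (F I)" if "finite I" for I
    using resolvent_complement[OF S[OF that] S0[OF that] R[OF that]] by (auto simp: F_def)
  have Fq: "Re (vinner H (F I x) x) = Re (vinner H x x) - Re (vinner H (R I x) x)"
    if "finite I" "x \<in> vecs H" for I x
    using resolvent_complement[OF S[OF that(1)] S0[OF that(1)] R[OF that(1)]] that
    by (auto simp: F_def)
  have F_bounds: "0 \<le> Re (vinner H (F I x) x)" "Re (vinner H (F I x) x) \<le> Re (vinner H x x)"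
      "Re (vinner H (F I x) x) \<le> (\<Sum>k\<in>I. q k x)" if I: "finite I" and x: "x \<in> vecs H" for I x
    using H.resolvent_nonneg[OF Sops[OF I] S(2)[OF I] S0[OF I] R(2)[OF I] x]
      H.resolvent_le_one[OF Sops[OF I] S(2)[OF I] S0[OF I] R(2)[OF I] x]
      H.one_minus_resolvent_le[OF Sops[OF I] S(2)[OF I] S0[OF I] R(2)[OF I] x]
    by (auto simp: Fq[OF I x] Sq[OF I x])
  have F_mono: "Re (vinner H (F I x) x) \<le> Re (vinner H (F J x) x)"
    if J: "finite J" and IJ: "I \<subseteq> J" and x: "x \<in> vecs H" for I J x
  proof -
    have I: "finite I" using J IJ finite_subset by blast
    have le: "Re (vinner H (S I y) y) \<le> Re (vinner H (S J y) y)" if "y \<in> vecs H" for y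
      using that I J IJ q0 by (auto simp: Sq intro!: sum_mono2)
    show ?thesis
      using H.resolvent_antimono[OF Sops[OF I] S(2)[OF I] S0[OF I] R(2)[OF I]
          Sops[OF J] S(2)[OF J] S0[OF J] R(2)[OF J] le x]
      by (simp add: Fq I J x)
  qed
  have z_le_F: "q k x \<le> (2 + C) * Re (vinner H (F {k} x) x)" if x: "x \<in> vecs H" for k x
  proof -
    have "finite {k}" by simp
    note k = Sops[OF this] S(2)[OF this] S0[OF this] R(2)[OF this]
    have "Re (vinner H (S {k} y) y) \<le> C * Re (vinner H y y)" if "y \<in> vecs H" for y
      using C(2)[OF that] that by (simp add: Sq q_def)
    from H.le_one_minus_resolvent[OF k x this C(1)]
    show ?thesis using x by (simp add: Sq Fq)
  qed
  have "\<exists>L\<in>A. H.hermitian L \<and>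
      (\<forall>x\<in>vecs H. (\<lambda>m. Re (vinner H (F {n..<m} x) x)) \<longlonglongrightarrow> Re (vinner H (L x) x))" for n
    by (rule H.monotone_limit[OF A]) (auto intro!: F F_bounds F_mono)
  then obtain f where f: "\<And>n. f n \<in> A" "\<And>n. H.hermitian (f n)"
      and flim: "\<And>n x. x \<in> vecs H \<Longrightarrow>
        (\<lambda>m. Re (vinner H (F {n..<m} x) x)) \<longlonglongrightarrow> Re (vinner H (f n x) x)" by metis
  have F_le_f: "Re (vinner H (F {n..<m} x) x) \<le> Re (vinner H (f n x) x)" if "x \<in> vecs H" for n m x
    using that F_mono by (intro incseq_le[OF _ flim[OF that]]) (auto simp: incseq_def)
  have f_bounds: "0 \<le> Re (vinner H (f n x) x)" "Re (vinner H (f n x) x) \<le> Re (vinner H x x)"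
    if x: "x \<in> vecs H" for n x
  proof -
    show "0 \<le> Re (vinner H (f n x) x)"
      using F_le_f[OF x, of n n] F_bounds(1)[OF _ x, of "{n..<n}"] by simp
    show "Re (vinner H (f n x) x) \<le> Re (vinner H x x)"
      using F_bounds(2)[OF _ x] by (intro LIMSEQ_le_const2[OF flim[OF x]]) auto
  qed
  have f_decreasing: "Re (vinner H (f (Suc n) x) x) \<le> Re (vinner H (f n x) x)"
    if x: "x \<in> vecs H" for n x
  proof -
    have "Re (vinner H (F {Suc n..<m} x) x) \<le> Re (vinner H (F {n..<m} x) x)" for m
      by (intro F_mono x) auto
    then show ?thesis by (intro LIMSEQ_le[OF flim[OF x] flim[OF x]]) blast
  qed
  have f_xi: "Re (vinner H (f n \<xi>) \<xi>) \<le> 2 * (1/2) ^ n" for n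
  proof (rule LIMSEQ_le_const2[OF flim[OF \<xi>(1)]], intro exI[of _ n] allI impI)
    fix m assume "n \<le> m"
    have "Re (vinner H (F {n..<m} \<xi>) \<xi>) \<le> (\<Sum>k\<in>{n..<m}. q k \<xi>)"
      using \<xi> by (intro F_bounds) auto
    also have "\<dots> \<le> (\<Sum>k\<in>{n..<m}. (1/2) ^ k)"
      using summable by (intro sum_mono) (simp add: q_def)
    also have "\<dots> = 2 * (1/2) ^ n - 2 * (1/2) ^ m"
      using \<open>n \<le> m\<close> by (induction rule: dec_induct) (auto simp: sum.atLeastLessThan_Suc)
    also have "\<dots> \<le> 2 * (1/2) ^ n" by simp
    finally show "Re (vinner H (F {n..<m} \<xi>) \<xi>) \<le> 2 * (1/2) ^ n" .
  qed
  define g where "g n = H.op_diff (op_one H) (f n)" for n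
  have fops: "f n \<in> H.ops" for n using H.vn_ops[OF A f(1)] .
  have g: "g n \<in> A" "H.hermitian (g n)" for n
    using f fops by (auto simp: g_def H.vn_diff[OF A] H.vn_closed[OF A] H.op_one_in_ops
        intro!: H.hermitian_diff H.hermitian_one)
  have gq: "Re (vinner H (g n x) x) = Re (vinner H x x) - Re (vinner H (f n x) x)"
    if "x \<in> vecs H" for n x
    using that fops by (simp add: g_def H.qf_diff H.op_one_in_ops H.op_one_apply)
  note one = H.vn_closed(1)[OF A] H.hermitian_one
  have \<theta>g: "\<theta> (g n) \<in> B" "K.hermitian (\<theta> (g n))" for n
    using g by (auto intro: hom_mem hom_hermitian)
  have "\<exists>L\<in>B. K.hermitian L \<and>
      (\<forall>y\<in>vecs K. (\<lambda>n. Re (vinner K (\<theta> (g n) y) y)) \<longlonglongrightarrow> Re (vinner K (L y) y))"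
  proof (rule K.monotone_limit[OF B \<theta>g])
    fix n y assume y: "y \<in> vecs K"
    show "0 \<le> Re (vinner K (\<theta> (g n) y) y)"
      using f_bounds by (intro hom_positive g y) (auto simp: gq)
    show "Re (vinner K (\<theta> (g n) y) y) \<le> Re (vinner K y y)"
      using hom_mono[OF g one _ y] f_bounds y
      by (simp add: gq H.op_one_apply hom_one K.op_one_apply)
    show "Re (vinner K (\<theta> (g n) y) y) \<le> Re (vinner K (\<theta> (g (Suc n)) y) y)"
      using f_decreasing by (intro hom_mono g y) (auto simp: gq)
  qed
  then obtain G where G: "G \<in> B" "K.hermitian G"
      and Glim: "\<And>y. y \<in> vecs K \<Longrightarrow>
        (\<lambda>n. Re (vinner K (\<theta> (g n) y) y)) \<longlonglongrightarrow> Re (vinner K (G y) y)" by blast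
  interpret inv: vn_isomorphism K H B A "inv_into A \<theta>" by (rule vn_isomorphism_inverse)
  define T where "T = inv_into A \<theta> G"
  have T: "T \<in> A" "\<theta> T = G" "H.hermitian T"
    using G bij by (auto simp: T_def bij_betw_def inv_into_into f_inv_into_f inv.hom_hermitian)
  have inv_g: "inv_into A \<theta> (\<theta> (g n)) = g n" "inv_into A \<theta> (op_one K) = op_one H" for n
    using g bij inv.hom_one by (auto simp: bij_betw_def)
  have g_le_T: "Re (vinner H (g n x) x) \<le> Re (vinner H (T x) x)" if x: "x \<in> vecs H" for n x
  proof -
    have "Re (vinner K (\<theta> (g n) y) y) \<le> Re (vinner K (G y) y)" if y: "y \<in> vecs K" for y
    proof (rule incseq_le[OF _ Glim[OF y]])
      show "incseq (\<lambda>n. Re (vinner K (\<theta> (g n) y) y))"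
        using f_decreasing by (intro incseq_SucI hom_mono g y) (auto simp: gq)
    qed
    from inv.hom_mono[OF \<theta>g G this x] show ?thesis by (simp add: inv_g T_def)
  qed
  have T_le: "Re (vinner H (T x) x) \<le> Re (vinner H x x)" if x: "x \<in> vecs H" for x
  proof -
    have "Re (vinner K (G y) y) \<le> Re (vinner K (op_one K y) y)" if y: "y \<in> vecs K" for y
      using hom_mono[OF g one _ y] f_bounds y
      by (intro LIMSEQ_le_const2[OF Glim[OF y]])
        (auto simp: gq H.op_one_apply hom_one K.op_one_apply)
    from inv.hom_mono[OF G K.vn_closed(1)[OF B] K.hermitian_one this x]
    show ?thesis using x by (simp add: inv_g T_def H.op_one_apply)
  qed
  have Tops: "T \<in> H.ops" using H.vn_ops[OF A T(1)] .
  define D where "D = H.op_diff (op_one H) T"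
  have D: "D \<in> A" "D \<in> H.ops" "H.hermitian D"
    using T Tops by (auto simp: D_def H.vn_diff[OF A] H.vn_closed[OF A] H.op_one_in_ops H.op_diff_in_ops
        intro!: H.hermitian_diff H.hermitian_one)
  have Dq: "Re (vinner H (D x) x) = Re (vinner H x x) - Re (vinner H (T x) x)"
    if "x \<in> vecs H" for x
    using that Tops by (simp add: D_def H.qf_diff H.op_one_in_ops H.op_one_apply)
  have "Re (vinner H (D \<xi>) \<xi>) \<le> 0"
  proof (rule LIMSEQ_le_const)
    show "(\<lambda>n. 2 * (1/2 :: real) ^ n) \<longlonglongrightarrow> 0"
      by (intro tendsto_mult_right_zero LIMSEQ_power_zero) auto
    show "\<exists>N. \<forall>n\<ge>N. Re (vinner H (D \<xi>) \<xi>) \<le> 2 * (1/2 :: real) ^ n"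
    proof (intro exI allI impI)
      fix n
      show "Re (vinner H (D \<xi>) \<xi>) \<le> 2 * (1/2 :: real) ^ n"
        using f_xi[of n] g_le_T[OF \<xi>(1), of n] \<xi>(1) by (simp add: Dq gq)
    qed
  qed
  then have "Re (vinner H (D \<xi>) \<xi>) = 0" using T_le[OF \<xi>(1)] by (simp add: Dq \<xi>(1))
  then have "D \<xi> = vzero H"
    using T_le by (intro H.positive_zero_vec D \<xi>(1)) (auto simp: Dq)
  then have D0: "D = op_zero H" by (rule \<xi>(2)[OF D(1)])
  have "T = op_one H"
  proof (rule H.op_inner_ext[OF Tops H.op_one_in_ops])
    fix x y assume xy: "x \<in> vecs H" "y \<in> vecs H"
    have "H.vsub x (T x) = vzero H"
      using D0 xy by (metis D_def H.op_diff_apply H.op_one_apply H.op_zero_apply)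
    then show "vinner H (T x) y = vinner H (op_one H x) y"
      using H.inner_sub_left[OF xy(1) H.op_closed[OF Tops xy(1)] xy(2)] xy
      by (simp add: H.inner_zero_left H.op_one_apply)
  qed
  then have G1: "G = op_one K" using T hom_one by simp
  have upper: "Re (vinner K (\<theta> (g n) \<eta>) \<eta>) \<le> Re (vinner K \<eta> \<eta>) - \<delta> / (2 + C)" for n
  proof -
    define a where "a = op_mult H (adjoint_op H (z n)) (z n)"
    let ?f = "op_scale H (of_real (2 + C)) (f n)"
    have zn: "z n \<in> H.ops" using H.vn_ops[OF A z] .
    have a: "a \<in> A" "a \<in> H.ops" using z H.vn_ops[OF A] by (auto simp: a_def H.vn_closed[OF A])
    have "H.hermitian a"
      unfolding H.hermitian_iff[OF a(2)] using zn
      by (simp add: a_def H.adjoint_mult H.adjoint_in_ops H.adjoint_adjoint)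
    moreover have "Re (vinner H (a x) x) \<le> Re (vinner H (?f x) x)" if x: "x \<in> vecs H" for x
    proof -
      have "Re (vinner H (a x) x) = q n x"
        using x zn by (simp add: a_def q_def H.op_apply H.adjoint_inner' H.op_closed)
      also have "\<dots> \<le> (2 + C) * Re (vinner H (F {n..<Suc n} x) x)" using z_le_F[OF x] by simp
      also have "\<dots> \<le> (2 + C) * Re (vinner H (f n x) x)"
        using C(1) F_le_f[OF x] by (intro mult_left_mono) (blast, simp)
      also have "\<dots> = Re (vinner H (?f x) x)" using fops x by (simp only: H.qf_scale)
      finally show ?thesis .
    qed
    ultimately have "Re (vinner K (\<theta> a \<eta>) \<eta>) \<le> Re (vinner K (\<theta> ?f \<eta>) \<eta>)"
      using a f fops by (intro hom_mono \<eta>(1) H.hermitian_scale H.vn_closed(3)[OF A])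
    also have "\<dots> = (2 + C) * Re (vinner K (\<theta> (f n) \<eta>) \<eta>)"
      using \<eta>(1) K.vn_ops[OF B hom_mem[OF f(1)]] by (simp only: hom_scale[OF f(1)] K.qf_scale)
    finally have "\<delta> \<le> (2 + C) * Re (vinner K (\<theta> (f n) \<eta>) \<eta>)"
      using \<eta>(3)[of n] hom_norm_sq[OF z \<eta>(1), of n] by (simp add: a_def)
    then have "\<delta> / (2 + C) \<le> Re (vinner K (\<theta> (f n) \<eta>) \<eta>)"
      using C(1) by (simp add: field_simps)
    moreover have "Re (vinner K (\<theta> (g n) \<eta>) \<eta>) = Re (vinner K \<eta> \<eta>) - Re (vinner K (\<theta> (f n) \<eta>) \<eta>)"
      using \<eta>(1) f one K.vn_ops[OF B hom_mem[OF f(1)]]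
      by (simp add: g_def hom_diff hom_one K.qf_diff K.op_one_in_ops K.op_one_apply)
    ultimately show ?thesis by simp
  qed
  have "Re (vinner K (G \<eta>) \<eta>) \<le> Re (vinner K \<eta> \<eta>) - \<delta> / (2 + C)"
    by (rule LIMSEQ_le_const2[OF Glim[OF \<eta>(1)]]) (use upper in blast)
  then show False
    using G1 \<eta>(1) divide_pos_pos[OF \<eta>(2), of "2 + C"] C(1) by (simp add: K.op_one_apply)
qed

text \<open>Algebraic isomorphisms are continuous on bounded sequences: if the \<open>z\<^sub>n\<close> tend to \<open>0\<close> at one separating
  vector, then their images tend to \<open>0\<close> strongly. Otherwise a subsequence decays at \<open>\<xi>\<close> as fast as \<open>2\<^sup>-\<^sup>j\<close>
  while its images stay away from \<open>0\<close> at \<open>\<eta>\<close>.\<close>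

theorem hom_normal:
  assumes \<xi>: "\<xi> \<in> vecs H" "\<And>T. \<lbrakk>T \<in> A; T \<xi> = vzero H\<rbrakk> \<Longrightarrow> T = op_zero H"
    and z: "\<And>n. z n \<in> A"
    and C: "0 \<le> C" "\<And>n x. x \<in> vecs H \<Longrightarrow> Re (vinner H (z n x) (z n x)) \<le> C * Re (vinner H x x)"
    and lim: "(\<lambda>n. Re (vinner H (z n \<xi>) (z n \<xi>))) \<longlonglongrightarrow> 0"
    and \<eta>: "\<eta> \<in> vecs K"
  shows "(\<lambda>n. Re (vinner K (\<theta> (z n) \<eta>) (\<theta> (z n) \<eta>))) \<longlonglongrightarrow> 0"
proof (rule ccontr)
  assume not: "\<not> ?thesis"
  have nonneg: "0 \<le> Re (vinner K (\<theta> (z n) \<eta>) (\<theta> (z n) \<eta>))" for n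
    using K.op_closed[OF K.vn_ops[OF B hom_mem[OF z]] \<eta>] by (rule K.inner_nonneg)
  from not obtain \<delta> where \<delta>: "0 < \<delta>"
      "\<And>N. \<exists>n\<ge>N. \<delta> \<le> Re (vinner K (\<theta> (z n) \<eta>) (\<theta> (z n) \<eta>))"
    using nonneg unfolding LIMSEQ_def by (auto simp: dist_real_def not_less)
  have "\<exists>n. Re (vinner H (z n \<xi>) (z n \<xi>)) \<le> (1/2) ^ j \<and> \<delta> \<le> Re (vinner K (\<theta> (z n) \<eta>) (\<theta> (z n) \<eta>))"
    for j
  proof -
    have "\<forall>\<^sub>F n in sequentially. Re (vinner H (z n \<xi>) (z n \<xi>)) < (1/2) ^ j"
      using order_tendstoD(2)[OF lim] by simp
    then obtain N where "\<And>n. N \<le> n \<Longrightarrow> Re (vinner H (z n \<xi>) (z n \<xi>)) < (1/2) ^ j"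
      by (auto simp: eventually_sequentially)
    then show ?thesis using \<delta>(2)[of N] by (meson less_imp_le)
  qed
  then obtain k where k: "\<And>j. Re (vinner H (z (k j) \<xi>) (z (k j) \<xi>)) \<le> (1/2) ^ j"
      "\<And>j. \<delta> \<le> Re (vinner K (\<theta> (z (k j)) \<eta>) (\<theta> (z (k j)) \<eta>))" by metis
  show False
    by (rule summable_sequence_not_bounded_below[OF \<xi>, of "\<lambda>j. z (k j)" C \<eta> \<delta>])
      (use z C k \<eta> \<delta>(1) in auto)
qed

end

section \<open>Square integrable functions\<close>

lemma l2D:
  assumes "f \<in> l2_functions \<mu>"
  shows l2_measurable: "f \<in> borel_measurable \<mu>"
    and l2_integrable: "integrable \<mu> (\<lambda>x. (cmod (f x))\<^sup>2)"
  using assms by (auto simp: l2_functions_def)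

lemma l2_boundI:
  assumes "g \<in> borel_measurable \<mu>" "integrable \<mu> h" "AE x in \<mu>. (cmod (g x))\<^sup>2 \<le> h x"
  shows "g \<in> l2_functions \<mu>"
proof -
  have "integrable \<mu> (\<lambda>x. (cmod (g x))\<^sup>2)"
    by (rule Bochner_Integration.integrable_bound[OF assms(2)])
      (use assms in \<open>auto elim!: eventually_mono\<close>)
  then show ?thesis using assms(1) by (simp add: l2_functions_def)
qed

lemma cmod_add_sq_le: "(cmod (a + b))\<^sup>2 \<le> 2 * (cmod a)\<^sup>2 + 2 * (cmod b)\<^sup>2"
proof -
  have "(cmod (a + b))\<^sup>2 \<le> (cmod a + cmod b)\<^sup>2"
    by (intro power_mono norm_triangle_ineq) auto
  also have "\<dots> \<le> 2 * (cmod a)\<^sup>2 + 2 * (cmod b)\<^sup>2"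
    using sum_squares_bound[of "cmod a" "cmod b"] by (simp add: power2_sum)
  finally show ?thesis .
qed

lemma cmod_diff_sq_le: "(cmod (a - b))\<^sup>2 \<le> 2 * (cmod a)\<^sup>2 + 2 * (cmod b)\<^sup>2"
  using cmod_add_sq_le[of a "- b"] by simp

lemma l2_add: "\<lbrakk>f \<in> l2_functions \<mu>; g \<in> l2_functions \<mu>\<rbrakk> \<Longrightarrow> (\<lambda>x. f x + g x) \<in> l2_functions \<mu>"
  by (rule l2_boundI[where h = "\<lambda>x. 2 * (cmod (f x))\<^sup>2 + 2 * (cmod (g x))\<^sup>2"])
    (auto simp: l2_measurable l2_integrable intro!: cmod_add_sq_le borel_measurable_add)

lemma l2_scale: "f \<in> l2_functions \<mu> \<Longrightarrow> (\<lambda>x. c * f x) \<in> l2_functions \<mu>"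
  by (rule l2_boundI[where h = "\<lambda>x. (cmod c)\<^sup>2 * (cmod (f x))\<^sup>2"])
    (auto simp: l2_measurable l2_integrable norm_mult power_mult_distrib
      intro!: borel_measurable_times)

lemma l2_diff: "\<lbrakk>f \<in> l2_functions \<mu>; g \<in> l2_functions \<mu>\<rbrakk> \<Longrightarrow> (\<lambda>x. f x - g x) \<in> l2_functions \<mu>"
  using l2_add[of f \<mu> "\<lambda>x. -1 * g x"] l2_scale[of g \<mu> "-1"] by simp

lemma l2_zero: "(\<lambda>_. 0) \<in> l2_functions \<mu>"
  by (simp add: l2_functions_def)

lemma l2_mult_integrable:
  assumes f: "f \<in> l2_functions \<mu>" and g: "g \<in> l2_functions \<mu>"
  shows "integrable \<mu> (\<lambda>x. f x * cnj (g x))"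
proof (rule Bochner_Integration.integrable_bound)
  show "integrable \<mu> (\<lambda>x. (cmod (f x))\<^sup>2 + (cmod (g x))\<^sup>2)" using l2D[OF f] l2D[OF g] by simp
  show "(\<lambda>x. f x * cnj (g x)) \<in> borel_measurable \<mu>"
    using l2D(1)[OF f] l2D(1)[OF g]
    by (intro borel_measurable_times borel_measurable_continuous_on[where f = cnj])
      (auto intro: continuous_intros)
  have "cmod (f x * cnj (g x)) \<le> (cmod (f x))\<^sup>2 + (cmod (g x))\<^sup>2" for x
  proof -
    have "0 \<le> cmod (f x) * cmod (g x)" by simp
    then show ?thesis
      unfolding norm_mult complex_mod_cnj using sum_squares_bound[of "cmod (f x)" "cmod (g x)"]
      by linarith
  qed
  then show "AE x in \<mu>. norm (f x * cnj (g x)) \<le> norm ((cmod (f x))\<^sup>2 + (cmod (g x))\<^sup>2)"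
    by (intro AE_I2) simp
qed

lemma l2_class_cong: "AE x in \<mu>. f x = g x \<Longrightarrow> l2_class \<mu> f = l2_class \<mu> g"
  by (auto simp: l2_class_def elim: eventually_elim2)

lemma
  assumes "f \<in> l2_functions \<mu>"
  shows l2_rep_in: "l2_rep (l2_class \<mu> f) \<in> l2_functions \<mu>"
    and l2_rep_AE: "AE x in \<mu>. l2_rep (l2_class \<mu> f) x = f x"
proof -
  have "f \<in> l2_class \<mu> f" using assms by (simp add: l2_class_def)
  then have "l2_rep (l2_class \<mu> f) \<in> l2_class \<mu> f" unfolding l2_rep_def
    by (rule someI[of "\<lambda>h. h \<in> l2_class \<mu> f"])
  then show "l2_rep (l2_class \<mu> f) \<in> l2_functions \<mu>" "AE x in \<mu>. l2_rep (l2_class \<mu> f) x = f x"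
    by (auto simp: l2_class_def)
qed

lemma L2_vec_cases:
  assumes "F \<in> vecs (L2 \<mu>)"
  obtains f where "f \<in> l2_functions \<mu>" "F = l2_class \<mu> f"
  using assms by (auto simp: L2_def)

lemma L2_rep:
  assumes "F \<in> vecs (L2 \<mu>)"
  shows "l2_rep F \<in> l2_functions \<mu>" "l2_class \<mu> (l2_rep F) = F"
proof -
  obtain f where f: "f \<in> l2_functions \<mu>" "F = l2_class \<mu> f" using L2_vec_cases[OF assms] .
  show "l2_rep F \<in> l2_functions \<mu>" using f l2_rep_in by blast
  show "l2_class \<mu> (l2_rep F) = F" using f l2_rep_AE[OF f(1)] by (simp add: l2_class_cong)
qed

lemma L2_class_in: "f \<in> l2_functions \<mu> \<Longrightarrow> l2_class \<mu> f \<in> vecs (L2 \<mu>)"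
  by (simp add: L2_def)

lemma l2_class_eq_iff:
  assumes "f \<in> l2_functions \<mu>"
  shows "l2_class \<mu> f = l2_class \<mu> g \<longleftrightarrow> (AE x in \<mu>. f x = g x)"
proof
  assume "l2_class \<mu> f = l2_class \<mu> g"
  moreover have "f \<in> l2_class \<mu> f" using assms by (simp add: l2_class_def)
  ultimately show "AE x in \<mu>. f x = g x" by (auto simp: l2_class_def)
qed (rule l2_class_cong)

lemma L2_vadd:
  assumes f: "f \<in> l2_functions \<mu>" and g: "g \<in> l2_functions \<mu>"
  shows "vadd (L2 \<mu>) (l2_class \<mu> f) (l2_class \<mu> g) = l2_class \<mu> (\<lambda>x. f x + g x)"
proof -
  have "AE x in \<mu>. l2_rep (l2_class \<mu> f) x + l2_rep (l2_class \<mu> g) x = f x + g x"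
    using l2_rep_AE[OF f] l2_rep_AE[OF g] by eventually_elim simp
  then show ?thesis by (simp add: L2_def l2_class_cong)
qed

lemma L2_vscale:
  assumes f: "f \<in> l2_functions \<mu>"
  shows "vscale (L2 \<mu>) c (l2_class \<mu> f) = l2_class \<mu> (\<lambda>x. c * f x)"
proof -
  have "AE x in \<mu>. c * l2_rep (l2_class \<mu> f) x = c * f x"
    using l2_rep_AE[OF f] by eventually_elim simp
  then show ?thesis by (simp add: L2_def l2_class_cong)
qed

lemma L2_vzero: "vzero (L2 \<mu>) = l2_class \<mu> (\<lambda>_. 0)"
  by (simp add: L2_def)

lemma L2_inner:
  assumes f: "f \<in> l2_functions \<mu>" and g: "g \<in> l2_functions \<mu>"
  shows "vinner (L2 \<mu>) (l2_class \<mu> f) (l2_class \<mu> g) = (\<integral>x. f x * cnj (g x) \<partial>\<mu>)"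
proof -
  have "(\<integral>x. l2_rep (l2_class \<mu> f) x * cnj (l2_rep (l2_class \<mu> g) x) \<partial>\<mu>) = (\<integral>x. f x * cnj (g x) \<partial>\<mu>)"
  proof (rule integral_cong_AE)
    show "AE x in \<mu>. l2_rep (l2_class \<mu> f) x * cnj (l2_rep (l2_class \<mu> g) x) = f x * cnj (g x)"
      using l2_rep_AE[OF f] l2_rep_AE[OF g] by eventually_elim simp
  qed (use l2_mult_integrable f g l2_rep_in in \<open>blast intro: borel_measurable_integrable\<close>)+
  then show ?thesis by (simp add: L2_def)
qed

lemma L2_norm_sq:
  assumes f: "f \<in> l2_functions \<mu>"
  shows "Re (vinner (L2 \<mu>) (l2_class \<mu> f) (l2_class \<mu> f)) = (\<integral>x. (cmod (f x))\<^sup>2 \<partial>\<mu>)"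
proof -
  have "f x * cnj (f x) = of_real ((cmod (f x))\<^sup>2)" for x by (rule complex_norm_square[symmetric])
  then have "vinner (L2 \<mu>) (l2_class \<mu> f) (l2_class \<mu> f) = (\<integral>x. of_real ((cmod (f x))\<^sup>2) \<partial>\<mu>)"
    using f by (simp add: L2_inner)
  also have "\<dots> = of_real (\<integral>x. (cmod (f x))\<^sup>2 \<partial>\<mu>)"
    by (rule integral_complex_of_real)
  finally show ?thesis by simp
qed

lemma L2_vsub:
  assumes f: "f \<in> l2_functions \<mu>" and g: "g \<in> l2_functions \<mu>"
  shows "vadd (L2 \<mu>) (l2_class \<mu> f) (vscale (L2 \<mu>) (-1) (l2_class \<mu> g)) = l2_class \<mu> (\<lambda>x. f x - g x)"
  using f g l2_scale[OF g, of "-1"] by (simp add: L2_vscale L2_vadd)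

lemma l2_nn_integral:
  assumes "f \<in> l2_functions \<mu>"
  shows "(\<integral>\<^sup>+x. ennreal ((cmod (f x))\<^sup>2) \<partial>\<mu>) = ennreal (\<integral>x. (cmod (f x))\<^sup>2 \<partial>\<mu>)"
  using l2D[OF assms] by (intro nn_integral_eq_integral) auto

lemma l2I_nn_integral:
  assumes "f \<in> borel_measurable \<mu>" "(\<integral>\<^sup>+x. ennreal ((cmod (f x))\<^sup>2) \<partial>\<mu>) < \<infinity>"
  shows "f \<in> l2_functions \<mu>"
  using assms by (simp add: l2_functions_def integrable_iff_bounded)

text \<open>The Riesz--Fischer theorem. If consecutive differences \<open>d\<^sub>j\<close> of a subsequence satisfy
  \<open>\<parallel>d\<^sub>j\<parallel>\<^sup>2 \<le> 4\<^sup>-\<^sup>j\<close>, then \<open>\<Sum> 2\<^sup>j |d\<^sub>j|\<^sup>2\<close> is integrable, so that \<open>|d\<^sub>j|\<close> decays geometrically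
  almost everywhere.\<close>

lemma riesz_fischer:
  assumes f: "\<And>n. f n \<in> l2_functions \<mu>"
    and Cauchy: "\<And>e::real. 0 < e \<Longrightarrow> \<exists>N. \<forall>m\<ge>N. \<forall>n\<ge>N. (\<integral>x. (cmod (f m x - f n x))\<^sup>2 \<partial>\<mu>) < e"
  shows "\<exists>g\<in>l2_functions \<mu>. (\<lambda>n. \<integral>x. (cmod (f n x - g x))\<^sup>2 \<partial>\<mu>) \<longlonglongrightarrow> 0"
proof -
  have "\<exists>N. \<forall>m\<ge>N. \<forall>n\<ge>N. (\<integral>x. (cmod (f m x - f n x))\<^sup>2 \<partial>\<mu>) < (1/4) ^ j" for j
    by (rule Cauchy) simp
  then obtain k where k: "\<And>j m n. \<lbrakk>k j \<le> m; k j \<le> n\<rbrakk> \<Longrightarrow>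
      (\<integral>x. (cmod (f m x - f n x))\<^sup>2 \<partial>\<mu>) < (1/4) ^ j" by metis
  define r where "r j = (\<Sum>i\<le>j. k i)" for j :: nat
  have kr: "k j \<le> r j" "r j \<le> r (Suc j)" for j
    by (auto simp: r_def intro: member_le_sum)
  have r_mono: "mono r" using kr(2) by (simp add: mono_iff_le_Suc)
  define d where "d j x = f (r (Suc j)) x - f (r j) x" for j x
  have fm[measurable]: "f n \<in> borel_measurable \<mu>" for n using l2D[OF f] by blast
  have dm[measurable]: "d j \<in> borel_measurable \<mu>" for j unfolding d_def by measurable
  have dl2: "d j \<in> l2_functions \<mu>" for j unfolding d_def by (intro l2_diff f)
  have dsmall: "(\<integral>\<^sup>+x. ennreal ((cmod (d j x))\<^sup>2) \<partial>\<mu>) \<le> ennreal ((1/4) ^ j)" for j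
    using k[of j "r (Suc j)" "r j"] kr[of j] unfolding l2_nn_integral[OF dl2]
    by (intro ennreal_leI) (auto simp: d_def)
  have "(\<integral>\<^sup>+x. (\<Sum>j. ennreal (2 ^ j * (cmod (d j x))\<^sup>2)) \<partial>\<mu>)
      = (\<Sum>j. \<integral>\<^sup>+x. ennreal (2 ^ j * (cmod (d j x))\<^sup>2) \<partial>\<mu>)"
    by (rule nn_integral_suminf) measurable
  also have "\<dots> \<le> (\<Sum>j. ennreal ((1/2) ^ j))"
  proof (intro suminf_le)
    fix j
    have "(\<integral>\<^sup>+x. ennreal (2 ^ j * (cmod (d j x))\<^sup>2) \<partial>\<mu>) = ennreal (2 ^ j) * (\<integral>\<^sup>+x. ennreal ((cmod (d j x))\<^sup>2) \<partial>\<mu>)"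
      by (simp add: ennreal_mult nn_integral_cmult)
    also have "\<dots> \<le> ennreal (2 ^ j) * ennreal ((1/4) ^ j)"
      using dsmall by (intro mult_left_mono) auto
    also have "\<dots> = ennreal ((1/2) ^ j)"
    proof -
      have "(2 :: real) ^ j * (1/4) ^ j = (1/2) ^ j"
        unfolding power_mult_distrib[symmetric] by simp
      then show ?thesis by (subst ennreal_mult[symmetric]) auto
    qed
    finally show "(\<integral>\<^sup>+x. ennreal (2 ^ j * (cmod (d j x))\<^sup>2) \<partial>\<mu>) \<le> ennreal ((1/2) ^ j)" .
  qed auto
  also have "\<dots> = ennreal (\<Sum>j. (1/2) ^ j)"
    by (rule suminf_ennreal2) (auto intro: summable_geometric)
  also have "\<dots> < \<infinity>" by simp
  finally have "AE x in \<mu>. (\<Sum>j. ennreal (2 ^ j * (cmod (d j x))\<^sup>2)) \<noteq> \<infinity>"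
    by (intro nn_integral_PInf_AE) auto
  then have conv: "AE x in \<mu>. convergent (\<lambda>j. f (r j) x)"
  proof eventually_elim
    fix x assume fin: "(\<Sum>j. ennreal (2 ^ j * (cmod (d j x))\<^sup>2)) \<noteq> \<infinity>"
    define C where "C = enn2real (\<Sum>j. ennreal (2 ^ j * (cmod (d j x))\<^sup>2))"
    have C: "0 \<le> C" "(\<Sum>j. ennreal (2 ^ j * (cmod (d j x))\<^sup>2)) = ennreal C"
      unfolding C_def using fin by (auto simp: less_top)
    have "cmod (d j x) \<le> sqrt C * (sqrt (1/2)) ^ j" for j
    proof -
      have "ennreal (2 ^ j * (cmod (d j x))\<^sup>2) \<le> ennreal C"
      proof -
        have "(\<Sum>i\<in>{j}. ennreal (2 ^ i * (cmod (d i x))\<^sup>2)) \<le> (\<Sum>j. ennreal (2 ^ j * (cmod (d j x))\<^sup>2))"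
          by (rule sum_le_suminf[OF summableI]) (rule finite.insertI[OF finite.emptyI], rule zero_le)
        then show ?thesis unfolding C(2) by (simp only: sum.insert_if finite.emptyI empty_iff sum.empty add_0_right if_False)
      qed
      then have "2 ^ j * (cmod (d j x))\<^sup>2 \<le> C" using C(1) by (simp add: ennreal_le_iff)
      then have "(cmod (d j x))\<^sup>2 \<le> C * (1/2) ^ j" by (simp add: field_simps)
      also have "\<dots> = (sqrt C * (sqrt (1/2)) ^ j)\<^sup>2"
        using C(1) by (simp add: power_mult_distrib flip: power_mult)
          (simp add: power_mult mult.commute[of j])
      finally show ?thesis by (rule power2_le_imp_le) (use C(1) in auto)
    qed
    moreover have "summable (\<lambda>j. sqrt C * (sqrt (1/2)) ^ j)"
      by (intro summable_mult summable_geometric) (simp add: real_sqrt_divide)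
    ultimately have "summable (\<lambda>j. d j x)"
      using summable_comparison_test'[of "\<lambda>j. sqrt C * (sqrt (1/2)) ^ j" 0 "\<lambda>j. d j x"] by blast
    then have "convergent (\<lambda>n. (\<Sum>j<n. d j x) + f (r 0) x)"
      by (intro convergent_add convergent_const) (simp add: summable_iff_convergent)
    moreover have "(\<Sum>j<n. d j x) + f (r 0) x = f (r n) x" for n
      unfolding d_def by (subst sum_lessThan_telescope) simp
    ultimately show "convergent (\<lambda>j. f (r j) x)" by simp
  qed
  define g where "g x = lim (\<lambda>j. f (r j) x)" for x
  have gm[measurable]: "g \<in> borel_measurable \<mu>" unfolding g_def by measurable
  have close: "(\<integral>\<^sup>+x. ennreal ((cmod (f m x - g x))\<^sup>2) \<partial>\<mu>) \<le> ennreal ((1/4) ^ j)" if m: "k j \<le> m" for j m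
  proof -
    have "AE x in \<mu>. ennreal ((cmod (f m x - g x))\<^sup>2) = liminf (\<lambda>i. ennreal ((cmod (f m x - f (r i) x))\<^sup>2))"
      using conv
    proof eventually_elim
      fix x assume "convergent (\<lambda>j. f (r j) x)"
      then have "(\<lambda>j. f (r j) x) \<longlonglongrightarrow> g x" by (simp add: g_def convergent_LIMSEQ_iff)
      then have "(\<lambda>i. ennreal ((cmod (f m x - f (r i) x))\<^sup>2)) \<longlonglongrightarrow> ennreal ((cmod (f m x - g x))\<^sup>2)"
        by (intro tendsto_ennrealI tendsto_intros)
      then show "ennreal ((cmod (f m x - g x))\<^sup>2) = liminf (\<lambda>i. ennreal ((cmod (f m x - f (r i) x))\<^sup>2))"
        using lim_imp_Liminf[OF sequentially_bot] by metis
    qed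
    then have "(\<integral>\<^sup>+x. ennreal ((cmod (f m x - g x))\<^sup>2) \<partial>\<mu>)
        = (\<integral>\<^sup>+x. liminf (\<lambda>i. ennreal ((cmod (f m x - f (r i) x))\<^sup>2)) \<partial>\<mu>)"
      by (rule nn_integral_cong_AE)
    also have "\<dots> \<le> liminf (\<lambda>i. \<integral>\<^sup>+x. ennreal ((cmod (f m x - f (r i) x))\<^sup>2) \<partial>\<mu>)"
      by (rule nn_integral_liminf) measurable
    also have "\<dots> \<le> ennreal ((1/4) ^ j)"
    proof (rule Liminf_le)
      show "\<forall>\<^sub>F i in sequentially. (\<integral>\<^sup>+x. ennreal ((cmod (f m x - f (r i) x))\<^sup>2) \<partial>\<mu>) \<le> ennreal ((1/4) ^ j)"
        unfolding eventually_sequentially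
      proof (intro exI allI impI)
        fix i assume "j \<le> i"
        then have "k j \<le> r i" using kr(1)[of j] monoD[OF r_mono, of j i] by simp
        then show "(\<integral>\<^sup>+x. ennreal ((cmod (f m x - f (r i) x))\<^sup>2) \<partial>\<mu>) \<le> ennreal ((1/4) ^ j)"
          unfolding l2_nn_integral[OF l2_diff[OF f f]] using k[OF m] by (intro ennreal_leI less_imp_le) auto
      qed
    qed simp
    finally show ?thesis .
  qed
  have fg: "(\<lambda>x. f m x - g x) \<in> l2_functions \<mu>" if "k j \<le> m" for j m
    using close[OF that] by (intro l2I_nn_integral) (auto simp: order_le_less_trans)
  have "g \<in> l2_functions \<mu>"
    using l2_diff[OF f[of "k 0"] fg[of 0 "k 0"]] by simp
  moreover have "(\<lambda>n. \<integral>x. (cmod (f n x - g x))\<^sup>2 \<partial>\<mu>) \<longlonglongrightarrow> 0"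
  proof (rule LIMSEQ_I)
    fix e :: real assume e: "0 < e"
    obtain j where j: "(1/4 :: real) ^ j < e" using real_arch_pow_inv[OF e, of "1/4"] by auto
    have "norm ((\<integral>x. (cmod (f n x - g x))\<^sup>2 \<partial>\<mu>) - 0) < e" if "k j \<le> n" for n
    proof -
      have "ennreal (\<integral>x. (cmod (f n x - g x))\<^sup>2 \<partial>\<mu>) \<le> ennreal ((1/4) ^ j)"
        using close[OF that] l2_nn_integral[OF fg[OF that]] by simp
      then have "(\<integral>x. (cmod (f n x - g x))\<^sup>2 \<partial>\<mu>) \<le> (1/4) ^ j" by (simp add: ennreal_le_iff)
      moreover have "0 \<le> (\<integral>x. (cmod (f n x - g x))\<^sup>2 \<partial>\<mu>)" by simp
      ultimately show ?thesis using j by simp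
    qed
    then show "\<exists>N. \<forall>n\<ge>N. norm ((\<integral>x. (cmod (f n x - g x))\<^sup>2 \<partial>\<mu>) - 0) < e" by blast
  qed
  ultimately show ?thesis by blast
qed

lemma hilbert_space_L2: "hilbert_space (L2 \<mu>)"
proof
  fix F G K c
  note cl = l2_add l2_scale l2_zero l2_diff L2_class_in L2_vadd L2_vscale L2_vzero L2_inner
    l2_mult_integrable
  show "vadd (L2 \<mu>) F G \<in> vecs (L2 \<mu>)" if "F \<in> vecs (L2 \<mu>)" "G \<in> vecs (L2 \<mu>)"
    using that by (auto elim!: L2_vec_cases simp: cl)
  show "vzero (L2 \<mu>) \<in> vecs (L2 \<mu>)" by (simp add: cl)
  show "vscale (L2 \<mu>) c F \<in> vecs (L2 \<mu>)" if "F \<in> vecs (L2 \<mu>)"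
    using that by (auto elim!: L2_vec_cases simp: cl)
  show "vinner (L2 \<mu>) (vadd (L2 \<mu>) F G) K = vinner (L2 \<mu>) F K + vinner (L2 \<mu>) G K"
    if "F \<in> vecs (L2 \<mu>)" "G \<in> vecs (L2 \<mu>)" "K \<in> vecs (L2 \<mu>)"
    using that by (auto elim!: L2_vec_cases simp: cl distrib_right)
  show "vinner (L2 \<mu>) (vscale (L2 \<mu>) c F) K = c * vinner (L2 \<mu>) F K"
    if "F \<in> vecs (L2 \<mu>)" "K \<in> vecs (L2 \<mu>)"
    using that by (auto elim!: L2_vec_cases simp: cl mult.assoc)
  show "vinner (L2 \<mu>) (vzero (L2 \<mu>)) K = 0" if "K \<in> vecs (L2 \<mu>)"
    using that by (auto elim!: L2_vec_cases simp: cl)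
  show "vinner (L2 \<mu>) G F = cnj (vinner (L2 \<mu>) F G)" if F: "F \<in> vecs (L2 \<mu>)" and G: "G \<in> vecs (L2 \<mu>)"
  proof -
    obtain f where f: "f \<in> l2_functions \<mu>" "F = l2_class \<mu> f" using L2_vec_cases[OF F] .
    obtain g where g: "g \<in> l2_functions \<mu>" "G = l2_class \<mu> g" using L2_vec_cases[OF G] .
    have "(\<integral>x. g x * cnj (f x) \<partial>\<mu>) = (\<integral>x. cnj (f x * cnj (g x)) \<partial>\<mu>)" by (simp add: mult.commute)
    also have "\<dots> = cnj (\<integral>x. f x * cnj (g x) \<partial>\<mu>)" by (rule Bochner_Integration.integral_cnj)
    finally show ?thesis using f g by (simp add: L2_inner)
  qed
  show "0 \<le> Re (vinner (L2 \<mu>) F F)" if "F \<in> vecs (L2 \<mu>)"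
    using that by (auto elim!: L2_vec_cases simp: L2_norm_sq)
  show "F = G" if F: "F \<in> vecs (L2 \<mu>)" and G: "G \<in> vecs (L2 \<mu>)"
    and eq: "\<And>K. K \<in> vecs (L2 \<mu>) \<Longrightarrow> vinner (L2 \<mu>) F K = vinner (L2 \<mu>) G K"
  proof -
    obtain f where f: "f \<in> l2_functions \<mu>" "F = l2_class \<mu> f" using L2_vec_cases[OF F] .
    obtain g where g: "g \<in> l2_functions \<mu>" "G = l2_class \<mu> g" using L2_vec_cases[OF G] .
    let ?h = "\<lambda>x. f x - g x"
    have h: "?h \<in> l2_functions \<mu>" using f g by (simp add: l2_diff)
    have "(\<integral>x. f x * cnj (?h x) \<partial>\<mu>) = (\<integral>x. g x * cnj (?h x) \<partial>\<mu>)"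
      using eq[OF L2_class_in[OF h]] f g h by (simp add: L2_inner)
    then have "(\<integral>x. ?h x * cnj (?h x) \<partial>\<mu>) = 0"
      using Bochner_Integration.integral_diff[OF l2_mult_integrable[OF f(1) h] l2_mult_integrable[OF g(1) h]]
      by (simp add: left_diff_distrib)
    then have "(\<integral>x. (cmod (?h x))\<^sup>2 \<partial>\<mu>) = 0"
      using L2_norm_sq[OF h] L2_inner[OF h h] by simp
    then have "AE x in \<mu>. (cmod (?h x))\<^sup>2 = 0"
      using integral_nonneg_eq_0_iff_AE[OF l2D(2)[OF h]] by simp
    then show ?thesis using f g by (auto simp: l2_class_eq_iff)
  qed
  show "\<exists>L\<in>vecs (L2 \<mu>). (\<lambda>n. vnorm (L2 \<mu>) (vadd (L2 \<mu>) (X n) (vscale (L2 \<mu>) (-1) L))) \<longlonglongrightarrow> 0"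
    if X: "\<And>n. X n \<in> vecs (L2 \<mu>)" and Cauchy: "\<And>e. 0 < e \<Longrightarrow>
      \<exists>N. \<forall>m\<ge>N. \<forall>n\<ge>N. vnorm (L2 \<mu>) (vadd (L2 \<mu>) (X m) (vscale (L2 \<mu>) (-1) (X n))) < e" for X
  proof -
    define f where "f n = l2_rep (X n)" for n
    have f: "f n \<in> l2_functions \<mu>" "X n = l2_class \<mu> (f n)" for n
      using L2_rep[OF X] by (auto simp: f_def)
    have norm: "vnorm (L2 \<mu>) (vadd (L2 \<mu>) (X m) (vscale (L2 \<mu>) (-1) (l2_class \<mu> g)))
        = sqrt (\<integral>x. (cmod (f m x - g x))\<^sup>2 \<partial>\<mu>)" if "g \<in> l2_functions \<mu>" for m g
      using f that by (simp add: L2_vsub vnorm_def L2_norm_sq l2_diff)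
    have Cauchy': "\<exists>N. \<forall>m\<ge>N. \<forall>n\<ge>N. (\<integral>x. (cmod (f m x - f n x))\<^sup>2 \<partial>\<mu>) < e" if e: "0 < e" for e
      using Cauchy[of "sqrt e"] e norm[OF f(1)] f(2) by simp
    obtain g where g: "g \<in> l2_functions \<mu>" "(\<lambda>n. \<integral>x. (cmod (f n x - g x))\<^sup>2 \<partial>\<mu>) \<longlonglongrightarrow> 0"
      using riesz_fischer[OF f(1) Cauchy'] by blast
    have "(\<lambda>n. sqrt (\<integral>x. (cmod (f n x - g x))\<^sup>2 \<partial>\<mu>)) \<longlonglongrightarrow> 0"
      using tendsto_real_sqrt[OF g(2)] by simp
    then show ?thesis using norm[OF g(1)] L2_class_in[OF g(1)] by (intro bexI[of _ "l2_class \<mu> g"]) simp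
  qed
qed

interpretation L2: hilbert_space "L2 \<mu>" for \<mu>
  by (rule hilbert_space_L2)

section \<open>Weighted composition operators\<close>

definition preserving :: "'a measure \<Rightarrow> ('a \<Rightarrow> 'a) \<Rightarrow> bool" where
  "preserving \<nu> \<tau> \<longleftrightarrow> \<tau> \<in> measurable \<nu> \<nu> \<and> distr \<nu> \<nu> \<tau> = \<nu>"

text \<open>The generators of the algebras below and the elements of their commutants that are needed are all of
  this form.\<close>

definition wcomp :: "'a measure \<Rightarrow> ('a \<Rightarrow> complex) \<Rightarrow> ('a \<Rightarrow> 'a) \<Rightarrow>
    ('a \<Rightarrow> complex) set \<Rightarrow> ('a \<Rightarrow> complex) set" where
  "wcomp \<nu> w \<tau> = l2_op \<nu> (\<lambda>f p. w p * f (\<tau> p))"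

lemma preserving_id: "preserving \<nu> (\<lambda>p. p)"
  by (simp add: preserving_def distr_id2)

lemma preserving_AE: "\<lbrakk>preserving \<nu> \<tau>; AE x in \<nu>. P x\<rbrakk> \<Longrightarrow> AE x in \<nu>. P (\<tau> x)"
  unfolding preserving_def by (metis AE_distrD)

lemma preserving_integral:
  fixes f :: "'a \<Rightarrow> 'b :: {banach, second_countable_topology}"
  assumes "preserving \<nu> \<tau>" "f \<in> borel_measurable \<nu>"
  shows "(\<integral>x. f (\<tau> x) \<partial>\<nu>) = (\<integral>x. f x \<partial>\<nu>)"
  using integral_distr[of \<tau> \<nu> \<nu> f] assms by (simp add: preserving_def)

lemma preserving_integrable:
  fixes f :: "'a \<Rightarrow> 'b :: {banach, second_countable_topology}"
  assumes "preserving \<nu> \<tau>" "integrable \<nu> f"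
  shows "integrable \<nu> (\<lambda>x. f (\<tau> x))"
  using integrable_distr[of \<tau> \<nu> \<nu> f] assms by (simp add: preserving_def)

lemma essentially_bounded_const: "(\<lambda>_. c) \<in> essentially_bounded \<nu>"
  by (auto simp: essentially_bounded_def)

lemma essentially_boundedE:
  assumes "w \<in> essentially_bounded \<nu>"
  obtains C where "0 \<le> C" "w \<in> borel_measurable \<nu>" "AE x in \<nu>. cmod (w x) \<le> C"
proof -
  obtain C where C: "w \<in> borel_measurable \<nu>" "AE x in \<nu>. cmod (w x) \<le> C"
    using assms by (auto simp: essentially_bounded_def)
  then have "AE x in \<nu>. cmod (w x) \<le> \<bar>C\<bar>" by (auto elim!: eventually_mono)
  then show ?thesis using that[of "\<bar>C\<bar>"] C by simp
qed

lemma essentially_bounded_cnj: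
  assumes "w \<in> essentially_bounded \<nu>" shows "(\<lambda>x. cnj (w x)) \<in> essentially_bounded \<nu>"
proof -
  have "(\<lambda>x. cnj (w x)) \<in> borel_measurable \<nu>"
    using assms by (intro borel_measurable_continuous_on[where f = cnj])
      (auto simp: essentially_bounded_def intro: continuous_intros)
  then show ?thesis using assms by (auto simp: essentially_bounded_def)
qed

lemma essentially_bounded_preserving:
  assumes "preserving \<nu> \<tau>" "w \<in> essentially_bounded \<nu>"
  shows "(\<lambda>x. w (\<tau> x)) \<in> essentially_bounded \<nu>"
proof -
  obtain C where C: "w \<in> borel_measurable \<nu>" "AE x in \<nu>. cmod (w x) \<le> C"
    using assms by (auto simp: essentially_bounded_def)
  have "(\<lambda>x. w (\<tau> x)) \<in> borel_measurable \<nu>"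
    using C(1) assms(1) unfolding preserving_def by (auto intro: measurable_compose)
  then show ?thesis using preserving_AE[OF assms(1) C(2)] by (auto simp: essentially_bounded_def)
qed

lemma weighted_composition_bound:
  assumes "preserving \<nu> \<tau>" "w \<in> borel_measurable \<nu>" "AE x in \<nu>. cmod (w x) \<le> C"
    and f: "f \<in> l2_functions \<nu>"
  shows "(\<lambda>p. w p * f (\<tau> p)) \<in> l2_functions \<nu>"
    and "(\<integral>p. (cmod (w p * f (\<tau> p)))\<^sup>2 \<partial>\<nu>) \<le> C\<^sup>2 * (\<integral>p. (cmod (f p))\<^sup>2 \<partial>\<nu>)"
proof -
  have m: "(\<lambda>p. w p * f (\<tau> p)) \<in> borel_measurable \<nu>"
    using assms(1,2) l2_measurable[OF f] unfolding preserving_def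
    by (auto intro!: borel_measurable_times intro: measurable_compose)
  have int: "integrable \<nu> (\<lambda>p. C\<^sup>2 * (cmod (f (\<tau> p)))\<^sup>2)"
    using preserving_integrable[OF assms(1) l2_integrable[OF f]] by simp
  have bound: "AE p in \<nu>. (cmod (w p * f (\<tau> p)))\<^sup>2 \<le> C\<^sup>2 * (cmod (f (\<tau> p)))\<^sup>2"
    using assms(3)
    by eventually_elim (simp add: norm_mult power_mult_distrib mult_right_mono power_mono)
  show l2: "(\<lambda>p. w p * f (\<tau> p)) \<in> l2_functions \<nu>"
    by (rule l2_boundI[OF m int bound])
  have "(\<integral>p. (cmod (w p * f (\<tau> p)))\<^sup>2 \<partial>\<nu>) \<le> (\<integral>p. C\<^sup>2 * (cmod (f (\<tau> p)))\<^sup>2 \<partial>\<nu>)"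
    by (rule integral_mono_AE[OF l2_integrable[OF l2] int bound])
  also have "\<dots> = C\<^sup>2 * (\<integral>p. (cmod (f p))\<^sup>2 \<partial>\<nu>)"
    using preserving_integral[OF assms(1), of "\<lambda>p. (cmod (f p))\<^sup>2"] l2_measurable[OF f] by simp
  finally show "(\<integral>p. (cmod (w p * f (\<tau> p)))\<^sup>2 \<partial>\<nu>) \<le> C\<^sup>2 * (\<integral>p. (cmod (f p))\<^sup>2 \<partial>\<nu>)" .
qed

lemma l2_weighted_composition:
  assumes "preserving \<nu> \<tau>" "w \<in> essentially_bounded \<nu>" "f \<in> l2_functions \<nu>"
  shows "(\<lambda>p. w p * f (\<tau> p)) \<in> l2_functions \<nu>"
proof -
  obtain C where "0 \<le> C" "w \<in> borel_measurable \<nu>" "AE x in \<nu>. cmod (w x) \<le> C"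
    using essentially_boundedE[OF assms(2)] by blast
  then show ?thesis using weighted_composition_bound(1)[OF assms(1) _ _ assms(3)] by blast
qed

lemma wcomp_apply:
  assumes "preserving \<nu> \<tau>" "f \<in> l2_functions \<nu>"
  shows "wcomp \<nu> w \<tau> (l2_class \<nu> f) = l2_class \<nu> (\<lambda>p. w p * f (\<tau> p))"
proof -
  have "AE p in \<nu>. w p * l2_rep (l2_class \<nu> f) (\<tau> p) = w p * f (\<tau> p)"
    using preserving_AE[OF assms(1) l2_rep_AE[OF assms(2)]] by eventually_elim simp
  then show ?thesis
    using assms(2) by (simp add: wcomp_def l2_op_def L2_class_in l2_class_cong)
qed

lemma wcomp_in_ops:
  assumes "preserving \<nu> \<tau>" "w \<in> essentially_bounded \<nu>"
  shows "wcomp \<nu> w \<tau> \<in> bounded_ops (L2 \<nu>)"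
proof -
  obtain C where C: "0 \<le> C" "w \<in> borel_measurable \<nu>" "AE x in \<nu>. cmod (w x) \<le> C"
    using essentially_boundedE[OF assms(2)] by blast
  note [simp] = wcomp_apply[OF assms(1)] l2_weighted_composition[OF assms] L2_class_in
    L2_vadd L2_vscale l2_add l2_scale L2_norm_sq
  show ?thesis
  proof (rule L2.opsI[where C = "C\<^sup>2"])
    show "wcomp \<nu> w \<tau> \<in> extensional (vecs (L2 \<nu>))" by (simp add: wcomp_def l2_op_def)
    show "Re (vinner (L2 \<nu>) (wcomp \<nu> w \<tau> F) (wcomp \<nu> w \<tau> F)) \<le> C\<^sup>2 * Re (vinner (L2 \<nu>) F F)"
      if "F \<in> vecs (L2 \<nu>)" for F
      using that weighted_composition_bound(2)[OF assms(1) C(2,3)] by (auto elim!: L2_vec_cases)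
    show "wcomp \<nu> w \<tau> (vscale (L2 \<nu>) c F) = vscale (L2 \<nu>) c (wcomp \<nu> w \<tau> F)"
      if "F \<in> vecs (L2 \<nu>)" for c F
      using that by (auto elim!: L2_vec_cases simp: algebra_simps)
  qed (auto elim!: L2_vec_cases simp: algebra_simps)
qed

lemma wcomp_adjoint:
  assumes \<tau>: "preserving \<nu> \<tau>" and \<sigma>: "preserving \<nu> \<sigma>" and w: "w \<in> essentially_bounded \<nu>"
    and inv: "\<And>p. p \<in> space \<nu> \<Longrightarrow> \<tau> (\<sigma> p) = p"
  shows "adjoint_op (L2 \<nu>) (wcomp \<nu> w \<tau>) = wcomp \<nu> (\<lambda>p. cnj (w (\<sigma> p))) \<sigma>"
proof -
  have w': "(\<lambda>p. cnj (w (\<sigma> p))) \<in> essentially_bounded \<nu>"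
    using essentially_bounded_cnj[OF essentially_bounded_preserving[OF \<sigma> w]] .
  show ?thesis
  proof (rule L2.adjoint_unique[OF wcomp_in_ops[OF \<tau> w] wcomp_in_ops[OF \<sigma> w']])
    fix F G assume "F \<in> vecs (L2 \<nu>)" "G \<in> vecs (L2 \<nu>)"
    then obtain f g where f: "f \<in> l2_functions \<nu>" "F = l2_class \<nu> f"
      and g: "g \<in> l2_functions \<nu>" "G = l2_class \<nu> g"
      by (auto elim!: L2_vec_cases)
    have m: "(\<lambda>p. w p * f (\<tau> p) * cnj (g p)) \<in> borel_measurable \<nu>"
      using l2_mult_integrable[OF l2_weighted_composition[OF \<tau> w f(1)] g(1)]
      by (rule borel_measurable_integrable)
    have "(\<integral>p. w p * f (\<tau> p) * cnj (g p) \<partial>\<nu>)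
        = (\<integral>p. w (\<sigma> p) * f (\<tau> (\<sigma> p)) * cnj (g (\<sigma> p)) \<partial>\<nu>)"
      using preserving_integral[OF \<sigma> m] by simp
    also have "\<dots> = (\<integral>p. f p * cnj (cnj (w (\<sigma> p)) * g (\<sigma> p)) \<partial>\<nu>)"
      using inv by (intro Bochner_Integration.integral_cong) auto
    finally show "vinner (L2 \<nu>) (wcomp \<nu> w \<tau> F) G = vinner (L2 \<nu>) F (wcomp \<nu> (\<lambda>p. cnj (w (\<sigma> p))) \<sigma> G)"
      using f g l2_weighted_composition[OF \<tau> w f(1)] l2_weighted_composition[OF \<sigma> w' g(1)]
      by (simp add: wcomp_apply \<tau> \<sigma> L2_inner)
  qed
qed

lemma wcomp_wcomp:
  assumes \<tau>: "preserving \<nu> \<tau>" and \<tau>': "preserving \<nu> \<tau>'" and w': "w' \<in> essentially_bounded \<nu>"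
    and f: "f \<in> l2_functions \<nu>"
  shows "wcomp \<nu> w \<tau> (wcomp \<nu> w' \<tau>' (l2_class \<nu> f))
    = l2_class \<nu> (\<lambda>p. w p * (w' (\<tau> p) * f (\<tau>' (\<tau> p))))"
  using f by (simp add: wcomp_apply \<tau> \<tau>' l2_weighted_composition w')

lemma wcomp_commute:
  assumes \<tau>: "preserving \<nu> \<tau>" and \<tau>': "preserving \<nu> \<tau>'"
    and w: "w \<in> essentially_bounded \<nu>" and w': "w' \<in> essentially_bounded \<nu>"
    and "AE p in \<nu>. w p * w' (\<tau> p) = w' p * w (\<tau>' p)"
    and "\<And>p. p \<in> space \<nu> \<Longrightarrow> \<tau>' (\<tau> p) = \<tau> (\<tau>' p)"
    and F: "F \<in> vecs (L2 \<nu>)"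
  shows "wcomp \<nu> w \<tau> (wcomp \<nu> w' \<tau>' F) = wcomp \<nu> w' \<tau>' (wcomp \<nu> w \<tau> F)"
proof -
  obtain f where f: "f \<in> l2_functions \<nu>" "F = l2_class \<nu> f" using L2_vec_cases[OF F] .
  have "AE p in \<nu>. w p * (w' (\<tau> p) * f (\<tau>' (\<tau> p))) = w' p * (w (\<tau>' p) * f (\<tau> (\<tau>' p)))"
    using assms(5) AE_space by eventually_elim (simp add: assms(6) flip: mult.assoc)
  then show ?thesis
    using f by (simp add: wcomp_wcomp \<tau> \<tau>' w w' l2_class_cong)
qed


section \<open>Products with counting measures and elementary tensors\<close>

lemma AE_fst:
  assumes "sigma_finite_measure \<kappa>" "AE x in \<nu>. P x"
  shows "AE p in \<nu> \<Otimes>\<^sub>M \<kappa>. P (fst p)"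
proof -
  interpret sigma_finite_measure \<kappa> by fact
  obtain N where N: "{x \<in> space \<nu>. \<not> P x} \<subseteq> N" "emeasure \<nu> N = 0" "N \<in> sets \<nu>"
    using assms(2) by (auto elim: AE_E)
  show ?thesis
  proof (rule AE_I)
    show "{p \<in> space (\<nu> \<Otimes>\<^sub>M \<kappa>). \<not> P (fst p)} \<subseteq> N \<times> space \<kappa>"
      using N(1) by (auto simp: space_pair_measure)
    show "emeasure (\<nu> \<Otimes>\<^sub>M \<kappa>) (N \<times> space \<kappa>) = 0"
      using N by (simp add: emeasure_pair_measure_Times)
    show "N \<times> space \<kappa> \<in> sets (\<nu> \<Otimes>\<^sub>M \<kappa>)" using N by simp
  qed
qed

lemma AE_snd:
  assumes "sigma_finite_measure \<kappa>" "AE x in \<kappa>. P x"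
  shows "AE p in \<nu> \<Otimes>\<^sub>M \<kappa>. P (snd p)"
proof -
  interpret sigma_finite_measure \<kappa> by fact
  obtain N where N: "{x \<in> space \<kappa>. \<not> P x} \<subseteq> N" "emeasure \<kappa> N = 0" "N \<in> sets \<kappa>"
    using assms(2) by (auto elim: AE_E)
  show ?thesis
  proof (rule AE_I)
    show "{p \<in> space (\<nu> \<Otimes>\<^sub>M \<kappa>). \<not> P (snd p)} \<subseteq> space \<nu> \<times> N"
      using N(1) by (auto simp: space_pair_measure)
    show "emeasure (\<nu> \<Otimes>\<^sub>M \<kappa>) (space \<nu> \<times> N) = 0"
      using N by (simp add: emeasure_pair_measure_Times)
    show "space \<nu> \<times> N \<in> sets (\<nu> \<Otimes>\<^sub>M \<kappa>)" using N by simp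
  qed
qed

lemma essentially_bounded_fst:
  assumes "sigma_finite_measure \<kappa>" "w \<in> essentially_bounded \<nu>"
  shows "(\<lambda>p. w (fst p)) \<in> essentially_bounded (\<nu> \<Otimes>\<^sub>M \<kappa>)"
proof -
  obtain C where "w \<in> borel_measurable \<nu>" "AE x in \<nu>. cmod (w x) \<le> C"
    using assms(2) by (auto simp: essentially_bounded_def)
  then show ?thesis
    using AE_fst[OF assms(1), of "\<lambda>x. cmod (w x) \<le> C" \<nu>]
    by (auto simp: essentially_bounded_def intro: measurable_compose[OF measurable_fst])
qed

lemma preserving_map_prod:
  assumes "preserving \<nu> \<tau>" "preserving \<kappa> \<tau>'" "sigma_finite_measure \<kappa>"
  shows "preserving (\<nu> \<Otimes>\<^sub>M \<kappa>) (map_prod \<tau> \<tau>')"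
proof -
  have m: "\<tau> \<in> measurable \<nu> \<nu>" "\<tau>' \<in> measurable \<kappa> \<kappa>" and d: "distr \<nu> \<nu> \<tau> = \<nu>" "distr \<kappa> \<kappa> \<tau>' = \<kappa>"
    using assms by (auto simp: preserving_def)
  have "map_prod \<tau> \<tau>' = (\<lambda>(x, y). (\<tau> x, \<tau>' y))" by auto
  moreover have "(\<lambda>(x, y). (\<tau> x, \<tau>' y)) \<in> measurable (\<nu> \<Otimes>\<^sub>M \<kappa>) (\<nu> \<Otimes>\<^sub>M \<kappa>)"
    using m by measurable
  moreover have "distr (\<nu> \<Otimes>\<^sub>M \<kappa>) (\<nu> \<Otimes>\<^sub>M \<kappa>) (\<lambda>(x, y). (\<tau> x, \<tau>' y)) = \<nu> \<Otimes>\<^sub>M \<kappa>"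
    using pair_measure_distr[OF m] assms(3) d by simp
  ultimately show ?thesis by (simp add: preserving_def)
qed

lemma preserving_bij_count_space: "bij_betw f I I \<Longrightarrow> preserving (count_space I) f"
  using distr_bij_count_space[of f I I] bij_betwE[of f I I]
  by (auto simp: preserving_def)

lemma l2_product:
  assumes \<kappa>: "sigma_finite_measure \<kappa>" and f: "f \<in> l2_functions \<nu>" and g: "g \<in> l2_functions \<kappa>"
  shows "(\<lambda>(x, y). f x * g y) \<in> l2_functions (\<nu> \<Otimes>\<^sub>M \<kappa>)"
proof (rule l2I_nn_integral)
  interpret sigma_finite_measure \<kappa> by fact
  have [measurable]: "f \<in> borel_measurable \<nu>" "g \<in> borel_measurable \<kappa>"
    using l2_measurable f g by auto
  show m: "(\<lambda>(x, y). f x * g y) \<in> borel_measurable (\<nu> \<Otimes>\<^sub>M \<kappa>)" by measurable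
  have "(\<integral>\<^sup>+p. ennreal ((cmod (case p of (x, y) \<Rightarrow> f x * g y))\<^sup>2) \<partial>(\<nu> \<Otimes>\<^sub>M \<kappa>))
      = (\<integral>\<^sup>+x. \<integral>\<^sup>+y. ennreal ((cmod (f x))\<^sup>2) * ennreal ((cmod (g y))\<^sup>2) \<partial>\<kappa> \<partial>\<nu>)"
    by (subst nn_integral_fst[symmetric]) (auto simp: norm_mult power_mult_distrib ennreal_mult)
  also have "\<dots> = (\<integral>\<^sup>+x. ennreal ((cmod (f x))\<^sup>2) \<partial>\<nu>) * (\<integral>\<^sup>+y. ennreal ((cmod (g y))\<^sup>2) \<partial>\<kappa>)"
    by (simp add: nn_integral_cmult nn_integral_multc)
  also have "\<dots> < \<infinity>"
    unfolding l2_nn_integral[OF f] l2_nn_integral[OF g] by (simp flip: ennreal_mult)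
  finally show "(\<integral>\<^sup>+p. ennreal ((cmod (case p of (x, y) \<Rightarrow> f x * g y))\<^sup>2) \<partial>(\<nu> \<Otimes>\<^sub>M \<kappa>)) < \<infinity>" .
qed

lemma l2_tensor_class:
  assumes \<kappa>: "sigma_finite_measure \<kappa>" and f: "f \<in> l2_functions \<nu>" and g: "g \<in> l2_functions \<kappa>"
  shows "l2_tensor \<nu> \<kappa> (l2_class \<nu> f) (l2_class \<kappa> g) = l2_class (\<nu> \<Otimes>\<^sub>M \<kappa>) (\<lambda>(x, y). f x * g y)"
  unfolding l2_tensor_def
proof (rule l2_class_cong)
  show "AE p in \<nu> \<Otimes>\<^sub>M \<kappa>. (case p of (x, y) \<Rightarrow> l2_rep (l2_class \<nu> f) x * l2_rep (l2_class \<kappa> g) y)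
      = (case p of (x, y) \<Rightarrow> f x * g y)"
    using AE_fst[OF \<kappa> l2_rep_AE[OF f]] AE_snd[OF \<kappa> l2_rep_AE[OF g], of \<nu>]
    by eventually_elim (auto simp: split_beta)
qed

lemma l2_tensor_in:
  assumes "sigma_finite_measure \<kappa>" "F \<in> vecs (L2 \<nu>)" "G \<in> vecs (L2 \<kappa>)"
  shows "l2_tensor \<nu> \<kappa> F G \<in> vecs (L2 (\<nu> \<Otimes>\<^sub>M \<kappa>))"
  using assms by (auto elim!: L2_vec_cases simp: l2_tensor_class L2_class_in l2_product)

lemma wcomp_tensor:
  assumes \<kappa>: "sigma_finite_measure \<kappa>" and \<tau>: "preserving \<nu> \<tau>" and \<tau>': "preserving \<kappa> \<tau>'"
    and w: "w \<in> essentially_bounded \<nu>"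
    and F: "F \<in> vecs (L2 \<nu>)" and G: "G \<in> vecs (L2 \<kappa>)"
  shows "wcomp (\<nu> \<Otimes>\<^sub>M \<kappa>) (\<lambda>p. w (fst p)) (map_prod \<tau> \<tau>') (l2_tensor \<nu> \<kappa> F G)
    = l2_tensor \<nu> \<kappa> (wcomp \<nu> w \<tau> F) (wcomp \<kappa> (\<lambda>_. 1) \<tau>' G)"
proof -
  obtain f where f: "f \<in> l2_functions \<nu>" "F = l2_class \<nu> f" using L2_vec_cases[OF F] .
  obtain g where g: "g \<in> l2_functions \<kappa>" "G = l2_class \<kappa> g" using L2_vec_cases[OF G] .
  have g': "(\<lambda>y. 1 * g (\<tau>' y)) \<in> l2_functions \<kappa>"
    by (rule l2_weighted_composition[OF \<tau>' essentially_bounded_const g(1)])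
  show ?thesis
    unfolding f(2) g(2) l2_tensor_class[OF \<kappa> f(1) g(1)] wcomp_apply[OF \<tau> f(1)] wcomp_apply[OF \<tau>' g(1)]
      wcomp_apply[OF preserving_map_prod[OF \<tau> \<tau>' \<kappa>] l2_product[OF \<kappa> f(1) g(1)]]
      l2_tensor_class[OF \<kappa> l2_weighted_composition[OF \<tau> w f(1)] g']
    by (intro arg_cong[where f = "l2_class _"]) (auto simp: fun_eq_iff)
qed

lemma l2_point: "i \<in> I \<Longrightarrow> (indicator {i} :: 'b \<Rightarrow> complex) \<in> l2_functions (count_space I)"
proof -
  assume i: "i \<in> I"
  have "(\<integral>\<^sup>+y. ennreal ((cmod (indicator {i} y))\<^sup>2) \<partial>count_space I) = (\<integral>\<^sup>+y. indicator {i} y \<partial>count_space I)"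
    by (intro nn_integral_cong) (auto simp: indicator_def)
  also have "\<dots> < \<infinity>" using i by simp
  finally show ?thesis by (intro l2I_nn_integral) auto
qed

context
  fixes \<nu> :: "'a measure" and I :: "'b set"
  assumes I: "countable I"
begin

abbreviation (input) "\<kappa> \<equiv> count_space I"

lemma count_sigma_finite: "sigma_finite_measure \<kappa>"
  using I by (rule sigma_finite_measure_count_space_countable)

lemma AE_slices:
  assumes "\<And>i. i \<in> I \<Longrightarrow> AE p in \<nu> \<Otimes>\<^sub>M \<kappa>. snd p = i \<longrightarrow> P p"
  shows "AE p in \<nu> \<Otimes>\<^sub>M \<kappa>. P p"
proof -
  have "AE p in \<nu> \<Otimes>\<^sub>M \<kappa>. \<forall>i\<in>I. snd p = i \<longrightarrow> P p"
    unfolding AE_ball_countable[OF I] using assms by blast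
  with AE_space show ?thesis by eventually_elim (auto simp: space_pair_measure)
qed

lemma nn_integral_slice:
  assumes [measurable]: "f \<in> borel_measurable (\<nu> \<Otimes>\<^sub>M \<kappa>)" and i: "i \<in> I"
  shows "(\<integral>\<^sup>+p. f p * indicator {i} (snd p) \<partial>(\<nu> \<Otimes>\<^sub>M \<kappa>)) = (\<integral>\<^sup>+x. f (x, i) \<partial>\<nu>)"
proof -
  interpret sigma_finite_measure \<kappa> by (rule count_sigma_finite)
  have "(\<lambda>p. f p * indicator {i} (snd p)) \<in> borel_measurable (\<nu> \<Otimes>\<^sub>M \<kappa>)"
    by (intro borel_measurable_times_ennreal assms(1) measurable_compose[OF measurable_snd]) simp
  then have "(\<integral>\<^sup>+p. f p * indicator {i} (snd p) \<partial>(\<nu> \<Otimes>\<^sub>M \<kappa>))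
      = (\<integral>\<^sup>+x. \<integral>\<^sup>+y. f (x, y) * indicator {i} y \<partial>\<kappa> \<partial>\<nu>)"
    by (subst nn_integral_fst[symmetric]) auto
  also have "\<dots> = (\<integral>\<^sup>+x. f (x, i) \<partial>\<nu>)"
  proof (rule nn_integral_cong)
    fix x
    have "(\<integral>\<^sup>+y. f (x, y) * indicator {i} y \<partial>\<kappa>) = f (x, i) * emeasure \<kappa> {i}"
      using i by (subst nn_integral_indicator_singleton) auto
    then show "(\<integral>\<^sup>+y. f (x, y) * indicator {i} y \<partial>\<kappa>) = f (x, i)" using i by simp
  qed
  finally show ?thesis .
qed

lemma l2_section:
  assumes "f \<in> l2_functions (\<nu> \<Otimes>\<^sub>M \<kappa>)" "i \<in> I"
  shows "(\<lambda>x. f (x, i)) \<in> l2_functions \<nu>"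
proof (rule l2I_nn_integral)
  have m: "f \<in> borel_measurable (\<nu> \<Otimes>\<^sub>M \<kappa>)" using l2_measurable assms by blast
  then have m': "(\<lambda>p. ennreal ((cmod (f p))\<^sup>2)) \<in> borel_measurable (\<nu> \<Otimes>\<^sub>M \<kappa>)" by measurable
  show "(\<lambda>x. f (x, i)) \<in> borel_measurable \<nu>"
    using m assms(2) by (intro measurable_compose[OF _ m]) simp
  have "(\<integral>\<^sup>+x. ennreal ((cmod (f (x, i)))\<^sup>2) \<partial>\<nu>)
      = (\<integral>\<^sup>+p. ennreal ((cmod (f p))\<^sup>2) * indicator {i} (snd p) \<partial>(\<nu> \<Otimes>\<^sub>M \<kappa>))"
    using nn_integral_slice[OF m' assms(2)] by simp
  also have "\<dots> \<le> (\<integral>\<^sup>+p. ennreal ((cmod (f p))\<^sup>2) \<partial>(\<nu> \<Otimes>\<^sub>M \<kappa>))"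
    by (intro nn_integral_mono) (auto simp: indicator_def)
  also have "\<dots> < \<infinity>" unfolding l2_nn_integral[OF assms(1)] by simp
  finally show "(\<integral>\<^sup>+x. ennreal ((cmod (f (x, i)))\<^sup>2) \<partial>\<nu>) < \<infinity>" .
qed


text \<open>A function orthogonal to all elementary tensors is in particular orthogonal to its own slices,
  which are elementary tensors.\<close>

lemma elementary_tensors_total:
  assumes F: "F \<in> vecs (L2 (\<nu> \<Otimes>\<^sub>M \<kappa>))"
    and orth: "\<And>G K. \<lbrakk>G \<in> vecs (L2 \<nu>); K \<in> vecs (L2 \<kappa>)\<rbrakk> \<Longrightarrow>
      vinner (L2 (\<nu> \<Otimes>\<^sub>M \<kappa>)) (l2_tensor \<nu> \<kappa> G K) F = 0"
  shows "F = vzero (L2 (\<nu> \<Otimes>\<^sub>M \<kappa>))"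
proof -
  obtain f where f: "f \<in> l2_functions (\<nu> \<Otimes>\<^sub>M \<kappa>)" "F = l2_class (\<nu> \<Otimes>\<^sub>M \<kappa>) f"
    using L2_vec_cases[OF F] .
  have "AE p in \<nu> \<Otimes>\<^sub>M \<kappa>. f p = 0"
  proof (rule AE_slices)
    fix i assume i: "i \<in> I"
    define s where "s = (\<lambda>(x, y). f (x, i) * indicator {i} y)"
    note g = l2_section[OF f(1) i] and k = l2_point[OF i]
    have s: "s \<in> l2_functions (\<nu> \<Otimes>\<^sub>M \<kappa>)"
      using l2_product[OF count_sigma_finite g k] by (simp add: s_def)
    have ss: "s p * cnj (f p) = s p * cnj (s p)" for p
      by (auto simp: s_def indicator_def split: prod.splits)
    have "vinner (L2 (\<nu> \<Otimes>\<^sub>M \<kappa>)) (l2_class (\<nu> \<Otimes>\<^sub>M \<kappa>) s) F = 0"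
      using orth[OF L2_class_in[OF g] L2_class_in[OF k]]
      by (simp add: l2_tensor_class[OF count_sigma_finite g k] s_def)
    then have "vinner (L2 (\<nu> \<Otimes>\<^sub>M \<kappa>)) (l2_class (\<nu> \<Otimes>\<^sub>M \<kappa>) s) (l2_class (\<nu> \<Otimes>\<^sub>M \<kappa>) s) = 0"
      using f s by (simp add: L2_inner ss)
    then have "(\<integral>p. (cmod (s p))\<^sup>2 \<partial>(\<nu> \<Otimes>\<^sub>M \<kappa>)) = 0" using L2_norm_sq[OF s] by simp
    then have "AE p in \<nu> \<Otimes>\<^sub>M \<kappa>. (cmod (s p))\<^sup>2 = 0"
      using integral_nonneg_eq_0_iff_AE[OF l2_integrable[OF s]] by simp
    then show "AE p in \<nu> \<Otimes>\<^sub>M \<kappa>. snd p = i \<longrightarrow> f p = 0"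
      by eventually_elim (auto simp: s_def)
  qed
  then show ?thesis unfolding f(2) L2_vzero by (rule l2_class_cong)
qed

lemma ops_eq_on_tensors:
  assumes S: "S \<in> bounded_ops (L2 (\<nu> \<Otimes>\<^sub>M \<kappa>))" and T: "T \<in> bounded_ops (L2 (\<nu> \<Otimes>\<^sub>M \<kappa>))"
    and eq: "\<And>F G. \<lbrakk>F \<in> vecs (L2 \<nu>); G \<in> vecs (L2 \<kappa>)\<rbrakk> \<Longrightarrow>
      S (l2_tensor \<nu> \<kappa> F G) = T (l2_tensor \<nu> \<kappa> F G)"
  shows "S = T"
proof (rule L2.op_inner_ext[OF S T])
  fix x y assume xy: "x \<in> vecs (L2 (\<nu> \<Otimes>\<^sub>M \<kappa>))" "y \<in> vecs (L2 (\<nu> \<Otimes>\<^sub>M \<kappa>))"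
  let ?S = "adjoint_op (L2 (\<nu> \<Otimes>\<^sub>M \<kappa>)) S" and ?T = "adjoint_op (L2 (\<nu> \<Otimes>\<^sub>M \<kappa>)) T"
  have v: "?S y \<in> vecs (L2 (\<nu> \<Otimes>\<^sub>M \<kappa>))" "?T y \<in> vecs (L2 (\<nu> \<Otimes>\<^sub>M \<kappa>))"
    using L2.op_closed[OF L2.adjoint_in_ops] S T xy(2) by auto
  have "L2.vsub (\<nu> \<Otimes>\<^sub>M \<kappa>) (?S y) (?T y) = vzero (L2 (\<nu> \<Otimes>\<^sub>M \<kappa>))"
  proof (rule elementary_tensors_total)
    fix G K assume GK: "G \<in> vecs (L2 \<nu>)" "K \<in> vecs (L2 \<kappa>)"
    note t = l2_tensor_in[OF count_sigma_finite GK]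
    show "vinner (L2 (\<nu> \<Otimes>\<^sub>M \<kappa>)) (l2_tensor \<nu> \<kappa> G K) (L2.vsub (\<nu> \<Otimes>\<^sub>M \<kappa>) (?S y) (?T y)) = 0"
      unfolding L2.inner_sub_right[OF v t]
      using L2.adjoint_inner[OF S t xy(2)] L2.adjoint_inner[OF T t xy(2)] eq[OF GK] by simp
  qed (use v L2.vsub_closed in blast)
  then have "vinner (L2 (\<nu> \<Otimes>\<^sub>M \<kappa>)) x (?S y) = vinner (L2 (\<nu> \<Otimes>\<^sub>M \<kappa>)) x (?T y)"
    using L2.inner_sub_right[OF v xy(1)] L2.inner_zero_right[OF xy(1)] by simp
  then show "vinner (L2 (\<nu> \<Otimes>\<^sub>M \<kappa>)) (S x) y = vinner (L2 (\<nu> \<Otimes>\<^sub>M \<kappa>)) (T x) y"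
    using L2.adjoint_inner[OF S xy] L2.adjoint_inner[OF T xy] by simp
qed

text \<open>The easy half of the commutation theorem for tensor products.\<close>

lemma tensor_commutes:
  assumes A: "A \<subseteq> bounded_ops (L2 \<nu>)" and B: "B \<subseteq> bounded_ops (L2 \<kappa>)"
    and W: "W \<in> bounded_ops (L2 (\<nu> \<Otimes>\<^sub>M \<kappa>))" "S \<in> A" "T \<in> B"
      "\<And>F G. \<lbrakk>F \<in> vecs (L2 \<nu>); G \<in> vecs (L2 \<kappa>)\<rbrakk> \<Longrightarrow>
        W (l2_tensor \<nu> \<kappa> F G) = l2_tensor \<nu> \<kappa> (S F) (T G)"
    and P: "P \<in> bounded_ops (L2 (\<nu> \<Otimes>\<^sub>M \<kappa>))" "c \<in> commutant (L2 \<nu>) A" "d \<in> commutant (L2 \<kappa>) B"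
      "\<And>F G. \<lbrakk>F \<in> vecs (L2 \<nu>); G \<in> vecs (L2 \<kappa>)\<rbrakk> \<Longrightarrow>
        P (l2_tensor \<nu> \<kappa> F G) = l2_tensor \<nu> \<kappa> (c F) (d G)"
    and x: "x \<in> vecs (L2 (\<nu> \<Otimes>\<^sub>M \<kappa>))"
  shows "P (W x) = W (P x)"
proof -
  have cd: "c \<in> bounded_ops (L2 \<nu>)" "d \<in> bounded_ops (L2 \<kappa>)"
    using P(2,3) by (auto simp: commutant_def)
  have ST: "S \<in> bounded_ops (L2 \<nu>)" "T \<in> bounded_ops (L2 \<kappa>)" using W A B by auto
  have "op_mult (L2 (\<nu> \<Otimes>\<^sub>M \<kappa>)) P W = op_mult (L2 (\<nu> \<Otimes>\<^sub>M \<kappa>)) W P"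
  proof (rule ops_eq_on_tensors)
    fix F G assume FG: "F \<in> vecs (L2 \<nu>)" "G \<in> vecs (L2 \<kappa>)"
    note in_vecs = FG L2.op_closed[OF ST(1) FG(1)] L2.op_closed[OF ST(2) FG(2)]
      L2.op_closed[OF cd(1) FG(1)] L2.op_closed[OF cd(2) FG(2)]
    show "op_mult (L2 (\<nu> \<Otimes>\<^sub>M \<kappa>)) P W (l2_tensor \<nu> \<kappa> F G)
        = op_mult (L2 (\<nu> \<Otimes>\<^sub>M \<kappa>)) W P (l2_tensor \<nu> \<kappa> F G)"
      using L2.commutantD[OF P(2) W(2) FG(1)] L2.commutantD[OF P(3) W(3) FG(2)] in_vecs
      by (simp add: L2.op_mult_apply l2_tensor_in[OF count_sigma_finite] W(4) P(4))
  qed (intro L2.op_mult_in_ops W P)+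
  then show ?thesis
    using L2.op_mult_apply[OF x, of P W] L2.op_mult_apply[OF x, of W P] by simp
qed

end

section \<open>The group of finitely supported permutations\<close>

lemma finitary_carrier:
  "p \<in> carrier finitary_sym_group \<longleftrightarrow> bij p \<and> finite {n. p n \<noteq> n}"
  by (simp add: finitary_sym_group_def)

lemma finitary_mult: "p \<otimes>\<^bsub>finitary_sym_group\<^esub> q = p \<circ> q" and finitary_one: "\<one>\<^bsub>finitary_sym_group\<^esub> = id"
  by (simp_all add: finitary_sym_group_def)

lemma group_finitary: "group finitary_sym_group"
proof (rule groupI)
  fix p q assume p: "p \<in> carrier finitary_sym_group" and q: "q \<in> carrier finitary_sym_group"
  have "{n. (p \<circ> q) n \<noteq> n} \<subseteq> {n. p n \<noteq> n} \<union> {n. q n \<noteq> n}" by auto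
  then show "p \<otimes>\<^bsub>finitary_sym_group\<^esub> q \<in> carrier finitary_sym_group"
    using p q by (auto simp: finitary_carrier finitary_mult intro: bij_comp finite_subset)
next
  fix p assume p: "p \<in> carrier finitary_sym_group"
  have b: "bij p" using p by (simp add: finitary_carrier)
  let ?q = "inv_into UNIV p"
  have "?q n = n \<longleftrightarrow> p n = n" for n
    using bij_inv_eq_iff[OF b, of n n] by auto
  then have "?q \<in> carrier finitary_sym_group"
    using p by (simp add: finitary_carrier bij_imp_bij_inv)
  moreover have "?q \<circ> p = id" using b by (simp add: bij_is_inj)
  ultimately show "\<exists>q\<in>carrier finitary_sym_group. q \<otimes>\<^bsub>finitary_sym_group\<^esub> p = \<one>\<^bsub>finitary_sym_group\<^esub>"
    by (auto simp: finitary_mult finitary_one)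
qed (auto simp: finitary_carrier finitary_mult finitary_one o_assoc)

text \<open>A finitely supported permutation is determined by its values up to a bound for its support, that is, by a
  finite list.\<close>

lemma countable_finitary: "countable (carrier finitary_sym_group)"
proof -
  define N where "N p = (SOME N. \<forall>n\<ge>N. p n = n)" for p :: "nat \<Rightarrow> nat"
  have N: "p n = n" if "p \<in> carrier finitary_sym_group" "N p \<le> n" for p n
  proof -
    have "finite {n. p n \<noteq> n}" using that(1) by (simp add: finitary_carrier)
    then obtain m where m: "\<forall>n\<in>{n. p n \<noteq> n}. n < m" using finite_nat_set_iff_bounded by blast
    have "p n = n" if "m \<le> n" for n
      using m that by (cases "p n = n") auto
    then have "\<exists>N. \<forall>n\<ge>N. p n = n" by blast
    then have "\<forall>n\<ge>N p. p n = n" unfolding N_def by (rule someI_ex)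
    then show ?thesis using that(2) by blast
  qed
  have "inj_on (\<lambda>p. map p [0..<N p]) (carrier finitary_sym_group)"
  proof (rule inj_onI, rule ext)
    fix p q n assume p: "p \<in> carrier finitary_sym_group" and q: "q \<in> carrier finitary_sym_group"
      and eq: "map p [0..<N p] = map q [0..<N q]"
    then have "N p = N q" by (metis length_map length_upt minus_nat.diff_0)
    with eq show "p n = q n"
      using N[OF p, of n] N[OF q, of n] by (cases "n < N p") auto
  qed
  then show ?thesis by (rule countableI')
qed

lemma transpose_in_finitary: "Transposition.transpose a b \<in> carrier finitary_sym_group"
proof -
  have "{n. Transposition.transpose a b n \<noteq> n} \<subseteq> {a, b}" by (auto simp: Transposition.transpose_def)
  then show ?thesis by (auto simp: finitary_carrier intro: finite_subset)
qed

abbreviation "adjacent n \<equiv> Transposition.transpose n (Suc n)"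

text \<open>A permutation that fixes both \<open>n\<close> and \<open>n + 1\<close> commutes with their transposition.\<close>

lemma finitary_eventually_commutes:
  assumes "t \<in> carrier finitary_sym_group"
  shows "\<forall>\<^sub>F n in sequentially. t \<circ> adjacent n = adjacent n \<circ> t"
proof -
  obtain m where bound: "\<forall>n\<in>{n. t n \<noteq> n}. n < m"
    using assms finite_nat_set_iff_bounded unfolding finitary_carrier by blast
  have m: "t n = n" if "m \<le> n" for n
    using bound that by (cases "t n = n") auto
  have inj: "inj t" using assms by (simp add: finitary_carrier bij_is_inj)
  have "t \<circ> adjacent n = adjacent n \<circ> t" if "m \<le> n" for n
  proof
    fix k
    have t: "t n = n" "t (Suc n) = Suc n" using m that by auto
    show "(t \<circ> adjacent n) k = (adjacent n \<circ> t) k"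
    proof (cases "k = n \<or> k = Suc n")
      case False
      then have "t k \<noteq> n" "t k \<noteq> Suc n" using t inj_eq[OF inj, of k n] inj_eq[OF inj, of k "Suc n"] by auto
      then show ?thesis using False by simp
    qed (use t in auto)
  qed
  then show ?thesis unfolding eventually_sequentially by blast
qed

lemma adjacent_not_commute: "adjacent n \<circ> adjacent (Suc n) \<noteq> adjacent (Suc n) \<circ> adjacent n"
proof
  assume "adjacent n \<circ> adjacent (Suc n) = adjacent (Suc n) \<circ> adjacent n"
  then have "(adjacent n \<circ> adjacent (Suc n)) n = (adjacent (Suc n) \<circ> adjacent n) n"
    by (rule fun_cong)
  then show False by (simp add: Transposition.transpose_def)
qed

lemma group_bij_mult:
  assumes "group G" "g \<in> carrier G"
  shows "bij_betw (\<lambda>h. g \<otimes>\<^bsub>G\<^esub> h) (carrier G) (carrier G)"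
    and "bij_betw (\<lambda>h. h \<otimes>\<^bsub>G\<^esub> g) (carrier G) (carrier G)"
proof -
  interpret group G by fact
  show "bij_betw (\<lambda>h. g \<otimes>\<^bsub>G\<^esub> h) (carrier G) (carrier G)"
    by (rule bij_betw_byWitness[where f' = "\<lambda>h. inv\<^bsub>G\<^esub> g \<otimes>\<^bsub>G\<^esub> h"])
      (use assms(2) in \<open>auto simp flip: m_assoc\<close>)
  show "bij_betw (\<lambda>h. h \<otimes>\<^bsub>G\<^esub> g) (carrier G) (carrier G)"
    by (rule bij_betw_byWitness[where f' = "\<lambda>h. h \<otimes>\<^bsub>G\<^esub> inv\<^bsub>G\<^esub> g"])
      (use assms(2) in \<open>auto simp: m_assoc\<close>)
qed


section \<open>Separating vectors and slices\<close>

text \<open>If \<open>z \<xi> = 0\<close>, then \<open>z\<close> vanishes on all \<open>c \<xi>\<close> with \<open>c\<close> in the commutant, so that \<open>z\<^sup>* y\<close> is orthogonal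
  to all of them.\<close>

lemma (in hilbert_space) separatingI:
  assumes A: "von_neumann_algebra H A" and D: "D \<subseteq> commutant H A" and \<xi>: "\<xi> \<in> V"
    and total: "\<And>y. \<lbrakk>y \<in> V; \<And>c. c \<in> D \<Longrightarrow> ip (c \<xi>) y = 0\<rbrakk> \<Longrightarrow> y = vzero H"
    and z: "z \<in> A" "z \<xi> = vzero H"
  shows "z = op_zero H"
proof (rule op_inner_ext[OF vn_ops[OF A z(1)] op_zero_in_ops])
  fix x y assume x: "x \<in> V" and y: "y \<in> V"
  have zo: "z \<in> ops" using vn_ops[OF A z(1)] .
  have "adjoint_op H z y = vzero H"
  proof (rule total)
    fix c assume c: "c \<in> D"
    then have c': "c \<in> commutant H A" "c \<in> ops" using D commutant_subset_ops by auto
    have "ip (c \<xi>) (adjoint_op H z y) = ip (z (c \<xi>)) y"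
      using adjoint_inner[OF zo op_closed[OF c'(2) \<xi>] y] by simp
    also have "z (c \<xi>) = c (z \<xi>)" using commutantD[OF c'(1) z(1) \<xi>] by simp
    also have "\<dots> = vzero H" by (simp add: z op_zero_vec[OF c'(2)])
    finally show "ip (c \<xi>) (adjoint_op H z y) = 0" using y by (simp add: inner_zero_left)
  qed (use y op_closed[OF adjoint_in_ops[OF zo]] in auto)
  then show "ip (z x) y = ip (op_zero H x) y"
    using adjoint_inner[OF zo x y] x y by (simp add: inner_zero_right op_zero_apply inner_zero_left)
qed

text \<open>A bounded multiple of \<open>z\<close> that is nonzero when \<open>z\<close> is.\<close>

definition squash :: "complex \<Rightarrow> complex" where
  "squash z = z / of_real (1 + (cmod z)\<^sup>2)"

lemma cmod_squash: "cmod (squash z) \<le> 1"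
proof -
  have "2 * cmod z \<le> 1 + (cmod z)\<^sup>2" using sum_squares_bound[of "cmod z" 1] by simp
  moreover have "0 \<le> cmod z" by simp
  ultimately have "cmod z \<le> 1 + (cmod z)\<^sup>2" by linarith
  moreover have "cmod (of_real (1 + (cmod z)\<^sup>2)) = 1 + (cmod z)\<^sup>2"
    unfolding norm_of_real by simp
  moreover have "0 < 1 + (cmod z)\<^sup>2" by (simp add: add_pos_nonneg)
  ultimately show ?thesis unfolding squash_def norm_divide by (simp add: divide_le_eq)
qed

lemma squash_measurable: "squash \<in> borel_measurable borel"
  unfolding squash_def by measurable

lemma squash_bounded: 
  assumes "f \<in> borel_measurable \<mu>" shows "(\<lambda>x. squash (f x)) \<in> essentially_bounded \<mu>"
  using measurable_compose[OF assms squash_measurable] cmod_squash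
  by (auto simp: essentially_bounded_def)

text \<open>The inner product of \<open>s\<close> with \<open>f\<close> is the integral of \<open>|f|\<^sup>2 / (1 + |f|\<^sup>2)\<close> over the set \<open>P\<close>. Unlike \<open>f\<close>,
  the function \<open>s\<close> is bounded, so that a bounded right multiplication can produce it from the trace vector.\<close>

lemma orthogonal_to_squashed_slice:
  assumes f: "f \<in> l2_functions \<nu>"
    and s: "s \<in> l2_functions \<nu>" "\<And>p. p \<in> space \<nu> \<Longrightarrow> s p = (if P p then squash (f p) else 0)"
    and orth: "vinner (L2 \<nu>) (l2_class \<nu> s) (l2_class \<nu> f) = 0"
  shows "AE p in \<nu>. P p \<longrightarrow> f p = 0"
proof -
  define k where "k p = Re (s p * cnj (f p))" for p
  have k: "k p = (if P p then (cmod (f p))\<^sup>2 / (1 + (cmod (f p))\<^sup>2) else 0)" if "p \<in> space \<nu>" for p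
  proof (cases "P p")
    case True
    have "s p * cnj (f p) = (f p * cnj (f p)) / of_real (1 + (cmod (f p))\<^sup>2)"
      using s(2)[OF that] True by (simp add: squash_def)
    also have "\<dots> = of_real ((cmod (f p))\<^sup>2 / (1 + (cmod (f p))\<^sup>2))"
      by (simp only: complex_norm_square[symmetric] of_real_divide)
    finally show ?thesis using True by (simp only: k_def Re_complex_of_real if_True)
  qed (use s(2)[OF that] in \<open>simp add: k_def\<close>)
  have int: "integrable \<nu> (\<lambda>p. s p * cnj (f p))" by (rule l2_mult_integrable[OF s(1) f])
  have "(\<integral>p. k p \<partial>\<nu>) = Re (\<integral>p. s p * cnj (f p) \<partial>\<nu>)"
    unfolding k_def by (rule integral_Re[OF int])
  also have "\<dots> = 0" using orth by (simp add: L2_inner s(1) f)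
  finally have int0: "(\<integral>p. k p \<partial>\<nu>) = 0" .
  have "integrable \<nu> k" unfolding k_def using int by (rule integrable_Re)
  moreover have "AE p in \<nu>. 0 \<le> k p" using k by (intro AE_I2) auto
  ultimately have "AE p in \<nu>. k p = 0" using int0 integral_nonneg_eq_0_iff_AE by blast
  then show ?thesis using AE_space
  proof eventually_elim
    case (elim p)
    have "0 < 1 + (cmod (f p))\<^sup>2" by (simp add: add_pos_nonneg)
    then show ?case using elim k[OF elim(2)] by (auto simp: divide_eq_0_iff)
  qed
qed


section \<open>The crossed product and its commutant\<close>

locale crossed = group G for G (structure) +
  fixes \<mu> :: "'x measure" and \<phi>
  assumes countable: "countable (carrier G)" and pmp: "pmp_action G \<mu> \<phi>"
begin

abbreviation "\<gamma> \<equiv> count_space (carrier G)"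
abbreviation "\<nu> \<equiv> crossed_space G \<mu>"
abbreviation "M \<equiv> crossed_product G \<mu> \<phi>"

sublocale prob_space \<mu>
  using pmp by (simp add: pmp_action_def standard_prob_space_def)

sublocale action: group_action G "space \<mu>" \<phi>
  using pmp by (simp add: pmp_action_def)

lemma \<gamma>: "sigma_finite_measure \<gamma>"
  using countable by (rule sigma_finite_measure_count_space_countable)


lemma space_\<nu>: "space \<nu> = space \<mu> \<times> carrier G"
  by (simp add: space_pair_measure)

lemma \<phi>_preserving: "g \<in> carrier G \<Longrightarrow> preserving \<mu> (\<phi> g)"
  using pmp by (auto simp: pmp_action_def preserving_def)

lemma \<phi>_in: "\<lbrakk>g \<in> carrier G; x \<in> space \<mu>\<rbrakk> \<Longrightarrow> \<phi> g x \<in> space \<mu>"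
  using action.element_image by blast

lemma \<phi>_one: "x \<in> space \<mu> \<Longrightarrow> \<phi> \<one> x = x"
  using action.id_eq_one by (metis restrict_apply')

lemma \<phi>_mult: "\<lbrakk>g \<in> carrier G; h \<in> carrier G; x \<in> space \<mu>\<rbrakk> \<Longrightarrow> \<phi> g (\<phi> h x) = \<phi> (g \<otimes> h) x"
  using action.composition_rule by simp

text \<open>\<open>U g\<close> and \<open>mul a\<close> are the generators \<open>u\<^sub>g\<close> and \<open>a \<otimes> 1\<close>. The operator \<open>rmult a g\<close> multiplies from the right: a
  vector \<open>\<Sum> b\<^sub>h \<otimes> \<delta>\<^sub>h\<close> stands for \<open>\<Sum> b\<^sub>h u\<^sub>h\<close>, and \<open>b u\<^sub>h a = b a(h\<^sup>-\<^sup>1 \<cdot>) u\<^sub>h\<close> accounts for the weight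
  and \<open>u\<^sub>h u\<^sub>g\<^sup>*\<close> for the translation.\<close>

definition U where "U g = wcomp \<nu> (\<lambda>_. 1) (map_prod (\<phi> (inv g)) (\<lambda>h. inv g \<otimes> h))"
definition mul where "mul a = wcomp \<nu> (\<lambda>p. a (fst p)) (\<lambda>p. p)"
definition weight where "weight a = (\<lambda>(x, h). a (\<phi> (inv h) x))"
abbreviation right where "right g \<equiv> map_prod (\<lambda>x. x) (\<lambda>h. h \<otimes> g)"
definition rmult where "rmult a g = wcomp \<nu> (weight a) (right g)"

lemma U_preserving: "g \<in> carrier G \<Longrightarrow> preserving \<nu> (map_prod (\<phi> (inv g)) (\<lambda>h. inv g \<otimes> h))"
  by (intro preserving_map_prod \<phi>_preserving preserving_bij_count_space \<gamma> group_bij_mult)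
    (auto intro: is_group)

lemma right_preserving: "g \<in> carrier G \<Longrightarrow> preserving \<nu> (right g)"
  by (intro preserving_map_prod preserving_id preserving_bij_count_space \<gamma> group_bij_mult)
    (auto intro: is_group)

lemma weight_bounded:
  assumes a: "a \<in> essentially_bounded \<mu>"
  shows "weight a \<in> essentially_bounded \<nu>"
proof -
  obtain K where K: "0 \<le> K" "a \<in> borel_measurable \<mu>" "AE x in \<mu>. cmod (a x) \<le> K"
    using essentially_boundedE[OF a] by blast
  have "weight a = (\<lambda>p. a (\<phi> (inv (snd p)) (fst p)))" by (auto simp: weight_def)
  moreover have "(\<lambda>p. a (\<phi> (inv (snd p)) (fst p))) \<in> borel_measurable \<nu>"
  proof (rule measurable_compose_countable'[where I = "carrier G" and g = snd, OF _ _ countable])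
    fix h assume "h \<in> carrier G"
    then have "\<phi> (inv h) \<in> measurable \<mu> \<mu>" using \<phi>_preserving by (auto simp: preserving_def)
    then show "(\<lambda>p. a (\<phi> (inv h) (fst p))) \<in> borel_measurable \<nu>"
      using K(2) by (auto intro: measurable_compose)
  qed simp
  moreover have "AE p in \<nu>. cmod (a (\<phi> (inv (snd p)) (fst p))) \<le> K"
  proof (rule AE_slices[OF countable])
    fix h assume h: "h \<in> carrier G"
    have "AE x in \<mu>. cmod (a (\<phi> (inv h) x)) \<le> K"
      using h by (intro preserving_AE[OF \<phi>_preserving K(3)]) simp
    from AE_fst[OF \<gamma> this]
    show "AE p in \<nu>. snd p = h \<longrightarrow> cmod (a (\<phi> (inv (snd p)) (fst p))) \<le> K"
      by eventually_elim auto
  qed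
  ultimately show ?thesis by (auto simp: essentially_bounded_def)
qed

lemma ops:
  shows U_ops: "g \<in> carrier G \<Longrightarrow> U g \<in> bounded_ops (L2 \<nu>)"
    and mul_ops: "a \<in> essentially_bounded \<mu> \<Longrightarrow> mul a \<in> bounded_ops (L2 \<nu>)"
    and rmult_ops: "\<lbrakk>a \<in> essentially_bounded \<mu>; g \<in> carrier G\<rbrakk> \<Longrightarrow> rmult a g \<in> bounded_ops (L2 \<nu>)"
  unfolding U_def mul_def rmult_def
  by (intro wcomp_in_ops U_preserving preserving_id essentially_bounded_const
      essentially_bounded_fst \<gamma> right_preserving weight_bounded; assumption)+

definition gens where "gens = {mul a |a. a \<in> essentially_bounded \<mu>} \<union> {U g |g. g \<in> carrier G}"

lemma M_eq: "M = vn_generated (L2 \<nu>) gens"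
proof -
  have "mul a = l2_op \<nu> (\<lambda>\<xi> (x, h). a x * \<xi> (x, h))" for a
    unfolding mul_def wcomp_def by (intro arg_cong[where f = "l2_op \<nu>"]) (auto simp: fun_eq_iff)
  moreover have "U g = l2_op \<nu> (\<lambda>\<xi> (x, h). \<xi> (\<phi> (inv g) x, inv g \<otimes> h))" for g
    unfolding U_def wcomp_def by (intro arg_cong[where f = "l2_op \<nu>"]) (auto simp: fun_eq_iff)
  ultimately show ?thesis by (simp add: crossed_product_def gens_def)
qed

lemma gens_ops: "gens \<subseteq> bounded_ops (L2 \<nu>)"
  by (auto simp: gens_def U_ops mul_ops)

lemma M_vn: "von_neumann_algebra (L2 \<nu>) M"
  unfolding M_eq by (rule L2.von_neumann_vn_generated[OF gens_ops])

lemma U_in_M: "g \<in> carrier G \<Longrightarrow> U g \<in> M" and mul_in_M: "a \<in> essentially_bounded \<mu> \<Longrightarrow> mul a \<in> M"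
  using L2.vn_generated_superset[OF gens_ops] by (auto simp: M_eq gens_def)

lemma rmult_commutes_gens:
  assumes a: "a \<in> essentially_bounded \<mu>" and g: "g \<in> carrier G" and W: "W \<in> gens"
    and F: "F \<in> vecs (L2 \<nu>)"
  shows "rmult a g (W F) = W (rmult a g F)"
  using W unfolding gens_def
proof (elim UnE CollectE exE conjE)
  fix b assume b: "W = mul b" "b \<in> essentially_bounded \<mu>"
  show ?thesis
    unfolding b(1) rmult_def mul_def
    by (rule wcomp_commute[OF right_preserving[OF g] preserving_id weight_bounded[OF a]
          essentially_bounded_fst[OF \<gamma> b(2)] _ _ F]) auto
next
  fix k assume k: "W = U k" "k \<in> carrier G"
  have "weight a (map_prod (\<phi> (inv k)) (\<lambda>h. inv k \<otimes> h) p) = weight a p" if "p \<in> space \<nu>" for p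
    using that k(2) by (auto simp: weight_def space_\<nu> \<phi>_mult inv_mult_group m_assoc)
  then show ?thesis
    unfolding k(1) rmult_def U_def
    by (intro wcomp_commute[OF right_preserving[OF g] U_preserving[OF k(2)] weight_bounded[OF a]
          essentially_bounded_const _ _ F] AE_I2) (use k(2) g in \<open>auto simp: space_\<nu> m_assoc\<close>)
qed

lemma rmult_adjoint:
  assumes a: "a \<in> essentially_bounded \<mu>" and g: "g \<in> carrier G"
  shows "\<exists>b\<in>essentially_bounded \<mu>. adjoint_op (L2 \<nu>) (rmult a g) = rmult b (inv g)"
proof
  let ?b = "\<lambda>x. cnj (a (\<phi> g x))"
  show b: "?b \<in> essentially_bounded \<mu>"
    by (intro essentially_bounded_cnj essentially_bounded_preserving[OF \<phi>_preserving[OF g]] a)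
  have r: "preserving \<nu> (right (inv g))" using g by (intro right_preserving) simp
  have "adjoint_op (L2 \<nu>) (rmult a g) = wcomp \<nu> (\<lambda>p. cnj (weight a (right (inv g) p))) (right (inv g))"
    unfolding rmult_def using g
    by (intro wcomp_adjoint right_preserving r weight_bounded a) (auto simp: space_\<nu> m_assoc)
  also have "\<dots> = rmult ?b (inv g)"
    unfolding rmult_def
  proof (rule L2.op_ext[OF wcomp_in_ops[OF r] wcomp_in_ops[OF r weight_bounded[OF b]]])
    show "(\<lambda>p. cnj (weight a (right (inv g) p))) \<in> essentially_bounded \<nu>"
      by (intro essentially_bounded_cnj essentially_bounded_preserving[OF r] weight_bounded a)
    fix F assume "F \<in> vecs (L2 \<nu>)"
    then obtain f where f: "f \<in> l2_functions \<nu>" "F = l2_class \<nu> f" by (auto elim!: L2_vec_cases)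
    show "wcomp \<nu> (\<lambda>p. cnj (weight a (right (inv g) p))) (right (inv g)) F
        = wcomp \<nu> (weight ?b) (right (inv g)) F"
      unfolding f(2) wcomp_apply[OF r f(1)] using g
      by (intro l2_class_cong AE_I2) (auto simp: space_\<nu> weight_def \<phi>_mult inv_mult_group)
  qed
  finally show "adjoint_op (L2 \<nu>) (rmult a g) = rmult ?b (inv g)" .
qed

text \<open>Left and right multiplications commute.\<close>

lemma rmult_commutant:
  assumes a: "a \<in> essentially_bounded \<mu>" and g: "g \<in> carrier G"
  shows "rmult a g \<in> commutant (L2 \<nu>) M"
proof -
  obtain b where b: "b \<in> essentially_bounded \<mu>" "adjoint_op (L2 \<nu>) (rmult a g) = rmult b (inv g)"
    using rmult_adjoint[OF a g] by blast
  show ?thesis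
    unfolding M_eq using b g rmult_commutes_gens[OF a g] rmult_commutes_gens[OF b(1)]
    by (intro L2.commutant_vn_generatedI[OF gens_ops rmult_ops[OF a g]]) auto
qed

text \<open>The vector \<open>1 \<otimes> \<delta>\<^sub>e\<close> of the trace.\<close>

definition \<xi>0 :: "'x \<times> 'a \<Rightarrow> complex" where "\<xi>0 = (\<lambda>(x, h). 1 * indicator {\<one>} h)"
definition \<xi> where "\<xi> = l2_class \<nu> \<xi>0"

lemma \<xi>0_l2: "\<xi>0 \<in> l2_functions \<nu>"
proof -
  have "(\<lambda>_. 1) \<in> l2_functions \<mu>" by (simp add: l2_functions_def)
  then show ?thesis
    unfolding \<xi>0_def by (intro l2_product[OF \<gamma>] l2_point) auto
qed

lemma \<xi>_in: "\<xi> \<in> vecs (L2 \<nu>)"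
  by (simp add: \<xi>_def L2_class_in \<xi>0_l2)

text \<open>The right multiples of \<open>\<xi>\<close> include the bounded functions supported on a single slice \<open>X \<times> {h}\<close>.\<close>

lemma \<xi>_separating:
  assumes z: "z \<in> M" "z \<xi> = vzero (L2 \<nu>)"
  shows "z = op_zero (L2 \<nu>)"
proof (rule L2.separatingI[OF M_vn _ \<xi>_in _ z])
  let ?D = "{rmult a g |a g. a \<in> essentially_bounded \<mu> \<and> g \<in> carrier G}"
  show "?D \<subseteq> commutant (L2 \<nu>) M" using rmult_commutant by auto
  fix F assume F: "F \<in> vecs (L2 \<nu>)" and orth: "\<And>c. c \<in> ?D \<Longrightarrow> vinner (L2 \<nu>) (c \<xi>) F = 0"
  obtain f where f: "f \<in> l2_functions \<nu>" "F = l2_class \<nu> f" using L2_vec_cases[OF F] .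
  have "AE p in \<nu>. f p = 0"
  proof (rule AE_slices[OF countable])
    fix h assume h: "h \<in> carrier G"
    define a where "a x = squash (f (\<phi> h x, h))" for x
    have "(\<lambda>x. f (x, h)) \<in> borel_measurable \<mu>"
      using l2_section[OF countable f(1) h] by (rule l2_measurable)
    then have a: "a \<in> essentially_bounded \<mu>"
      unfolding a_def using essentially_bounded_preserving[OF \<phi>_preserving[OF h] squash_bounded]
      by blast
    let ?s = "\<lambda>p. weight a p * \<xi>0 (right (inv h) p)"
    have hi: "inv h \<in> carrier G" using h by simp
    have Rxi: "rmult a (inv h) \<xi> = l2_class \<nu> ?s"
      unfolding rmult_def \<xi>_def by (rule wcomp_apply[OF right_preserving[OF hi] \<xi>0_l2])
    show "AE p in \<nu>. snd p = h \<longrightarrow> f p = 0"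
    proof (rule orthogonal_to_squashed_slice[OF f(1)])
      show "?s \<in> l2_functions \<nu>"
        by (intro l2_weighted_composition right_preserving hi weight_bounded a \<xi>0_l2)
      show "?s p = (if snd p = h then squash (f p) else 0)" if p_in: "p \<in> space \<nu>" for p
      proof -
        obtain x k where p: "p = (x, k)" "x \<in> space \<mu>" "k \<in> carrier G"
          using p_in by (cases p) (auto simp: space_\<nu>)
        have "k \<otimes> inv h = \<one> \<longleftrightarrow> k = h" using p(3) h
          by (metis inv_equality inv_inv hi r_inv)
        then show ?thesis
          using p h by (auto simp: weight_def a_def \<xi>0_def \<phi>_mult \<phi>_one indicator_def)
      qed
      show "vinner (L2 \<nu>) (l2_class \<nu> ?s) (l2_class \<nu> f) = 0"
        using orth[of "rmult a (inv h)"] a hi unfolding Rxi f(2) by blast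
    qed
  qed
  then show "F = vzero (L2 \<nu>)" unfolding f(2) L2_vzero by (rule l2_class_cong)
qed

text \<open>On the trace vector left and right multiplications agree. This turns commutators with \<open>U g\<close> and \<open>mul a\<close>
  into differences of a left and a right multiplication, applied to one vector.\<close>

lemma U_\<xi>:
  assumes g: "g \<in> carrier G"
  shows "U g \<xi> = rmult (\<lambda>_. 1) (inv g) \<xi>"
proof -
  have gi: "inv g \<in> carrier G" using g by simp
  have "inv g \<otimes> h = \<one> \<longleftrightarrow> h \<otimes> inv g = \<one>" if "h \<in> carrier G" for h
    using that g by (metis inv_comm gi)
  then show ?thesis
    unfolding U_def rmult_def \<xi>_def wcomp_apply[OF U_preserving[OF g] \<xi>0_l2]
      wcomp_apply[OF right_preserving[OF gi] \<xi>0_l2]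
    by (intro l2_class_cong AE_I2) (auto simp: space_\<nu> \<xi>0_def weight_def indicator_def)
qed

lemma mul_\<xi>: "mul a \<xi> = rmult a \<one> \<xi>"
  unfolding mul_def rmult_def \<xi>_def wcomp_apply[OF preserving_id \<xi>0_l2]
    wcomp_apply[OF right_preserving[OF one_closed] \<xi>0_l2]
  by (intro l2_class_cong AE_I2) (auto simp: space_\<nu> \<xi>0_def weight_def indicator_def \<phi>_one)

end

section \<open>The tensor product with the hyperfinite factor\<close>

lemma (in hilbert_space) norm_sq_vsub_le:
  assumes "x \<in> V" "y \<in> V"
  shows "Re (ip (vsub x y) (vsub x y)) \<le> 2 * Re (ip x x) + 2 * Re (ip y y)"
  using inner_nonneg[of "vadd H x y"] assms by (simp add: inner_simps closed)

lemma
  assumes "group \<Gamma>"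
  shows left_translation_in_group_vn: "s \<in> carrier \<Gamma> \<Longrightarrow>
      wcomp (count_space (carrier \<Gamma>)) (\<lambda>_. 1) (\<lambda>t. inv\<^bsub>\<Gamma>\<^esub> s \<otimes>\<^bsub>\<Gamma>\<^esub> t) \<in> group_vn \<Gamma>"
    and left_translations_in_ops: "{l2_op (count_space (carrier \<Gamma>)) (\<lambda>\<xi> h. \<xi> (inv\<^bsub>\<Gamma>\<^esub> g \<otimes>\<^bsub>\<Gamma>\<^esub> h)) | g. g \<in> carrier \<Gamma>}
      \<subseteq> bounded_ops (L2 (count_space (carrier \<Gamma>)))" (is "?gens \<subseteq> _")
proof -
  interpret group \<Gamma> by fact
  have eq: "wcomp (count_space (carrier \<Gamma>)) (\<lambda>_. 1) (\<lambda>t. inv\<^bsub>\<Gamma>\<^esub> g \<otimes>\<^bsub>\<Gamma>\<^esub> t)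
      = l2_op (count_space (carrier \<Gamma>)) (\<lambda>\<xi> h. \<xi> (inv\<^bsub>\<Gamma>\<^esub> g \<otimes>\<^bsub>\<Gamma>\<^esub> h))" for g
    by (simp add: wcomp_def)
  have "wcomp (count_space (carrier \<Gamma>)) (\<lambda>_. 1) (\<lambda>t. inv\<^bsub>\<Gamma>\<^esub> g \<otimes>\<^bsub>\<Gamma>\<^esub> t)
      \<in> bounded_ops (L2 (count_space (carrier \<Gamma>)))" if "g \<in> carrier \<Gamma>" for g
    using that assms(1)
    by (intro wcomp_in_ops preserving_bij_count_space group_bij_mult essentially_bounded_const) auto
  then show gens: "?gens \<subseteq> bounded_ops (L2 (count_space (carrier \<Gamma>)))" by (auto simp: eq)
  assume "s \<in> carrier \<Gamma>"
  then show "wcomp (count_space (carrier \<Gamma>)) (\<lambda>_. 1) (\<lambda>t. inv\<^bsub>\<Gamma>\<^esub> s \<otimes>\<^bsub>\<Gamma>\<^esub> t) \<in> group_vn \<Gamma>"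
    using L2.vn_generated_superset[OF gens] unfolding group_vn_def eq by auto
qed

lemma right_translation_commutant:
  assumes \<Gamma>: "group \<Gamma>" and s: "s \<in> carrier \<Gamma>"
  shows "wcomp (count_space (carrier \<Gamma>)) (\<lambda>_. 1) (\<lambda>t. t \<otimes>\<^bsub>\<Gamma>\<^esub> s)
    \<in> commutant (L2 (count_space (carrier \<Gamma>))) (group_vn \<Gamma>)"
proof -
  interpret group \<Gamma> by fact
  let ?r = "\<lambda>s. wcomp (count_space (carrier \<Gamma>)) (\<lambda>_. 1) (\<lambda>t. t \<otimes>\<^bsub>\<Gamma>\<^esub> s)"
  have r: "preserving (count_space (carrier \<Gamma>)) (\<lambda>t. t \<otimes>\<^bsub>\<Gamma>\<^esub> s)" if "s \<in> carrier \<Gamma>" for s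
    using that \<Gamma> by (intro preserving_bij_count_space group_bij_mult)
  have adj: "adjoint_op (L2 (count_space (carrier \<Gamma>))) (?r s) = ?r (inv\<^bsub>\<Gamma>\<^esub> s)"
    using wcomp_adjoint[OF r[OF s] r[of "inv\<^bsub>\<Gamma>\<^esub> s"] essentially_bounded_const[of 1]] s
    by (simp add: m_assoc)
  have comm: "?r k (W F) = W (?r k F)"
    if k: "k \<in> carrier \<Gamma>" and W: "W \<in> {l2_op (count_space (carrier \<Gamma>))
      (\<lambda>\<xi> h. \<xi> (inv\<^bsub>\<Gamma>\<^esub> g \<otimes>\<^bsub>\<Gamma>\<^esub> h)) | g. g \<in> carrier \<Gamma>}"
      and F: "F \<in> vecs (L2 (count_space (carrier \<Gamma>)))" for k W F
  proof -
    obtain g where g: "g \<in> carrier \<Gamma>"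
        "W = wcomp (count_space (carrier \<Gamma>)) (\<lambda>_. 1) (\<lambda>t. inv\<^bsub>\<Gamma>\<^esub> g \<otimes>\<^bsub>\<Gamma>\<^esub> t)"
      using W by (auto simp: wcomp_def)
    have l: "preserving (count_space (carrier \<Gamma>)) (\<lambda>t. inv\<^bsub>\<Gamma>\<^esub> g \<otimes>\<^bsub>\<Gamma>\<^esub> t)"
      using g(1) \<Gamma> by (intro preserving_bij_count_space group_bij_mult) auto
    show ?thesis
      unfolding g(2)
      by (rule wcomp_commute[OF r[OF k] l essentially_bounded_const essentially_bounded_const _ _ F])
        (use g(1) k in \<open>auto simp: m_assoc\<close>)
  qed
  show ?thesis
    unfolding group_vn_def
    by (rule L2.commutant_vn_generatedI[OF left_translations_in_ops[OF \<Gamma>]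
          wcomp_in_ops[OF r[OF s] essentially_bounded_const]])
      (use comm s adj in auto)
qed

lemma group_vn_vn: "group \<Gamma> \<Longrightarrow> von_neumann_algebra (L2 (count_space (carrier \<Gamma>))) (group_vn \<Gamma>)"
  unfolding group_vn_def
  by (rule L2.von_neumann_vn_generated[OF left_translations_in_ops])

lemma wcomp_one_id: "F \<in> vecs (L2 \<nu>) \<Longrightarrow> wcomp \<nu> (\<lambda>_. 1) (\<lambda>p. p) F = F"
  by (auto elim!: L2_vec_cases simp: wcomp_apply[OF preserving_id])

context crossed
begin

abbreviation "K \<equiv> \<nu> \<Otimes>\<^sub>M R_space"
abbreviation "N \<equiv> vn_tensor \<nu> R_space M hyperfinite_R"

lemma R_sigma_finite: "sigma_finite_measure R_space"
  using countable_finitary by (rule sigma_finite_measure_count_space_countable)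

lemma R_vn: "von_neumann_algebra (L2 R_space) hyperfinite_R"
  unfolding hyperfinite_R_def by (rule group_vn_vn[OF group_finitary])

definition N_gens where
  "N_gens = {W \<in> bounded_ops (L2 K). \<exists>S\<in>M. \<exists>T\<in>hyperfinite_R.
     \<forall>F\<in>vecs (L2 \<nu>). \<forall>G\<in>vecs (L2 R_space).
       W (l2_tensor \<nu> R_space F G) = l2_tensor \<nu> R_space (S F) (T G)}"

lemma N_gens_ops: "N_gens \<subseteq> bounded_ops (L2 K)"
  by (auto simp: N_gens_def)

lemma N_eq: "N = vn_generated (L2 K) N_gens"
  by (simp add: vn_tensor_def N_gens_def)

lemma N_vn: "von_neumann_algebra (L2 K) N"
  unfolding N_eq by (rule L2.von_neumann_vn_generated[OF N_gens_ops])

lemma translate_preserving: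
  assumes "s \<in> carrier finitary_sym_group"
  shows "preserving R_space (\<lambda>t. t \<circ> s)" and "preserving R_space (\<lambda>t. s \<circ> t)"
  using group_bij_mult[OF group_finitary assms]
  by (auto intro!: preserving_bij_count_space simp: finitary_mult)

text \<open>The tensor product of an element of the commutant of the crossed product with a right translation of the
  permutation group.\<close>

lemma tensor_wcomp_commutant:
  assumes \<tau>: "preserving \<nu> \<tau>" "preserving \<nu> \<sigma>" "\<And>p. p \<in> space \<nu> \<Longrightarrow> \<tau> (\<sigma> p) = p"
    and w: "w \<in> essentially_bounded \<nu>" and c: "wcomp \<nu> w \<tau> \<in> commutant (L2 \<nu>) M"
    and s: "s \<in> carrier finitary_sym_group"
  shows "wcomp K (\<lambda>p. w (fst p)) (map_prod \<tau> (\<lambda>t. t \<circ> s)) \<in> commutant (L2 K) N"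
proof -
  let ?s = "inv\<^bsub>finitary_sym_group\<^esub> s"
  interpret fin: group finitary_sym_group by (rule group_finitary)
  have s': "?s \<in> carrier finitary_sym_group" "?s \<circ> s = id"
    using s fin.l_inv[OF s] by (auto simp: finitary_mult finitary_one)
  let ?w = "\<lambda>p. cnj (w (\<sigma> p))"
  have w': "?w \<in> essentially_bounded \<nu>"
    by (intro essentially_bounded_cnj essentially_bounded_preserving[OF \<tau>(2)] w)
  let ?P = "wcomp K (\<lambda>p. w (fst p)) (map_prod \<tau> (\<lambda>t. t \<circ> s))"
  let ?Q = "wcomp K (\<lambda>p. ?w (fst p)) (map_prod \<sigma> (\<lambda>t. t \<circ> ?s))"
  note pres = preserving_map_prod[OF \<tau>(1) translate_preserving(1)[OF s] R_sigma_finite]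
    preserving_map_prod[OF \<tau>(2) translate_preserving(1)[OF s'(1)] R_sigma_finite]
  have P: "?P \<in> bounded_ops (L2 K)" "?Q \<in> bounded_ops (L2 K)"
    by (intro wcomp_in_ops pres essentially_bounded_fst R_sigma_finite w w')+
  have PQ: "adjoint_op (L2 K) ?P = ?Q"
  proof -
    have "adjoint_op (L2 K) ?P = wcomp K (\<lambda>p. cnj (w (fst (map_prod \<sigma> (\<lambda>t. t \<circ> ?s) p))))
        (map_prod \<sigma> (\<lambda>t. t \<circ> ?s))"
      using \<tau>(3) s'(2)
      by (intro wcomp_adjoint pres essentially_bounded_fst R_sigma_finite w)
        (auto simp: space_pair_measure comp_assoc)
    then show ?thesis by (simp add: fst_map_prod)
  qed
  have c': "wcomp \<nu> ?w \<sigma> \<in> commutant (L2 \<nu>) M"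
    using L2.commutant_adjoint[OF _ _ c] M_vn wcomp_adjoint[OF \<tau>(1,2) w \<tau>(3)]
    by (auto simp: von_neumann_algebra_def)
  have d: "wcomp R_space (\<lambda>_. 1) (\<lambda>t. t \<circ> k) \<in> commutant (L2 R_space) hyperfinite_R"
    if "k \<in> carrier finitary_sym_group" for k
    using right_translation_commutant[OF group_finitary that]
    by (simp add: hyperfinite_R_def finitary_mult)
  have MR: "M \<subseteq> bounded_ops (L2 \<nu>)" "hyperfinite_R \<subseteq> bounded_ops (L2 R_space)"
    using M_vn R_vn by (auto simp: von_neumann_algebra_def)
  have commute: "T (W x) = W (T x)"
    if W: "W \<in> N_gens" and x: "x \<in> vecs (L2 K)" and T: "T = wcomp K (\<lambda>p. u (fst p)) (map_prod \<rho> (\<lambda>t. t \<circ> k))"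
      and \<rho>: "preserving \<nu> \<rho>" "u \<in> essentially_bounded \<nu>" "wcomp \<nu> u \<rho> \<in> commutant (L2 \<nu>) M"
      and k: "k \<in> carrier finitary_sym_group" for W x T u \<rho> k
  proof -
    obtain S T' where ST: "S \<in> M" "T' \<in> hyperfinite_R" "\<And>F G. \<lbrakk>F \<in> vecs (L2 \<nu>); G \<in> vecs (L2 R_space)\<rbrakk> \<Longrightarrow>
       W (l2_tensor \<nu> R_space F G) = l2_tensor \<nu> R_space (S F) (T' G)"
      using W by (auto simp: N_gens_def)
    have To: "T \<in> bounded_ops (L2 K)"
      unfolding T by (intro wcomp_in_ops preserving_map_prod \<rho> translate_preserving k R_sigma_finite
          essentially_bounded_fst)
    have TFG: "T (l2_tensor \<nu> R_space F G) = l2_tensor \<nu> R_space (wcomp \<nu> u \<rho> F) (wcomp R_space (\<lambda>_. 1) (\<lambda>t. t \<circ> k) G)"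
      if "F \<in> vecs (L2 \<nu>)" "G \<in> vecs (L2 R_space)" for F G
      unfolding T by (rule wcomp_tensor[OF R_sigma_finite \<rho>(1) translate_preserving(1)[OF k] \<rho>(2) that])
    have Wo: "W \<in> bounded_ops (L2 K)" using W N_gens_ops by blast
    show ?thesis
      by (rule tensor_commutes[OF countable_finitary MR Wo ST(1,2) ST(3) To \<rho>(3) d[OF k] TFG x])
  qed
  show ?thesis
    unfolding N_eq
    by (rule L2.commutant_vn_generatedI[OF N_gens_ops P(1)])
      (use commute[OF _ _ refl \<tau>(1) w c s] commute[OF _ _ refl \<tau>(2) w' c' s'(1)] PQ in auto)
qed

text \<open>Right multiplication by \<open>u\<^sub>g\<^sup>* a\<close> in the crossed product, combined with right translation in the group
  of permutations.\<close>

definition rmult_N where "rmult_N a g s = wcomp K (\<lambda>p. weight a (fst p)) (map_prod (right g) (\<lambda>t. t \<circ> s))"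

lemma rmult_N_preserving:
  "\<lbrakk>g \<in> carrier G; s \<in> carrier finitary_sym_group\<rbrakk> \<Longrightarrow> preserving K (map_prod (right g) (\<lambda>t. t \<circ> s))"
  by (intro preserving_map_prod[OF right_preserving translate_preserving(1)] R_sigma_finite)

lemma rmult_N_commutant:
  assumes "a \<in> essentially_bounded \<mu>" "g \<in> carrier G" "s \<in> carrier finitary_sym_group"
  shows "rmult_N a g s \<in> commutant (L2 K) N"
  unfolding rmult_N_def
  using rmult_commutant[OF assms(1,2)] assms
  by (intro tensor_wcomp_commutant[where \<sigma> = "right (inv g)"] right_preserving weight_bounded)
    (auto simp: rmult_def space_\<nu> m_assoc)

definition \<xi>N0 where "\<xi>N0 = (\<lambda>(p, t). \<xi>0 p * indicator {id} t)"
definition \<xi>N where "\<xi>N = l2_class K \<xi>N0"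

lemma \<xi>N0_l2: "\<xi>N0 \<in> l2_functions K"
  unfolding \<xi>N0_def
  by (intro l2_product[OF R_sigma_finite \<xi>0_l2 l2_point]) (simp add: finitary_carrier)

lemma \<xi>N_in: "\<xi>N \<in> vecs (L2 K)"
  by (simp add: \<xi>N_def L2_class_in \<xi>N0_l2)

lemma space_K: "space K = (space \<mu> \<times> carrier G) \<times> carrier finitary_sym_group"
  by (simp add: space_pair_measure)

lemma \<xi>N_separating:
  assumes z: "z \<in> N" "z \<xi>N = vzero (L2 K)"
  shows "z = op_zero (L2 K)"
proof (rule L2.separatingI[OF N_vn _ \<xi>N_in _ z])
  let ?D = "{rmult_N a g s |a g s. a \<in> essentially_bounded \<mu> \<and> g \<in> carrier G \<and>
    s \<in> carrier finitary_sym_group}"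
  interpret fin: group finitary_sym_group by (rule group_finitary)
  show "?D \<subseteq> commutant (L2 K) N" using rmult_N_commutant by auto
  fix F assume F: "F \<in> vecs (L2 K)" and orth: "\<And>c. c \<in> ?D \<Longrightarrow> vinner (L2 K) (c \<xi>N) F = 0"
  obtain f where f: "f \<in> l2_functions K" "F = l2_class K f" using L2_vec_cases[OF F] .
  have "AE p in K. f p = 0"
  proof (rule AE_slices[OF countable_finitary])
    fix t assume t: "t \<in> carrier finitary_sym_group"
    have "AE p in K. \<forall>h\<in>carrier G. snd (fst p) = h \<longrightarrow> snd p = t \<longrightarrow> f p = 0"
      unfolding AE_ball_countable[OF countable]
    proof
      fix h assume h: "h \<in> carrier G"
      define a where "a x = squash (f ((\<phi> h x, h), t))" for x
      have "(\<lambda>q. f (q, t)) \<in> l2_functions \<nu>" by (rule l2_section[OF countable_finitary f(1) t])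
      from l2_section[OF countable this h]
      have "(\<lambda>x. f ((x, h), t)) \<in> borel_measurable \<mu>" by (rule l2_measurable)
      then have a: "a \<in> essentially_bounded \<mu>"
        unfolding a_def using essentially_bounded_preserving[OF \<phi>_preserving[OF h] squash_bounded]
        by blast
      let ?k = "inv\<^bsub>finitary_sym_group\<^esub> t"
      let ?s = "\<lambda>p. weight a (fst p) * \<xi>N0 (map_prod (right (inv h)) (\<lambda>t. t \<circ> ?k) p)"
      have hi: "inv h \<in> carrier G" and ti: "?k \<in> carrier finitary_sym_group" using h t by auto
      have Rxi: "rmult_N a (inv h) ?k \<xi>N = l2_class K ?s"
        unfolding rmult_N_def \<xi>N_def by (rule wcomp_apply[OF rmult_N_preserving[OF hi ti] \<xi>N0_l2])
      have "AE p in K. snd (fst p) = h \<and> snd p = t \<longrightarrow> f p = 0"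
      proof (rule orthogonal_to_squashed_slice[OF f(1)])
        show "?s \<in> l2_functions K"
          by (intro l2_weighted_composition rmult_N_preserving hi ti essentially_bounded_fst
              R_sigma_finite weight_bounded a \<xi>N0_l2)
        show "?s p = (if snd (fst p) = h \<and> snd p = t then squash (f p) else 0)" if p_in: "p \<in> space K" for p
        proof -
          obtain x k u where p: "p = ((x, k), u)" "x \<in> space \<mu>" "k \<in> carrier G"
              "u \<in> carrier finitary_sym_group"
            using p_in by (cases p) (auto simp: space_K)
          have "k \<otimes> inv h = \<one> \<longleftrightarrow> k = h" using p(3) h
            by (metis inv_equality inv_inv hi r_inv)
          moreover have "u \<circ> ?k = id \<longleftrightarrow> u = t"
            using p(4) t fin.inv_equality[of u ?k] fin.inv_inv[OF t] fin.r_inv[OF t] ti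
            unfolding finitary_mult finitary_one by metis
          ultimately show ?thesis
            using p h by (auto simp: weight_def a_def \<xi>N0_def \<xi>0_def \<phi>_mult \<phi>_one indicator_def)
        qed
        show "vinner (L2 K) (l2_class K ?s) (l2_class K f) = 0"
          using orth[of "rmult_N a (inv h) ?k"] a hi ti unfolding Rxi f(2) by blast
      qed
      then show "AE p in K. snd (fst p) = h \<longrightarrow> snd p = t \<longrightarrow> f p = 0" by eventually_elim blast
    qed
    with AE_space show "AE p in K. snd p = t \<longrightarrow> f p = 0"
      by eventually_elim (auto simp: space_K)
  qed
  then show "F = vzero (L2 K)" unfolding f(2) L2_vzero by (rule l2_class_cong)
qed


subsection \<open>A central sequence\<close>

text \<open>The operator \<open>1 \<otimes> \<lambda>\<^sub>s\<close> for an involution \<open>s\<close>, which equals its own inverse.\<close>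

definition \<Lambda> where "\<Lambda> s = wcomp K (\<lambda>_. 1) (map_prod (\<lambda>p. p) (\<lambda>t. s \<circ> t))"

context
  fixes s assumes s: "s \<in> carrier finitary_sym_group"
begin

lemma \<Lambda>_preserving: "preserving K (map_prod (\<lambda>p. p) (\<lambda>t. s \<circ> t))"
  by (intro preserving_map_prod[OF preserving_id translate_preserving(2)[OF s]] R_sigma_finite)

lemma \<Lambda>_ops: "\<Lambda> s \<in> bounded_ops (L2 K)"
  unfolding \<Lambda>_def by (rule wcomp_in_ops[OF \<Lambda>_preserving essentially_bounded_const])

lemma \<Lambda>_apply:
  assumes "f \<in> l2_functions K"
  shows "\<Lambda> s (l2_class K f) = l2_class K (\<lambda>(p, t). f (p, s \<circ> t))"
  unfolding \<Lambda>_def wcomp_apply[OF \<Lambda>_preserving assms] by (rule l2_class_cong) (auto intro!: AE_I2)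

lemma l2_left_translate:
  assumes "f \<in> l2_functions K"
  shows "(\<lambda>(p, t). f (p, s \<circ> t)) \<in> l2_functions K"
  using l2_weighted_composition[OF \<Lambda>_preserving essentially_bounded_const assms, of 1]
  by (simp add: map_prod_def split_beta')

end

context
  fixes s assumes s: "s \<in> carrier finitary_sym_group" and s2: "s \<circ> s = id"
begin

lemma \<Lambda>_in_N: "\<Lambda> s \<in> N"
proof -
  interpret fin: group finitary_sym_group by (rule group_finitary)
  have inv: "inv\<^bsub>finitary_sym_group\<^esub> s = s"
    using s s2 by (intro fin.inv_equality) (auto simp: finitary_mult finitary_one)
  have L: "wcomp R_space (\<lambda>_. 1) (\<lambda>t. s \<circ> t) \<in> hyperfinite_R"
    using left_translation_in_group_vn[OF group_finitary s]
    by (simp add: hyperfinite_R_def inv finitary_mult)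
  have "\<Lambda> s (l2_tensor \<nu> R_space F Q)
      = l2_tensor \<nu> R_space (op_one (L2 \<nu>) F) (wcomp R_space (\<lambda>_. 1) (\<lambda>t. s \<circ> t) Q)"
    if F: "F \<in> vecs (L2 \<nu>)" and Q: "Q \<in> vecs (L2 R_space)" for F Q
    unfolding \<Lambda>_def L2.op_one_apply[OF F]
    using wcomp_tensor[OF R_sigma_finite preserving_id translate_preserving(2)[OF s]
        essentially_bounded_const F Q, of 1]
    by (simp add: wcomp_one_id[OF F])
  then have "\<Lambda> s \<in> N_gens"
    unfolding N_gens_def using \<Lambda>_ops[OF s] L L2.vn_closed(1)[OF M_vn] by blast
  then show ?thesis unfolding N_eq using L2.vn_generated_superset[OF N_gens_ops] by blast
qed

lemma \<Lambda>_square: "op_mult (L2 K) (adjoint_op (L2 K) (\<Lambda> s)) (\<Lambda> s) = op_one (L2 K)"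
proof (rule L2.op_inner_ext)
  have ss: "s \<circ> (s \<circ> t) = t" for t :: "nat \<Rightarrow> nat"
    using s2 by (metis comp_assoc id_comp)
  have adj: "adjoint_op (L2 K) (\<Lambda> s) = \<Lambda> s"
    unfolding \<Lambda>_def
    using wcomp_adjoint[OF \<Lambda>_preserving[OF s] \<Lambda>_preserving[OF s] essentially_bounded_const[of 1]]
    by (simp add: map_prod_def split_beta ss)
  fix F Q assume F: "F \<in> vecs (L2 K)" and Q: "Q \<in> vecs (L2 K)"
  obtain f where f: "f \<in> l2_functions K" "F = l2_class K f" using L2_vec_cases[OF F] .
  have "\<Lambda> s (\<Lambda> s F) = F"
    using f by (simp add: \<Lambda>_apply[OF s] l2_left_translate[OF s] ss)
  then show "vinner (L2 K) (op_mult (L2 K) (adjoint_op (L2 K) (\<Lambda> s)) (\<Lambda> s) F) Q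
      = vinner (L2 K) (op_one (L2 K) F) Q"
    using F by (simp add: adj L2.op_mult_apply L2.op_one_apply)
qed (intro L2.ops_closed \<Lambda>_ops[OF s])+

lemma \<Lambda>_\<xi>N: "\<Lambda> s \<xi>N = rmult_N (\<lambda>_. 1) \<one> s \<xi>N"
proof -
  have "s \<circ> t = id \<longleftrightarrow> t \<circ> s = id" for t :: "nat \<Rightarrow> nat"
    using s2 by (metis comp_assoc comp_id id_comp)
  then show ?thesis
    unfolding \<Lambda>_def rmult_N_def \<xi>N_def wcomp_apply[OF \<Lambda>_preserving[OF s] \<xi>N0_l2]
      wcomp_apply[OF rmult_N_preserving[OF one_closed s] \<xi>N0_l2]
    by (intro l2_class_cong AE_I2) (auto simp: space_K \<xi>N0_def weight_def indicator_def)
qed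

text \<open>Applied to \<open>\<xi>N\<close>, the commutator of \<open>\<Lambda> s\<close> with \<open>Y\<close> compares the left and the right translation by \<open>s\<close> of
  the single vector \<open>Y \<xi>N\<close>, because the right translation commutes with \<open>Y\<close>.\<close>

lemma \<Lambda>_commutator:
  assumes "Y \<in> N" "Y \<xi>N = l2_class K f" "f \<in> l2_functions K"
  shows "L2.vsub K (\<Lambda> s (Y \<xi>N)) (Y (\<Lambda> s \<xi>N)) = l2_class K (\<lambda>(p, t). f (p, s \<circ> t) - f (p, t \<circ> s))"
    and "(\<lambda>(p, t). f (p, s \<circ> t)) \<in> l2_functions K" "(\<lambda>(p, t). f (p, t \<circ> s)) \<in> l2_functions K"
proof -
  show l: "(\<lambda>(p, t). f (p, s \<circ> t)) \<in> l2_functions K"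
    by (rule l2_left_translate[OF s assms(3)])
  have pr: "preserving K (map_prod (\<lambda>p. p) (\<lambda>t. t \<circ> s))"
    by (intro preserving_map_prod[OF preserving_id translate_preserving(1)[OF s]] R_sigma_finite)
  show r: "(\<lambda>(p, t). f (p, t \<circ> s)) \<in> l2_functions K"
    using l2_weighted_composition[OF pr essentially_bounded_const assms(3), of 1]
    by (simp add: map_prod_def split_beta')
  have "Y (\<Lambda> s \<xi>N) = rmult_N (\<lambda>_. 1) \<one> s (Y \<xi>N)"
    unfolding \<Lambda>_\<xi>N
    using L2.commutantD[OF rmult_N_commutant[OF essentially_bounded_const one_closed s] assms(1) \<xi>N_in] by simp
  also have "\<dots> = l2_class K (\<lambda>(p, t). f (p, t \<circ> s))"
    unfolding assms(2) rmult_N_def wcomp_apply[OF rmult_N_preserving[OF one_closed s] assms(3)]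
    by (intro l2_class_cong AE_I2) (auto simp: space_K weight_def)
  finally show "L2.vsub K (\<Lambda> s (Y \<xi>N)) (Y (\<Lambda> s \<xi>N)) = l2_class K (\<lambda>(p, t). f (p, s \<circ> t) - f (p, t \<circ> s))"
    using l r by (simp add: assms(2) \<Lambda>_apply[OF s assms(3)] L2.vsub_def L2_vsub split_beta')
qed

end

text \<open>Conjugation by \<open>s\<^sub>n\<close> converges strongly to the identity on \<open>L\<^sup>2\<close>: only the part of \<open>f\<close> over the
  permutations that do not commute with \<open>s\<^sub>n\<close> contributes.\<close>

lemma conjugation_tendsto:
  assumes f: "f \<in> l2_functions K"
    and s: "\<And>n. s n \<in> carrier finitary_sym_group" "\<And>n. s n \<circ> s n = id"
    and comm: "\<And>t. t \<in> carrier finitary_sym_group \<Longrightarrow> \<forall>\<^sub>F n in sequentially. t \<circ> s n = s n \<circ> t"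
  shows "(\<lambda>n. \<integral>q. (cmod ((\<lambda>(p, t). f (p, s n \<circ> t) - f (p, t \<circ> s n)) q))\<^sup>2 \<partial>K) \<longlonglongrightarrow> 0"
proof -
  define k where "k n = (\<lambda>q. (if snd q \<circ> s n = s n \<circ> snd q then 0 else (cmod (f q))\<^sup>2))" for n
  have fm: "(\<lambda>q. (cmod (f q))\<^sup>2) \<in> borel_measurable K" using l2_integrable[OF f] by (rule borel_measurable_integrable)
  have km: "k n \<in> borel_measurable K" for n
  proof -
    have "Measurable.pred K (\<lambda>q. snd q \<circ> s n = s n \<circ> snd q)"
      by (rule measurable_compose[OF measurable_snd, of "\<lambda>t. t \<circ> s n = s n \<circ> t"]) simp
    then show ?thesis unfolding k_def using fm by (intro measurable_If) auto
  qed
  have kint: "integrable K (k n)" for n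
    by (rule Bochner_Integration.integrable_bound[OF l2_integrable[OF f] km]) (auto simp: k_def)
  have "(\<lambda>n. \<integral>q. k n q \<partial>K) \<longlonglongrightarrow> (\<integral>q. 0 \<partial>K)"
  proof (rule integral_dominated_convergence[OF _ km l2_integrable[OF f]])
    show "AE q in K. (\<lambda>n. k n q) \<longlonglongrightarrow> 0"
    proof (rule AE_I2)
      fix q assume "q \<in> space K"
      then have "\<forall>\<^sub>F n in sequentially. snd q \<circ> s n = s n \<circ> snd q"
        by (intro comm) (auto simp: space_K)
      then show "(\<lambda>n. k n q) \<longlonglongrightarrow> 0"
        by (intro tendsto_eventually, elim eventually_mono) (simp add: k_def)
    qed
    show "AE q in K. norm (k n q) \<le> (cmod (f q))\<^sup>2" for n by (auto simp: k_def)
  qed simp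
  then have lim: "(\<lambda>n. 4 * (\<integral>q. k n q \<partial>K)) \<longlonglongrightarrow> 0" by (simp add: tendsto_mult_right_zero)
  have bound: "(\<integral>q. (cmod ((\<lambda>(p, t). f (p, s n \<circ> t) - f (p, t \<circ> s n)) q))\<^sup>2 \<partial>K) \<le> 4 * (\<integral>q. k n q \<partial>K)" for n
  proof -
    let ?l = "map_prod (\<lambda>p. p) (\<lambda>t. s n \<circ> t)" and ?r = "map_prod (\<lambda>p. p) (\<lambda>t. t \<circ> s n)"
    have l: "preserving K ?l" and r: "preserving K ?r"
      by (intro preserving_map_prod preserving_id translate_preserving s(1) R_sigma_finite)+
    have canc: "s n \<circ> (s n \<circ> t) = t" "t \<circ> s n \<circ> s n = t" for t :: "nat \<Rightarrow> nat"
      using s(2)[of n] by (metis comp_assoc id_comp, metis comp_assoc comp_id)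
    have "(\<integral>q. (cmod ((\<lambda>(p, t). f (p, s n \<circ> t) - f (p, t \<circ> s n)) q))\<^sup>2 \<partial>K)
        \<le> (\<integral>q. 2 * k n (?l q) + 2 * k n (?r q) \<partial>K)"
    proof (rule integral_mono_AE')
      show "integrable K (\<lambda>q. 2 * k n (?l q) + 2 * k n (?r q))"
        using preserving_integrable[OF l kint] preserving_integrable[OF r kint] by simp
      show "AE q in K. (cmod ((\<lambda>(p, t). f (p, s n \<circ> t) - f (p, t \<circ> s n)) q))\<^sup>2 \<le> 2 * k n (?l q) + 2 * k n (?r q)"
      proof (rule AE_I2)
        fix q :: "('x \<times> 'a) \<times> (nat \<Rightarrow> nat)"
        obtain p t where q: "q = (p, t)" by fastforce
        show "(cmod ((\<lambda>(p, t). f (p, s n \<circ> t) - f (p, t \<circ> s n)) q))\<^sup>2 \<le> 2 * k n (?l q) + 2 * k n (?r q)"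
        proof (cases "t \<circ> s n = s n \<circ> t")
          case True
          then show ?thesis by (simp add: q k_def)
        next
          case False
          have "s n \<circ> t \<circ> s n \<noteq> s n \<circ> (s n \<circ> t)" "t \<circ> s n \<circ> s n \<noteq> s n \<circ> (t \<circ> s n)"
            using False canc by (metis comp_assoc)+
          then show ?thesis using cmod_diff_sq_le by (simp add: q k_def)
        qed
      qed
    qed (simp add: k_def)
    also have "\<dots> = 2 * (\<integral>q. k n (?l q) \<partial>K) + 2 * (\<integral>q. k n (?r q) \<partial>K)"
      using preserving_integrable[OF l kint] preserving_integrable[OF r kint] by simp
    also have "\<dots> = 4 * (\<integral>q. k n q \<partial>K)"
      unfolding preserving_integral[OF l km] preserving_integral[OF r km] by simp
    finally show ?thesis .
  qed
  show ?thesis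
  proof (rule Lim_null_comparison[OF _ lim], rule always_eventually, rule allI)
    fix n
    have "0 \<le> (\<integral>q. (cmod ((\<lambda>(p, t). f (p, s n \<circ> t) - f (p, t \<circ> s n)) q))\<^sup>2 \<partial>K)"
      by (rule integral_nonneg_AE) simp
    then show "norm (\<integral>q. (cmod ((\<lambda>(p, t). f (p, s n \<circ> t) - f (p, t \<circ> s n)) q))\<^sup>2 \<partial>K)
        \<le> 4 * (\<integral>q. k n q \<partial>K)"
      using bound[of n] by (simp only: real_norm_def abs_of_nonneg)
  qed
qed

text \<open>The two products move \<open>\<xi>N\<close> to different slices, so their difference has at least the mass of one slice.\<close>

lemma \<Lambda>_not_commuting:
  assumes s: "s \<in> carrier finitary_sym_group" "s \<circ> s = id"
    and s': "s' \<in> carrier finitary_sym_group" "s' \<circ> s' = id" and ne: "s \<circ> s' \<noteq> s' \<circ> s"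
  defines "D \<equiv> L2.vsub K (\<Lambda> s (\<Lambda> s' \<xi>N)) (\<Lambda> s' (\<Lambda> s \<xi>N))"
  shows "1 \<le> Re (vinner (L2 K) D D)"
proof -
  note l = l2_left_translate[OF _ \<xi>N0_l2]
  have ll: "(\<lambda>(p, t). \<xi>N0 (p, k \<circ> (j \<circ> t))) \<in> l2_functions K"
    if "k \<in> carrier finitary_sym_group" "j \<in> carrier finitary_sym_group" for k j
    using l2_left_translate[OF that(2) l[OF that(1)]] by simp
  have \<Lambda>2: "\<Lambda> j (\<Lambda> k \<xi>N) = l2_class K (\<lambda>(p, t). \<xi>N0 (p, k \<circ> (j \<circ> t)))"
    if "k \<in> carrier finitary_sym_group" "j \<in> carrier finitary_sym_group" for k j
    unfolding \<xi>N_def \<Lambda>_apply[OF that(1) \<xi>N0_l2] \<Lambda>_apply[OF that(2) l[OF that(1)]] by simp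
  define d where "d = (\<lambda>(p, t). \<xi>N0 (p, s' \<circ> (s \<circ> t)) - \<xi>N0 (p, s \<circ> (s' \<circ> t)))"
  have d: "d \<in> l2_functions K"
    using l2_diff[OF ll[OF s'(1) s(1)] ll[OF s(1) s'(1)]] by (simp add: d_def split_beta')
  have D: "D = l2_class K d"
    unfolding D_def \<Lambda>2[OF s(1) s'(1)] \<Lambda>2[OF s'(1) s(1)] L2.vsub_def
      L2_vsub[OF ll[OF s'(1) s(1)] ll[OF s(1) s'(1)]]
    by (simp add: d_def split_beta')
  let ?t = "s \<circ> s'"
  have t: "?t \<in> carrier finitary_sym_group"
    using monoid.m_closed[OF group.is_monoid[OF group_finitary] s(1) s'(1)] by (simp add: finitary_mult)
  have e1: "s' \<circ> (s \<circ> ?t) = id"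
    using s(2) s'(2) by (metis comp_assoc id_comp)
  have e2: "s \<circ> (s' \<circ> ?t) \<noteq> id"
  proof
    assume "s \<circ> (s' \<circ> ?t) = id"
    then have "s' \<circ> (s \<circ> (s \<circ> (s' \<circ> ?t))) = s' \<circ> s" by simp
    then show False using ne s(2) s'(2) by (metis comp_assoc id_comp)
  qed
  have dt: "d (p, ?t) = \<xi>0 p" for p
    using e1 e2 by (simp add: d_def \<xi>N0_def)
  have "(1 :: ennreal) = (\<integral>\<^sup>+x. 1 \<partial>\<mu>)" by (simp add: emeasure_space_1)
  also have "\<dots> = (\<integral>\<^sup>+x. ennreal ((cmod (\<xi>0 (x, \<one>)))\<^sup>2) \<partial>\<mu>)" by (simp add: \<xi>0_def)
  also have "\<dots> = (\<integral>\<^sup>+p. ennreal ((cmod (\<xi>0 p))\<^sup>2) * indicator {\<one>} (snd p) \<partial>\<nu>)"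
    using l2_measurable[OF \<xi>0_l2] by (intro nn_integral_slice[OF countable, symmetric]) auto
  also have "\<dots> \<le> (\<integral>\<^sup>+p. ennreal ((cmod (\<xi>0 p))\<^sup>2) \<partial>\<nu>)"
    by (intro nn_integral_mono) (auto simp: indicator_def)
  also have "\<dots> = (\<integral>\<^sup>+p. ennreal ((cmod (d (p, ?t)))\<^sup>2) \<partial>\<nu>)" by (simp only: dt)
  also have "\<dots> = (\<integral>\<^sup>+q. ennreal ((cmod (d q))\<^sup>2) * indicator {?t} (snd q) \<partial>K)"
    using l2_measurable[OF d] by (intro nn_integral_slice[OF countable_finitary _ t, symmetric]) measurable
  also have "\<dots> \<le> (\<integral>\<^sup>+q. ennreal ((cmod (d q))\<^sup>2) \<partial>K)"
    by (intro nn_integral_mono) (auto simp: indicator_def)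
  finally have "1 \<le> (\<integral>q. (cmod (d q))\<^sup>2 \<partial>K)"
    unfolding l2_nn_integral[OF d] by simp
  then show ?thesis by (simp add: D L2_norm_sq[OF d])
qed

end

section \<open>Mass distributions of square integrable functions\<close>

text \<open>The measure with density \<open>|f|\<^sup>2\<close>.\<close>

definition mass :: "'a measure \<Rightarrow> ('a \<Rightarrow> complex) \<Rightarrow> 'a set \<Rightarrow> real" where
  "mass \<nu> f = measure (density \<nu> (\<lambda>p. ennreal ((cmod (f p))\<^sup>2)))"

lemma mass_integrable:
  assumes "f \<in> l2_functions \<nu>" "E \<in> sets \<nu>"
  shows "integrable \<nu> (\<lambda>p. (cmod (f p))\<^sup>2 * indicator E p)"
  using l2_integrable[OF assms(1)] assms(2) by (simp add: integrable_real_mult_indicator)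

lemma emeasure_l2_density:
  assumes f: "f \<in> l2_functions \<nu>" and E: "E \<in> sets \<nu>"
  shows "emeasure (density \<nu> (\<lambda>p. ennreal ((cmod (f p))\<^sup>2))) E
    = ennreal (\<integral>p. (cmod (f p))\<^sup>2 * indicator E p \<partial>\<nu>)"
proof -
  have "(\<lambda>p. ennreal ((cmod (f p))\<^sup>2)) \<in> borel_measurable \<nu>"
    using l2_measurable[OF f] by measurable
  then have "emeasure (density \<nu> (\<lambda>p. ennreal ((cmod (f p))\<^sup>2))) E
      = (\<integral>\<^sup>+p. ennreal ((cmod (f p))\<^sup>2) * indicator E p \<partial>\<nu>)"
    using E by (rule emeasure_density)
  also have "\<dots> = (\<integral>\<^sup>+p. ennreal ((cmod (f p))\<^sup>2 * indicator E p) \<partial>\<nu>)"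
    by (intro nn_integral_cong) (auto simp: indicator_def)
  also have "\<dots> = ennreal (\<integral>p. (cmod (f p))\<^sup>2 * indicator E p \<partial>\<nu>)"
    using mass_integrable[OF f E] by (intro nn_integral_eq_integral) auto
  finally show ?thesis .
qed

lemma mass_eq:
  assumes "f \<in> l2_functions \<nu>" "E \<in> sets \<nu>"
  shows "mass \<nu> f E = (\<integral>p. (cmod (f p))\<^sup>2 * indicator E p \<partial>\<nu>)"
  unfolding mass_def measure_def emeasure_l2_density[OF assms]
  by (intro enn2real_ennreal integral_nonneg_AE) simp

lemma mass_finite_measure:
  assumes "f \<in> l2_functions \<nu>"
  shows "finite_measure (density \<nu> (\<lambda>p. ennreal ((cmod (f p))\<^sup>2)))"
  by (rule finite_measureI) (simp add: emeasure_l2_density[OF assms sets.top])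

lemma mass_space:
  assumes "f \<in> l2_functions \<nu>"
  shows "mass \<nu> f (space \<nu>) = (\<integral>p. (cmod (f p))\<^sup>2 \<partial>\<nu>)"
  unfolding mass_eq[OF assms sets.top] by (rule Bochner_Integration.integral_cong) auto

lemma mass_union:
  assumes "f \<in> l2_functions \<nu>" "E \<in> sets \<nu>" "E' \<in> sets \<nu>" "E \<inter> E' = {}"
  shows "mass \<nu> f (E \<union> E') = mass \<nu> f E + mass \<nu> f E'"
  using finite_measure.finite_measure_Union[OF mass_finite_measure[OF assms(1)], of E E'] assms
  by (simp add: mass_def)

lemma mass_mono:
  assumes "f \<in> l2_functions \<nu>" "E' \<in> sets \<nu>" "E \<subseteq> E'"
  shows "mass \<nu> f E \<le> mass \<nu> f E'"
  using finite_measure.finite_measure_mono[OF mass_finite_measure[OF assms(1)] assms(3)] assms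
  by (simp add: mass_def)

lemma mass_nonneg: "0 \<le> mass \<nu> f E"
  by (simp add: mass_def)

lemma mass_preserving:
  assumes \<tau>: "preserving \<nu> \<tau>" and f: "f \<in> l2_functions \<nu>" and E: "E \<in> sets \<nu>" "E' \<in> sets \<nu>"
    and iff: "\<And>p. p \<in> space \<nu> \<Longrightarrow> \<tau> p \<in> E \<longleftrightarrow> p \<in> E'"
  shows "mass \<nu> (\<lambda>p. f (\<tau> p)) E' = mass \<nu> f E"
proof -
  have "(\<lambda>p. 1 * f (\<tau> p)) \<in> l2_functions \<nu>"
    by (rule l2_weighted_composition[OF \<tau> essentially_bounded_const f])
  then have "mass \<nu> (\<lambda>p. f (\<tau> p)) E' = (\<integral>p. (cmod (f (\<tau> p)))\<^sup>2 * indicator E' p \<partial>\<nu>)"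
    using E by (simp add: mass_eq)
  also have "\<dots> = (\<integral>p. (cmod (f (\<tau> p)))\<^sup>2 * indicator E (\<tau> p) \<partial>\<nu>)"
    using iff by (intro Bochner_Integration.integral_cong) (auto simp: indicator_def)
  also have "\<dots> = (\<integral>p. (cmod (f p))\<^sup>2 * indicator E p \<partial>\<nu>)"
    by (rule preserving_integral[OF \<tau> borel_measurable_integrable[OF mass_integrable[OF f E(1)]]])
  finally show ?thesis using f E by (simp add: mass_eq)
qed

lemma cmod_sq_diff_le:
  assumes "0 < (t::real)"
  shows "\<bar>(cmod a)\<^sup>2 - (cmod b)\<^sup>2\<bar> \<le> (cmod (a - b))\<^sup>2 / t + t * ((cmod a)\<^sup>2 + (cmod b)\<^sup>2)"
proof -
  define u v d where "u = cmod a" and "v = cmod b" and "d = cmod (a - b)"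
  have duv: "\<bar>u - v\<bar> \<le> d" unfolding u_def v_def d_def by (rule norm_triangle_ineq3)
  have nn: "0 \<le> u" "0 \<le> v" "0 \<le> d" by (auto simp: u_def v_def d_def)
  have "\<bar>u\<^sup>2 - v\<^sup>2\<bar> = \<bar>u - v\<bar> * (u + v)"
    using nn by (simp add: power2_eq_square square_diff_square_factored abs_mult)
  also have "\<dots> \<le> d * (u + v)" using duv nn by (intro mult_right_mono) auto
  also have "\<dots> \<le> d\<^sup>2 / t + t * (u\<^sup>2 + v\<^sup>2)"
  proof -
    have "2 * (t * d * (u + v)) \<le> d\<^sup>2 + t\<^sup>2 * (u + v)\<^sup>2"
      using sum_squares_bound[of d "t * (u + v)"] by (simp add: power_mult_distrib mult_ac)
    moreover have "t\<^sup>2 * (u + v)\<^sup>2 \<le> t\<^sup>2 * (2 * (u\<^sup>2 + v\<^sup>2))"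
      using sum_squares_bound[of u v] by (intro mult_left_mono) (auto simp: power2_sum)
    ultimately have "t * (d * (u + v)) \<le> d\<^sup>2 + t\<^sup>2 * (u\<^sup>2 + v\<^sup>2)"
    proof -
      have "2 * (t * (d * (u + v))) \<le> d\<^sup>2 + t\<^sup>2 * (u + v)\<^sup>2"
        using \<open>2 * (t * d * (u + v)) \<le> d\<^sup>2 + t\<^sup>2 * (u + v)\<^sup>2\<close> by (simp only: mult.assoc)
      moreover have "t\<^sup>2 * (u + v)\<^sup>2 \<le> 2 * (t\<^sup>2 * (u\<^sup>2 + v\<^sup>2))"
        using \<open>t\<^sup>2 * (u + v)\<^sup>2 \<le> t\<^sup>2 * (2 * (u\<^sup>2 + v\<^sup>2))\<close> by (simp only: mult.left_commute)
      moreover have "0 \<le> d\<^sup>2" by simp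
      ultimately show ?thesis by linarith
    qed
    also have "\<dots> = t * (d\<^sup>2 / t + t * (u\<^sup>2 + v\<^sup>2))"
      using assms by (simp add: field_simps power2_eq_square)
    finally show ?thesis using assms by simp
  qed
  finally show ?thesis by (simp add: u_def v_def d_def)
qed

text \<open>The parameter \<open>t\<close> balances the two error terms: masses of functions of bounded norm are close when the
  functions are.\<close>

lemma mass_diff_le:
  assumes f: "f \<in> l2_functions \<nu>" and g: "g \<in> l2_functions \<nu>" and E: "E \<in> sets \<nu>" and t: "0 < t"
  shows "\<bar>mass \<nu> f E - mass \<nu> g E\<bar> \<le> (\<integral>p. (cmod (f p - g p))\<^sup>2 \<partial>\<nu>) / t
    + t * ((\<integral>p. (cmod (f p))\<^sup>2 \<partial>\<nu>) + (\<integral>p. (cmod (g p))\<^sup>2 \<partial>\<nu>))"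
proof -
  note int = l2_integrable[OF f] l2_integrable[OF g] l2_integrable[OF l2_diff[OF f g]]
    mass_integrable[OF f E] mass_integrable[OF g E]
  have "mass \<nu> f E - mass \<nu> g E
      = (\<integral>p. (cmod (f p))\<^sup>2 * indicator E p - (cmod (g p))\<^sup>2 * indicator E p \<partial>\<nu>)"
    using f g E int by (simp add: mass_eq)
  also have "\<bar>\<dots>\<bar> \<le> (\<integral>p. \<bar>(cmod (f p))\<^sup>2 * indicator E p - (cmod (g p))\<^sup>2 * indicator E p\<bar> \<partial>\<nu>)"
    by (rule integral_abs_bound)
  also have "\<dots> \<le> (\<integral>p. (cmod (f p - g p))\<^sup>2 / t + t * ((cmod (f p))\<^sup>2 + (cmod (g p))\<^sup>2) \<partial>\<nu>)"
  proof (rule integral_mono)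
    fix p
    have "\<bar>(cmod (f p))\<^sup>2 * indicator E p - (cmod (g p))\<^sup>2 * indicator E p\<bar> \<le> \<bar>(cmod (f p))\<^sup>2 - (cmod (g p))\<^sup>2\<bar>"
      by (simp add: indicator_def)
    also have "\<dots> \<le> (cmod (f p - g p))\<^sup>2 / t + t * ((cmod (f p))\<^sup>2 + (cmod (g p))\<^sup>2)"
      by (rule cmod_sq_diff_le[OF t])
    finally show "\<bar>(cmod (f p))\<^sup>2 * indicator E p - (cmod (g p))\<^sup>2 * indicator E p\<bar>
        \<le> (cmod (f p - g p))\<^sup>2 / t + t * ((cmod (f p))\<^sup>2 + (cmod (g p))\<^sup>2)" .
  qed (use int in auto)
  also have "\<dots> = (\<integral>p. (cmod (f p - g p))\<^sup>2 \<partial>\<nu>) / t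
    + t * ((\<integral>p. (cmod (f p))\<^sup>2 \<partial>\<nu>) + (\<integral>p. (cmod (g p))\<^sup>2 \<partial>\<nu>))"
    using int by simp
  finally show ?thesis .
qed

lemma tendsto_zero_if_scaled_bound:
  fixes u d :: "nat \<Rightarrow> real"
  assumes d: "d \<longlonglongrightarrow> 0" and u: "\<And>n t. 0 < t \<Longrightarrow> \<bar>u n\<bar> \<le> d n / t + t * c" and c: "0 \<le> c"
  shows "u \<longlonglongrightarrow> 0"
proof (rule LIMSEQ_I)
  fix e :: real assume e: "0 < e"
  define t where "t = e / (2 * (c + 1))"
  have t: "0 < t" "t * c < e / 2" using e c by (auto simp: t_def field_simps)
  have "\<forall>\<^sub>F n in sequentially. d n < t * (e / 2)"
    by (rule order_tendstoD(2)[OF d]) (use t e in simp)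
  then obtain N where "\<And>n. N \<le> n \<Longrightarrow> d n < t * (e / 2)" by (auto simp: eventually_sequentially)
  then have "norm (u n - 0) < e" if "N \<le> n" for n
  proof -
    have "d n / t < e / 2" using \<open>\<And>n. N \<le> n \<Longrightarrow> d n < t * (e / 2)\<close>[OF that] t by (simp add: field_simps)
    then have "\<bar>u n\<bar> < e" using u[OF t(1), of n] t(2) by linarith
    then show ?thesis by simp
  qed
  then show "\<exists>N. \<forall>n\<ge>N. norm (u n - 0) < e" by blast
qed


section \<open>Central sequences of the crossed product\<close>

context crossed
begin

definition commutator where
  "commutator x z = L2.vsub \<nu> (x (z \<xi>)) (z (x \<xi>))"

definition isometric where
  "isometric x \<longleftrightarrow> (\<forall>F\<in>vecs (L2 \<nu>). Re (vinner (L2 \<nu>) (x F) (x F)) = Re (vinner (L2 \<nu>) F F))"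

text \<open>Sequences that are asymptotically central at the trace vector.\<close>

definition central where
  "central x \<longleftrightarrow> (\<forall>n. x n \<in> M \<and> isometric (x n)) \<and>
     (\<forall>z\<in>M. (\<lambda>n. Re (vinner (L2 \<nu>) (commutator (x n) z) (commutator (x n) z))) \<longlonglongrightarrow> 0)"

text \<open>The unitaries \<open>1 \<otimes> s\<^sub>n\<close> and \<open>1 \<otimes> s\<^sub>n\<^sub>+\<^sub>1\<close> asymptotically commute with the tensor product but not with each
  other. Normality of the isomorphism and of its inverse carries both facts to the crossed product.\<close>

lemma McDuff_central_sequences:
  assumes "star_isomorphic (L2 \<nu>) M (L2 K) N"
  shows "\<exists>x y. central x \<and> central y \<and>
    \<not> (\<lambda>n. Re (vinner (L2 \<nu>) (commutator (x n) (y n)) (commutator (x n) (y n)))) \<longlonglongrightarrow> 0"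
proof -
  obtain \<theta> where \<theta>: "star_iso (L2 \<nu>) M (L2 K) N \<theta>" using assms star_isomorphic_iff by blast
  interpret iso: vn_isomorphism "L2 \<nu>" "L2 K" M N \<theta>
    by unfold_locales (use M_vn N_vn \<theta> in auto)
  let ?\<psi> = "inv_into M \<theta>"
  interpret inv: vn_isomorphism "L2 K" "L2 \<nu>" N M ?\<psi> by (rule iso.vn_isomorphism_inverse)
  have \<theta>\<psi>: "\<theta> (?\<psi> T) = T" if "T \<in> N" for T
    using that iso.bij by (auto simp: bij_betw_def f_inv_into_f)
  have \<psi>\<theta>: "?\<psi> (\<theta> T) = T" if "T \<in> M" for T
    using that iso.bij by (auto simp: bij_betw_def)
  define X where "X k = ?\<psi> (\<Lambda> (adjacent k))" for k
  have adj: "adjacent k \<in> carrier finitary_sym_group" "adjacent k \<circ> adjacent k = id" for k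
    by (auto simp: transpose_in_finitary fun_eq_iff)
  have \<Lambda>N: "\<Lambda> (adjacent k) \<in> N" for k by (rule \<Lambda>_in_N[OF adj])
  have XM: "X k \<in> M" for k unfolding X_def by (rule inv.hom_mem[OF \<Lambda>N])
  have Xo: "X k \<in> bounded_ops (L2 \<nu>)" for k using L2.vn_ops[OF M_vn XM] .
  have isometry: "Re (vinner (L2 \<rho>) (x F) (x F)) = Re (vinner (L2 \<rho>) F F)"
    if "x \<in> bounded_ops (L2 \<rho>)" "op_mult (L2 \<rho>) (adjoint_op (L2 \<rho>) x) x = op_one (L2 \<rho>)"
      "F \<in> vecs (L2 \<rho>)" for x F and \<rho> :: "'r measure"
  proof -
    have "adjoint_op (L2 \<rho>) x (x F) = F"
      using that(2) L2.op_mult_apply[OF that(3), of "adjoint_op (L2 \<rho>) x" x] that(3)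
      by (simp add: L2.op_one_apply)
    then show ?thesis
      using L2.adjoint_inner[OF that(1,3) L2.op_closed[OF that(1,3)]] by simp
  qed
  have X1: "op_mult (L2 \<nu>) (adjoint_op (L2 \<nu>) (X k)) (X k) = op_one (L2 \<nu>)" for k
    using \<Lambda>_square[OF adj, of k] inv.hom_mult[OF L2.vn_closed(5)[OF N_vn \<Lambda>N] \<Lambda>N, of k k]
    by (simp add: X_def inv.hom_adjoint[OF \<Lambda>N] inv.hom_one)
  have X_iso: "Re (vinner (L2 \<nu>) (X k F) (X k F)) = Re (vinner (L2 \<nu>) F F)" if "F \<in> vecs (L2 \<nu>)" for k F
    by (rule isometry[OF Xo X1 that])
  have \<Lambda>_iso: "Re (vinner (L2 K) (\<Lambda> (adjacent k) F) (\<Lambda> (adjacent k) F)) = Re (vinner (L2 K) F F)"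
    if "F \<in> vecs (L2 K)" for k F
    by (rule isometry[OF \<Lambda>_ops[OF adj(1)] \<Lambda>_square[OF adj] that])
  have bound: "Re (vinner (L2 \<rho>) (L2.op_diff \<rho> (op_mult (L2 \<rho>) a b) (op_mult (L2 \<rho>) b a) F)
        (L2.op_diff \<rho> (op_mult (L2 \<rho>) a b) (op_mult (L2 \<rho>) b a) F)) \<le> 4 * C * Re (vinner (L2 \<rho>) F F)"
    if a: "a \<in> bounded_ops (L2 \<rho>)" "\<And>F. F \<in> vecs (L2 \<rho>) \<Longrightarrow> Re (vinner (L2 \<rho>) (a F) (a F)) = Re (vinner (L2 \<rho>) F F)"
      and b: "b \<in> bounded_ops (L2 \<rho>)" "\<And>F. F \<in> vecs (L2 \<rho>) \<Longrightarrow> Re (vinner (L2 \<rho>) (b F) (b F)) \<le> C * Re (vinner (L2 \<rho>) F F)"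
      and F: "F \<in> vecs (L2 \<rho>)" for a b C F and \<rho> :: "'r measure"
  proof -
    note v = L2.op_closed[OF a(1) F] L2.op_closed[OF b(1) F] L2.op_closed[OF a(1) L2.op_closed[OF b(1) F]]
      L2.op_closed[OF b(1) L2.op_closed[OF a(1) F]]
    have "Re (vinner (L2 \<rho>) (b (a F)) (b (a F))) \<le> C * Re (vinner (L2 \<rho>) F F)"
      using b(2)[OF v(1)] a(2)[OF F] by simp
    moreover have "Re (vinner (L2 \<rho>) (a (b F)) (a (b F))) \<le> C * Re (vinner (L2 \<rho>) F F)"
      using a(2)[OF v(2)] b(2)[OF F] by simp
    ultimately show ?thesis
      using L2.norm_sq_vsub_le[OF v(3,4)] F by (simp add: L2.op_diff_apply L2.op_mult_apply)
  qed
  have X_central: "(\<lambda>n. Re (vinner (L2 \<nu>) (commutator (X (k n)) z) (commutator (X (k n)) z))) \<longlonglongrightarrow> 0"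
    if z: "z \<in> M" and k: "filterlim k sequentially sequentially" for z and k :: "nat \<Rightarrow> nat"
  proof -
    define Y where "Y = \<theta> z"
    have Y: "Y \<in> N" "Y \<in> bounded_ops (L2 K)" "?\<psi> Y = z"
      using iso.hom_mem[OF z] L2.vn_ops[OF N_vn] \<psi>\<theta>[OF z] by (auto simp: Y_def)
    let ?\<Lambda> = "\<lambda>n. \<Lambda> (adjacent (k n))"
    let ?Z = "\<lambda>n. L2.op_diff K (op_mult (L2 K) (?\<Lambda> n) Y) (op_mult (L2 K) Y (?\<Lambda> n))"
    obtain C where C: "0 \<le> C" "\<And>F. F \<in> vecs (L2 K) \<Longrightarrow>
        Re (vinner (L2 K) (Y F) (Y F)) \<le> C * Re (vinner (L2 K) F F)"
      using L2.op_bound[OF Y(2)] by blast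
    have YL: "op_mult (L2 K) (?\<Lambda> n) Y \<in> N" "op_mult (L2 K) Y (?\<Lambda> n) \<in> N" for n
      using Y(1) \<Lambda>N by (auto intro: L2.vn_closed[OF N_vn])
    obtain f where f: "f \<in> l2_functions K" "Y \<xi>N = l2_class K f"
      using L2_vec_cases[OF L2.op_closed[OF Y(2) \<xi>N_in]] by blast
    have "(\<lambda>n. \<integral>q. (cmod ((\<lambda>(p, t). f (p, adjacent (k n) \<circ> t) - f (p, t \<circ> adjacent (k n))) q))\<^sup>2 \<partial>K) \<longlonglongrightarrow> 0"
    proof (rule conjugation_tendsto[OF f(1) adj])
      show "\<forall>\<^sub>F n in sequentially. t \<circ> adjacent (k n) = adjacent (k n) \<circ> t"
        if "t \<in> carrier finitary_sym_group" for t
        using finitary_eventually_commutes[OF that] k by (rule eventually_compose_filterlim)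
    qed
    moreover have "Re (vinner (L2 K) (?Z n \<xi>N) (?Z n \<xi>N))
        = (\<integral>q. (cmod ((\<lambda>(p, t). f (p, adjacent (k n) \<circ> t) - f (p, t \<circ> adjacent (k n))) q))\<^sup>2 \<partial>K)" for n
    proof -
      note c = \<Lambda>_commutator[OF adj Y(1) f(2,1), of "k n"]
      have "?Z n \<xi>N = l2_class K (\<lambda>(p, t). f (p, adjacent (k n) \<circ> t) - f (p, t \<circ> adjacent (k n)))"
        using c(1) \<xi>N_in by (simp add: L2.op_diff_apply L2.op_mult_apply)
      moreover have "(\<lambda>(p, t). f (p, adjacent (k n) \<circ> t) - f (p, t \<circ> adjacent (k n))) \<in> l2_functions K"
        using l2_diff[OF c(2,3)] by (simp add: split_beta')
      ultimately show ?thesis by (simp only: L2_norm_sq)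
    qed
    ultimately have lim: "(\<lambda>n. Re (vinner (L2 K) (?Z n \<xi>N) (?Z n \<xi>N))) \<longlonglongrightarrow> 0" by simp
    have "(\<lambda>n. Re (vinner (L2 \<nu>) (?\<psi> (?Z n) \<xi>) (?\<psi> (?Z n) \<xi>))) \<longlonglongrightarrow> 0"
    proof (rule inv.hom_normal[where z = ?Z, OF \<xi>N_in \<xi>N_separating _ _ _ lim \<xi>_in])
      show "?Z n \<in> N" for n using YL by (intro L2.vn_diff[OF N_vn])
      show "0 \<le> 4 * C" using C(1) by simp
      show "Re (vinner (L2 K) (?Z n F) (?Z n F)) \<le> 4 * C * Re (vinner (L2 K) F F)"
        if "F \<in> vecs (L2 K)" for n F
        by (rule bound[OF \<Lambda>_ops[OF adj(1)] \<Lambda>_iso Y(2) C(2) that])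
    qed
    moreover have "?\<psi> (?Z n) \<xi> = commutator (X (k n)) z" for n
      using inv.hom_diff[OF YL] inv.hom_mult[OF \<Lambda>N Y(1)] inv.hom_mult[OF Y(1) \<Lambda>N] \<xi>_in
      by (simp add: Y(3) X_def commutator_def L2.op_diff_apply L2.op_mult_apply)
    ultimately show ?thesis by simp
  qed
  have "central X"
    unfolding central_def isometric_def using XM X_iso X_central[OF _ filterlim_ident] by auto
  moreover have "central (\<lambda>n. X (Suc n))"
    unfolding central_def isometric_def using XM X_iso X_central[OF _ filterlim_Suc] by auto
  moreover have "\<not> (\<lambda>n. Re (vinner (L2 \<nu>) (commutator (X n) (X (Suc n))) (commutator (X n) (X (Suc n))))) \<longlonglongrightarrow> 0"
  proof
    assume lim: "(\<lambda>n. Re (vinner (L2 \<nu>) (commutator (X n) (X (Suc n))) (commutator (X n) (X (Suc n))))) \<longlonglongrightarrow> 0"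
    let ?Z = "\<lambda>n. L2.op_diff \<nu> (op_mult (L2 \<nu>) (X n) (X (Suc n))) (op_mult (L2 \<nu>) (X (Suc n)) (X n))"
    have XX: "op_mult (L2 \<nu>) (X j) (X k) \<in> M" for j k
      using XM by (intro L2.vn_closed[OF M_vn])
    have Z\<xi>: "?Z n \<xi> = commutator (X n) (X (Suc n))" for n
      using \<xi>_in by (simp add: commutator_def L2.op_diff_apply L2.op_mult_apply)
    have "(\<lambda>n. Re (vinner (L2 K) (\<theta> (?Z n) \<xi>N) (\<theta> (?Z n) \<xi>N))) \<longlonglongrightarrow> 0"
    proof (rule iso.hom_normal[where z = ?Z, OF \<xi>_in \<xi>_separating _ _ _ _ \<xi>N_in])
      show "?Z n \<in> M" for n using XX by (intro L2.vn_diff[OF M_vn])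
      show "0 \<le> 4 * (1 :: real)" by simp
      show "Re (vinner (L2 \<nu>) (?Z n F) (?Z n F)) \<le> 4 * 1 * Re (vinner (L2 \<nu>) F F)"
        if "F \<in> vecs (L2 \<nu>)" for n F
        by (rule bound[OF Xo X_iso Xo _ that]) (use X_iso in auto)
      show "(\<lambda>n. Re (vinner (L2 \<nu>) (?Z n \<xi>) (?Z n \<xi>))) \<longlonglongrightarrow> 0" using lim unfolding Z\<xi> .
    qed
    moreover have "1 \<le> Re (vinner (L2 K) (\<theta> (?Z n) \<xi>N) (\<theta> (?Z n) \<xi>N))" for n
    proof -
      have "\<theta> (X j) = \<Lambda> (adjacent j)" for j unfolding X_def by (rule \<theta>\<psi>[OF \<Lambda>N])
      then have "\<theta> (?Z n) \<xi>N = L2.vsub K (\<Lambda> (adjacent n) (\<Lambda> (adjacent (Suc n)) \<xi>N))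
          (\<Lambda> (adjacent (Suc n)) (\<Lambda> (adjacent n) \<xi>N))"
        using iso.hom_diff[OF XX XX] iso.hom_mult[OF XM XM] \<xi>N_in
        by (simp add: L2.op_diff_apply L2.op_mult_apply)
      then show ?thesis
        using \<Lambda>_not_commuting[OF adj adj adjacent_not_commute] by simp
    qed
    ultimately have "(1 :: real) \<le> 0" by (intro LIMSEQ_le_const) auto
    then show False by simp
  qed
  ultimately show ?thesis by (intro exI[of _ X] exI[of _ "\<lambda>n. X (Suc n)"]) simp
qed

end

subsection \<open>Fourier coefficients of isometries\<close>

context crossed
begin

text \<open>The function \<open>eta x (\<cdot>, h)\<close> is the Fourier coefficient \<open>E(x u\<^sub>h\<^sup>*)\<close> of \<open>x\<close>, where \<open>E\<close> is the
  conditional expectation onto \<open>L\<^sup>\<infinity>(X)\<close>.\<close>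

definition eta where "eta x = l2_rep (x \<xi>)"

lemma eta_l2: "x \<in> M \<Longrightarrow> eta x \<in> l2_functions \<nu>" and eta_class: "x \<in> M \<Longrightarrow> l2_class \<nu> (eta x) = x \<xi>"
  using L2_rep[OF L2.op_closed[OF L2.vn_ops[OF M_vn] \<xi>_in]] by (auto simp: eta_def)

lemma rectangle_sets: "\<lbrakk>B \<in> sets \<mu>; A \<subseteq> carrier G\<rbrakk> \<Longrightarrow> B \<times> A \<in> sets \<nu>"
  by (intro pair_measureI) auto

lemma slice_mass:
  assumes f: "f \<in> l2_functions \<nu>" and B: "B \<in> sets \<mu>" and h: "h \<in> carrier G"
  shows "mass \<nu> f (B \<times> {h}) = (\<integral>t. (cmod (f (t, h)))\<^sup>2 * indicator B t \<partial>\<mu>)"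
proof -
  have E: "B \<times> {h} \<in> sets \<nu>" using B h by (intro rectangle_sets) auto
  have fh: "(\<lambda>t. f (t, h)) \<in> l2_functions \<mu>" by (rule l2_section[OF countable f h])
  have m: "(\<lambda>p. ennreal ((cmod (f p))\<^sup>2 * indicator B (fst p))) \<in> borel_measurable \<nu>"
    using l2_measurable[OF f] B by measurable
  have "ennreal (mass \<nu> f (B \<times> {h})) = (\<integral>\<^sup>+p. ennreal ((cmod (f p))\<^sup>2 * indicator (B \<times> {h}) p) \<partial>\<nu>)"
    unfolding mass_eq[OF f E] using mass_integrable[OF f E]
    by (intro nn_integral_eq_integral[symmetric]) auto
  also have "\<dots> = (\<integral>\<^sup>+p. ennreal ((cmod (f p))\<^sup>2 * indicator B (fst p)) * indicator {h} (snd p) \<partial>\<nu>)"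
    by (intro nn_integral_cong) (auto simp: indicator_def)
  also have "\<dots> = (\<integral>\<^sup>+t. ennreal ((cmod (f (t, h)))\<^sup>2 * indicator B t) \<partial>\<mu>)"
    using nn_integral_slice[OF countable m h] by simp
  also have "\<dots> = ennreal (\<integral>t. (cmod (f (t, h)))\<^sup>2 * indicator B t \<partial>\<mu>)"
    using mass_integrable[OF fh B] by (intro nn_integral_eq_integral) auto
  finally show ?thesis by (simp add: mass_nonneg)
qed

lemma mul_\<xi>_class:
  assumes a: "a \<in> essentially_bounded \<mu>"
  shows "mul a \<xi> = l2_class \<nu> (\<lambda>p. a (fst p) * \<xi>0 p)" and "(\<lambda>p. a (fst p) * \<xi>0 p) \<in> l2_functions \<nu>"
  unfolding mul_def \<xi>_def
  using wcomp_apply[OF preserving_id \<xi>0_l2]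
    l2_weighted_composition[OF preserving_id essentially_bounded_fst[OF \<gamma> a] \<xi>0_l2] by auto

lemma mul_\<xi>_norm:
  assumes a: "a \<in> essentially_bounded \<mu>"
  shows "Re (vinner (L2 \<nu>) (mul a \<xi>) (mul a \<xi>)) = (\<integral>t. (cmod (a t))\<^sup>2 \<partial>\<mu>)"
proof -
  let ?f = "\<lambda>p. a (fst p) * \<xi>0 p"
  note f = mul_\<xi>_class[OF a]
  have one: "\<one> \<in> carrier G" by simp
  have "Re (vinner (L2 \<nu>) (mul a \<xi>) (mul a \<xi>)) = (\<integral>p. (cmod (?f p))\<^sup>2 \<partial>\<nu>)"
    unfolding f(1) by (rule L2_norm_sq[OF f(2)])
  also have "\<dots> = (\<integral>p. (cmod (?f p))\<^sup>2 * indicator (space \<mu> \<times> {\<one>}) p \<partial>\<nu>)"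
    by (intro Bochner_Integration.integral_cong) (auto simp: space_\<nu> \<xi>0_def indicator_def)
  also have "\<dots> = mass \<nu> ?f (space \<mu> \<times> {\<one>})"
    by (intro mass_eq[symmetric] f(2) rectangle_sets) auto
  also have "\<dots> = (\<integral>t. (cmod (a t))\<^sup>2 \<partial>\<mu>)"
    unfolding slice_mass[OF f(2) sets.top one]
    by (intro Bochner_Integration.integral_cong) (auto simp: \<xi>0_def)
  finally show ?thesis .
qed

lemma \<xi>_norm: "Re (vinner (L2 \<nu>) \<xi> \<xi>) = 1"
proof -
  have "mul (\<lambda>_. 1) \<xi> = \<xi>" unfolding mul_def by (rule wcomp_one_id[OF \<xi>_in])
  then show ?thesis using mul_\<xi>_norm[OF essentially_bounded_const[of 1]] by (simp add: prob_space)
qed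

lemma eta_norm:
  assumes "x \<in> M" "isometric x" shows "(\<integral>p. (cmod (eta x p))\<^sup>2 \<partial>\<nu>) = 1"
proof -
  have "(\<integral>p. (cmod (eta x p))\<^sup>2 \<partial>\<nu>) = Re (vinner (L2 \<nu>) (x \<xi>) (x \<xi>))"
    unfolding eta_class[OF assms(1), symmetric] by (rule L2_norm_sq[OF eta_l2[OF assms(1)], symmetric])
  also have "\<dots> = 1" using assms(2) \<xi>_in \<xi>_norm by (simp add: isometric_def)
  finally show ?thesis .
qed

lemma rmult_eta:
  assumes x: "x \<in> M" and a: "a \<in> essentially_bounded \<mu>" and g: "g \<in> carrier G"
  shows "x (rmult a g \<xi>) = l2_class \<nu> (\<lambda>p. weight a p * eta x (right g p))"
    and "(\<lambda>p. weight a p * eta x (right g p)) \<in> l2_functions \<nu>"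
proof -
  have "x (rmult a g \<xi>) = rmult a g (x \<xi>)" using L2.commutantD[OF rmult_commutant[OF a g] x \<xi>_in] by simp
  also have "\<dots> = l2_class \<nu> (\<lambda>p. weight a p * eta x (right g p))"
    unfolding eta_class[OF x, symmetric] rmult_def by (rule wcomp_apply[OF right_preserving[OF g] eta_l2[OF x]])
  finally show "x (rmult a g \<xi>) = l2_class \<nu> (\<lambda>p. weight a p * eta x (right g p))" .
  show "(\<lambda>p. weight a p * eta x (right g p)) \<in> l2_functions \<nu>"
    by (rule l2_weighted_composition[OF right_preserving[OF g] weight_bounded[OF a] eta_l2[OF x]])
qed

lemma right_one: "p \<in> space \<nu> \<Longrightarrow> right \<one> p = p"
  by (auto simp: space_\<nu>)

lemma indicator_bounded: "B \<in> sets \<mu> \<Longrightarrow> (indicator B :: 'x \<Rightarrow> complex) \<in> essentially_bounded \<mu>"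
  by (auto simp: essentially_bounded_def intro!: exI[of _ 1] AE_I2 split: split_indicator)

text \<open>The Fourier coefficients of an isometry in the crossed product are functions bounded by \<open>1\<close>,
  because cutting \<open>x \<xi>\<close> by the function \<open>1\<^sub>B\<close> on the right amounts to applying \<open>x\<close> to a vector
  of square norm \<open>\<mu>(B)\<close>.\<close>

lemma eta_mass_le:
  assumes x: "x \<in> M" "isometric x" and B: "B \<in> sets \<mu>" and h: "h \<in> carrier G"
  shows "mass \<nu> (eta x) (B \<times> {h}) \<le> measure \<mu> B"
proof -
  define a where "a t = (indicator B (\<phi> h t) :: complex)" for t
  have a: "a \<in> essentially_bounded \<mu>"
    unfolding a_def by (rule essentially_bounded_preserving[OF \<phi>_preserving[OF h] indicator_bounded[OF B]])
  let ?f = "\<lambda>p. weight a p * eta x (right \<one> p)"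
  note c = rmult_eta[OF x(1) a one_closed]
  have E: "B \<times> {h} \<in> sets \<nu>" using B h by (intro rectangle_sets) auto
  have "mass \<nu> (eta x) (B \<times> {h}) = (\<integral>p. (cmod (eta x p))\<^sup>2 * indicator (B \<times> {h}) p \<partial>\<nu>)"
    by (rule mass_eq[OF eta_l2[OF x(1)] E])
  also have "\<dots> \<le> (\<integral>p. (cmod (?f p))\<^sup>2 \<partial>\<nu>)"
  proof (rule integral_mono_AE[OF mass_integrable[OF eta_l2[OF x(1)] E] l2_integrable[OF c(2)]], rule AE_I2)
    fix p assume "p \<in> space \<nu>"
    then obtain t k where p: "p = (t, k)" "t \<in> space \<mu>" "k \<in> carrier G"
      by (cases p) (auto simp: space_\<nu>)
    show "(cmod (eta x p))\<^sup>2 * indicator (B \<times> {h}) p \<le> (cmod (?f p))\<^sup>2"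
      using p h by (auto simp: indicator_def weight_def a_def \<phi>_mult \<phi>_one)
  qed
  also have "\<dots> = Re (vinner (L2 \<nu>) (x (rmult a \<one> \<xi>)) (x (rmult a \<one> \<xi>)))"
    unfolding c(1) by (rule L2_norm_sq[OF c(2), symmetric])
  also have "\<dots> = Re (vinner (L2 \<nu>) (mul a \<xi>) (mul a \<xi>))"
    using x(2) L2.op_closed[OF rmult_ops[OF a one_closed] \<xi>_in] by (simp add: isometric_def mul_\<xi>)
  also have "\<dots> = (\<integral>t. (cmod (a t))\<^sup>2 \<partial>\<mu>)" by (rule mul_\<xi>_norm[OF a])
  also have "\<dots> = (\<integral>t. indicator B (\<phi> h t) \<partial>\<mu>)"
    by (intro Bochner_Integration.integral_cong) (auto simp: a_def indicator_def)
  also have "\<dots> = (\<integral>t. indicator B t \<partial>\<mu>)"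
    using preserving_integral[OF \<phi>_preserving[OF h], of "indicator B :: 'x \<Rightarrow> real"] B by simp
  also have "\<dots> = measure \<mu> B" using B by simp
  finally show ?thesis .
qed

lemma eta_slice_bounded:
  assumes x: "x \<in> M" "isometric x" and h: "h \<in> carrier G"
  shows "AE t in \<mu>. cmod (eta x (t, h)) \<le> 1"
proof -
  let ?k = "\<lambda>t. (cmod (eta x (t, h)))\<^sup>2"
  have fh: "(\<lambda>t. eta x (t, h)) \<in> l2_functions \<mu>" by (rule l2_section[OF countable eta_l2[OF x(1)] h])
  have km: "?k \<in> borel_measurable \<mu>" using l2_integrable[OF fh] by (rule borel_measurable_integrable)
  define B where "B = {t \<in> space \<mu>. 1 < ?k t}"
  have B: "B \<in> sets \<mu>" unfolding B_def using km by measurable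
  note int = mass_integrable[OF fh B]
  have ind: "integrable \<mu> (indicator B :: 'x \<Rightarrow> real)" using B by (simp add: integrable_indicator_iff less_top[symmetric])
  have "(\<integral>t. ?k t * indicator B t \<partial>\<mu>) \<le> (\<integral>t. indicator B t \<partial>\<mu>)"
    using eta_mass_le[OF x B h] slice_mass[OF eta_l2[OF x(1)] B h] B by simp
  then have "(\<integral>t. ?k t * indicator B t - indicator B t \<partial>\<mu>) \<le> 0"
    using Bochner_Integration.integral_diff[OF int ind] by simp
  moreover have nonneg: "AE t in \<mu>. 0 \<le> ?k t * indicator B t - indicator B t"
    by (rule AE_I2) (auto simp: B_def indicator_def)
  ultimately have "(\<integral>t. ?k t * indicator B t - indicator B t \<partial>\<mu>) = 0"
    using integral_nonneg_AE[OF nonneg] by simp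
  then have "AE t in \<mu>. ?k t * indicator B t - indicator B t = 0"
    using integral_nonneg_eq_0_iff_AE[OF Bochner_Integration.integrable_diff[OF int ind] nonneg] by simp
  with AE_space show ?thesis
  proof eventually_elim
    case (elim t)
    then have "?k t \<le> 1" by (auto simp: B_def indicator_def split: if_splits)
    then show ?case by (simp add: power_le_one_iff)
  qed
qed


subsection \<open>Asymptotic conjugation invariance\<close>

text \<open>At the trace vector, \<open>x u\<^sub>g - u\<^sub>g x\<close> is the difference of a right and a left translate of the function of
  \<open>x\<close>. Left translation by \<open>g\<close> sends the mass of \<open>A\<close> to \<open>g A\<close>, right translation sends the mass of
  \<open>g A g\<^sup>-\<^sup>1\<close> there.\<close>

lemma central_mass_conjugation:
  assumes x: "central x" and g: "g \<in> carrier G" and A: "A \<subseteq> carrier G"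
  shows "(\<lambda>n. mass \<nu> (eta (x n)) (space \<mu> \<times> (\<lambda>h. g \<otimes> h \<otimes> inv g) ` A)
    - mass \<nu> (eta (x n)) (space \<mu> \<times> A)) \<longlonglongrightarrow> 0"
proof -
  have xM: "x n \<in> M" "isometric (x n)" for n using x by (auto simp: central_def)
  have gi: "inv g \<in> carrier G" using g by simp
  let ?\<tau> = "map_prod (\<phi> (inv g)) (\<lambda>h. inv g \<otimes> h)"
  define \<alpha> where "\<alpha> n p = eta (x n) (right (inv g) p)" for n p
  define \<beta> where "\<beta> n p = eta (x n) (?\<tau> p)" for n p
  have \<alpha>l2: "\<alpha> n \<in> l2_functions \<nu>" and \<beta>l2: "\<beta> n \<in> l2_functions \<nu>" for n
    using l2_weighted_composition[OF right_preserving[OF gi] essentially_bounded_const[of 1] eta_l2[OF xM(1)]]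
      l2_weighted_composition[OF U_preserving[OF g] essentially_bounded_const[of 1] eta_l2[OF xM(1)]]
    by (auto simp: \<alpha>_def[abs_def] \<beta>_def[abs_def])
  have norms: "(\<integral>p. (cmod (\<alpha> n p))\<^sup>2 \<partial>\<nu>) = 1" "(\<integral>p. (cmod (\<beta> n p))\<^sup>2 \<partial>\<nu>) = 1" for n
    using preserving_integral[OF right_preserving[OF gi], of "\<lambda>p. (cmod (eta (x n) p))\<^sup>2"]
      preserving_integral[OF U_preserving[OF g], of "\<lambda>p. (cmod (eta (x n) p))\<^sup>2"]
      borel_measurable_integrable[OF l2_integrable[OF eta_l2[OF xM(1)]]] eta_norm[OF xM]
    by (auto simp: \<alpha>_def \<beta>_def)
  have comm: "commutator (x n) (U g) = l2_class \<nu> (\<lambda>p. \<alpha> n p - \<beta> n p)" for n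
  proof -
    have "x n (U g \<xi>) = l2_class \<nu> (\<alpha> n)"
      unfolding U_\<xi>[OF g] rmult_eta(1)[OF xM(1) essentially_bounded_const gi]
      by (intro l2_class_cong AE_I2) (auto simp: \<alpha>_def weight_def)
    moreover have "U g (x n \<xi>) = l2_class \<nu> (\<beta> n)"
      unfolding eta_class[OF xM(1), symmetric] U_def wcomp_apply[OF U_preserving[OF g] eta_l2[OF xM(1)]]
      by (simp add: \<beta>_def[abs_def])
    ultimately show ?thesis by (simp add: commutator_def L2.vsub_def L2_vsub \<alpha>l2 \<beta>l2)
  qed
  have d: "(\<lambda>n. \<integral>p. (cmod (\<alpha> n p - \<beta> n p))\<^sup>2 \<partial>\<nu>) \<longlonglongrightarrow> 0"
  proof -
    have "(\<lambda>n. Re (vinner (L2 \<nu>) (commutator (x n) (U g)) (commutator (x n) (U g)))) \<longlonglongrightarrow> 0"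
      using x U_in_M[OF g] by (simp add: central_def)
    then show ?thesis unfolding comm L2_norm_sq[OF l2_diff[OF \<alpha>l2 \<beta>l2]] .
  qed
  let ?V = "(\<lambda>h. g \<otimes> h) ` A" and ?W = "(\<lambda>h. g \<otimes> h \<otimes> inv g) ` A"
  have V: "?V \<subseteq> carrier G" "?W \<subseteq> carrier G" using A g by auto
  note sets = rectangle_sets[OF sets.top V(1)] rectangle_sets[OF sets.top V(2)] rectangle_sets[OF sets.top A]
  have m1: "mass \<nu> (\<alpha> n) (space \<mu> \<times> ?V) = mass \<nu> (eta (x n)) (space \<mu> \<times> ?W)" for n
    unfolding \<alpha>_def
  proof (rule mass_preserving[OF right_preserving[OF gi] eta_l2[OF xM(1)] sets(2,1)])
    fix p assume "p \<in> space \<nu>"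
    then obtain t h where p: "p = (t, h)" "t \<in> space \<mu>" "h \<in> carrier G"
      by (cases p) (auto simp: space_\<nu>)
    have "h \<otimes> inv g \<in> ?W \<longleftrightarrow> h \<in> ?V"
    proof
      assume "h \<otimes> inv g \<in> ?W"
      then obtain k where k: "k \<in> A" "h \<otimes> inv g = g \<otimes> k \<otimes> inv g" by blast
      then have "h = g \<otimes> k" using p(3) g A by (metis right_cancel gi m_closed subsetD)
      then show "h \<in> ?V" using k by blast
    qed (auto intro: imageI)
    then show "right (inv g) p \<in> space \<mu> \<times> ?W \<longleftrightarrow> p \<in> space \<mu> \<times> ?V" using p by simp
  qed
  have m2: "mass \<nu> (\<beta> n) (space \<mu> \<times> ?V) = mass \<nu> (eta (x n)) (space \<mu> \<times> A)" for n
    unfolding \<beta>_def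
  proof (rule mass_preserving[OF U_preserving[OF g] eta_l2[OF xM(1)] sets(3,1)])
    fix p assume "p \<in> space \<nu>"
    then obtain t h where p: "p = (t, h)" "t \<in> space \<mu>" "h \<in> carrier G"
      by (cases p) (auto simp: space_\<nu>)
    have "inv g \<otimes> h \<in> A \<longleftrightarrow> h \<in> ?V"
    proof
      assume "inv g \<otimes> h \<in> A"
      moreover have "h = g \<otimes> (inv g \<otimes> h)" using p(3) g by (simp flip: m_assoc)
      ultimately show "h \<in> ?V" by blast
    next
      assume "h \<in> ?V"
      then obtain k where "k \<in> A" "h = g \<otimes> k" by blast
      then show "inv g \<otimes> h \<in> A" using g A by (auto simp flip: m_assoc simp: subset_eq)
    qed
    then show "?\<tau> p \<in> space \<mu> \<times> A \<longleftrightarrow> p \<in> space \<mu> \<times> ?V" using p gi by (simp add: \<phi>_in)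
  qed
  show ?thesis
  proof (rule tendsto_zero_if_scaled_bound[OF d])
    fix n t assume "0 < (t::real)"
    then show "\<bar>mass \<nu> (eta (x n)) (space \<mu> \<times> ?W) - mass \<nu> (eta (x n)) (space \<mu> \<times> A)\<bar>
        \<le> (\<integral>p. (cmod (\<alpha> n p - \<beta> n p))\<^sup>2 \<partial>\<nu>) / t + t * 2"
      using mass_diff_le[OF \<alpha>l2 \<beta>l2 sets(1), of t n n] norms by (simp add: m1 m2)
  qed simp
qed


subsection \<open>Freeness moves central sequences away from nontrivial group elements\<close>

text \<open>The commutator with \<open>1\<^sub>B\<close> multiplies the Fourier coefficient at \<open>h\<close> by the function
  \<open>1\<^sub>B(h\<^sup>-\<^sup>1 t) - 1\<^sub>B(t)\<close>, which has absolute value \<open>1\<close> on \<open>E\<close>.\<close>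

lemma central_mass_moved:
  assumes x: "central x" and B: "B \<in> sets \<mu>" and h: "h \<in> carrier G"
  defines "E \<equiv> {t \<in> space \<mu>. t \<in> B \<longleftrightarrow> \<phi> (inv h) t \<notin> B}"
  shows "E \<in> sets \<mu>" and "(\<lambda>n. mass \<nu> (eta (x n)) (E \<times> {h})) \<longlonglongrightarrow> 0"
proof -
  have "\<phi> (inv h) \<in> measurable \<mu> \<mu>" using \<phi>_preserving[of "inv h"] h by (simp add: preserving_def)
  then show E: "E \<in> sets \<mu>" unfolding E_def using B by measurable
  have xM: "x n \<in> M" for n using x by (auto simp: central_def)
  define a where "a = (indicator B :: 'x \<Rightarrow> complex)"
  have a: "a \<in> essentially_bounded \<mu>" unfolding a_def by (rule indicator_bounded[OF B])
  define d where "d n p = weight a p * eta (x n) (right \<one> p) - a (fst p) * eta (x n) p" for n p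
  note c = rmult_eta[OF xM a one_closed]
  have ml2: "(\<lambda>p. a (fst p) * eta (x n) p) \<in> l2_functions \<nu>" for n
    by (rule l2_weighted_composition[OF preserving_id essentially_bounded_fst[OF \<gamma> a] eta_l2[OF xM]])
  have mc: "mul a (x n \<xi>) = l2_class \<nu> (\<lambda>p. a (fst p) * eta (x n) p)" for n
    unfolding eta_class[OF xM, symmetric] mul_def by (rule wcomp_apply[OF preserving_id eta_l2[OF xM]])
  have dl2: "d n \<in> l2_functions \<nu>" for n using l2_diff[OF c(2) ml2] by (simp add: d_def[abs_def])
  have "commutator (x n) (mul a) = l2_class \<nu> (d n)" for n
    unfolding commutator_def mul_\<xi> c(1) mc L2.vsub_def L2_vsub[OF c(2) ml2] by (simp add: d_def[abs_def])
  moreover have "(\<lambda>n. Re (vinner (L2 \<nu>) (commutator (x n) (mul a)) (commutator (x n) (mul a)))) \<longlonglongrightarrow> 0"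
    using x mul_in_M[OF a] by (simp add: central_def)
  ultimately have lim: "(\<lambda>n. \<integral>p. (cmod (d n p))\<^sup>2 \<partial>\<nu>) \<longlonglongrightarrow> 0"
    by (simp add: L2_norm_sq[OF dl2])
  have Es: "E \<times> {h} \<in> sets \<nu>" using E h by (intro rectangle_sets) auto
  have le: "mass \<nu> (eta (x n)) (E \<times> {h}) \<le> (\<integral>p. (cmod (d n p))\<^sup>2 \<partial>\<nu>)" for n
    unfolding mass_eq[OF eta_l2[OF xM] Es]
  proof (rule integral_mono_AE[OF mass_integrable[OF eta_l2[OF xM] Es] l2_integrable[OF dl2]], rule AE_I2)
    fix p assume "p \<in> space \<nu>"
    then obtain t k where p: "p = (t, k)" "t \<in> space \<mu>" "k \<in> carrier G"
      by (cases p) (auto simp: space_\<nu>)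
    show "(cmod (eta (x n) p))\<^sup>2 * indicator (E \<times> {h}) p \<le> (cmod (d n p))\<^sup>2"
    proof (cases "p \<in> E \<times> {h}")
      case True
      then show ?thesis using p
        by (cases "t \<in> B") (auto simp: d_def a_def weight_def E_def)
    qed simp
  qed
  show "(\<lambda>n. mass \<nu> (eta (x n)) (E \<times> {h})) \<longlonglongrightarrow> 0"
  proof (rule Lim_null_comparison[OF _ lim], rule always_eventually, rule allI)
    fix n show "norm (mass \<nu> (eta (x n)) (E \<times> {h})) \<le> (\<integral>p. (cmod (d n p))\<^sup>2 \<partial>\<nu>)"
      using le[of n] mass_nonneg[of \<nu> "eta (x n)"] by simp
  qed
qed

text \<open>A countable base separates \<open>t\<close> from \<open>h\<^sup>-\<^sup>1 t\<close>, so countably many of the sets of the previous lemma,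
  and up to small measure finitely many, cover the points that \<open>h\<close> moves. The remainder carries little mass,
  because the Fourier coefficients are bounded by \<open>1\<close>.\<close>

lemma central_mass_singleton:
  assumes x: "central x" and free: "essentially_free G \<mu> \<phi>" and h: "h \<in> carrier G" "h \<noteq> \<one>"
  shows "(\<lambda>n. mass \<nu> (eta (x n)) (space \<mu> \<times> {h})) \<longlonglongrightarrow> 0"
proof -
  have xM: "x n \<in> M" "isometric (x n)" for n using x by (auto simp: central_def)
  obtain T where T: "completely_metrizable_space T" "second_countable T" "topspace T = space \<mu>"
      "sets \<mu> = sigma_sets (topspace T) {U. openin T U}"
    using pmp by (auto simp: pmp_action_def standard_prob_space_def)
  obtain \<B> where \<B>: "countable \<B>" "\<And>V. V \<in> \<B> \<Longrightarrow> openin T V"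
      "\<And>U x. \<lbrakk>openin T U; x \<in> U\<rbrakk> \<Longrightarrow> \<exists>V\<in>\<B>. x \<in> V \<and> V \<subseteq> U"
    using T(2) unfolding second_countable_def by metis
  obtain x0 where "x0 \<in> space \<mu>" using not_empty by blast
  then have ne: "\<B> \<noteq> {}" using \<B>(3)[OF openin_topspace, of x0] T(3) by blast
  define E where "E i = {t \<in> space \<mu>. t \<in> from_nat_into \<B> i \<longleftrightarrow> \<phi> (inv h) t \<notin> from_nat_into \<B> i}"
    for i :: nat
  have Bs: "from_nat_into \<B> i \<in> sets \<mu>" for i
    unfolding T(4) using \<B>(2)[OF from_nat_into[OF ne]] by (intro sigma_sets.Basic) simp
  have Es: "E i \<in> sets \<mu>" and Elim: "(\<lambda>n. mass \<nu> (eta (x n)) (E i \<times> {h})) \<longlonglongrightarrow> 0" for i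
    unfolding E_def by (rule central_mass_moved[OF x Bs h(1)])+
  define D where "D k = space \<mu> - (\<Union>i<k. E i)" for k :: nat
  have Ds: "D k \<in> sets \<mu>" for k unfolding D_def using Es by auto
  have hi: "inv h \<in> carrier G" "inv h \<noteq> \<one>" using h by auto
  have moved: "AE t in \<mu>. t \<notin> (\<Inter>k. D k)"
  proof -
    have "AE t in \<mu>. \<phi> (inv h) t \<noteq> t" using free hi unfolding essentially_free_def by blast
    with AE_space show ?thesis
    proof eventually_elim
      case (elim t)
      have s: "\<phi> (inv h) t \<in> topspace T" "t \<in> topspace T" using elim(1) hi \<phi>_in T(3) by auto
      have "t1_space T"
        by (intro metrizable_imp_t1_space completely_metrizable_imp_metrizable_space T(1))
      then obtain U where "openin T U" "t \<in> U" "\<phi> (inv h) t \<notin> U"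
        using s elim(2)[symmetric] unfolding t1_space_def by blast
      then obtain V where V: "V \<in> \<B>" "t \<in> V" "\<phi> (inv h) t \<notin> V" using \<B>(3) by blast
      obtain i where "from_nat_into \<B> i = V" using from_nat_into_surj[OF \<B>(1) V(1)] by blast
      then have "t \<in> E i" using V elim(1) by (simp add: E_def)
      then have "t \<notin> D (Suc i)" by (auto simp: D_def)
      then show ?case by blast
    qed
  qed
  have Dinf: "(\<Inter>k. D k) \<in> sets \<mu>" using Ds by auto
  have "{t \<in> space \<mu>. \<not> t \<notin> (\<Inter>k. D k)} = (\<Inter>k. D k)"
    using sets.sets_into_space[OF Dinf] by blast
  from AE_iff_measurable[OF Dinf this] have "emeasure \<mu> (\<Inter>k. D k) = 0" using moved by simp
  then have "measure \<mu> (\<Inter>k. D k) = 0" by (simp add: measure_def)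
  moreover have "(\<lambda>k. measure \<mu> (D k)) \<longlonglongrightarrow> measure \<mu> (\<Inter>k. D k)"
    using Ds by (intro finite_Lim_measure_decseq) (force simp: D_def decseq_def)+
  ultimately have Dlim: "(\<lambda>k. measure \<mu> (D k)) \<longlonglongrightarrow> 0" by simp
  show ?thesis
  proof (rule LIMSEQ_I)
    fix e :: real assume e: "0 < e"
    obtain k where k: "measure \<mu> (D k) < e / 2"
      using order_tendstoD(2)[OF Dlim, of "e / 2"] e by (auto simp: eventually_sequentially)
    have "(\<lambda>n. \<Sum>i<k. mass \<nu> (eta (x n)) (E i \<times> {h})) \<longlonglongrightarrow> (\<Sum>i<k. 0)"
      by (intro tendsto_sum Elim)
    then have "\<forall>\<^sub>F n in sequentially. (\<Sum>i<k. mass \<nu> (eta (x n)) (E i \<times> {h})) < e / 2"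
      using e by (intro order_tendstoD(2)) auto
    then obtain N where N: "\<And>n. N \<le> n \<Longrightarrow> (\<Sum>i<k. mass \<nu> (eta (x n)) (E i \<times> {h})) < e / 2"
      by (auto simp: eventually_sequentially)
    have "norm (mass \<nu> (eta (x n)) (space \<mu> \<times> {h}) - 0) < e" if n: "N \<le> n" for n
    proof -
      note fin = mass_finite_measure[OF eta_l2[OF xM(1)[of n]]]
      have U: "(\<Union>i<k. E i) \<in> sets \<mu>" using Es by auto
      have sub: "(\<Union>i<k. E i) \<subseteq> space \<mu>" by (auto simp: E_def)
      have "space \<mu> \<times> {h} = D k \<times> {h} \<union> (\<Union>i<k. E i) \<times> {h}"
        using sub by (auto simp: D_def)
      then have "mass \<nu> (eta (x n)) (space \<mu> \<times> {h})
          = mass \<nu> (eta (x n)) (D k \<times> {h}) + mass \<nu> (eta (x n)) ((\<Union>i<k. E i) \<times> {h})"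
        using mass_union[OF eta_l2[OF xM(1)] rectangle_sets[OF Ds, of "{h}" k] rectangle_sets[OF U, of "{h}"]] h
        by (auto simp: D_def)
      also have "mass \<nu> (eta (x n)) (D k \<times> {h}) \<le> measure \<mu> (D k)"
        by (rule eta_mass_le[OF xM Ds h(1)])
      also have "mass \<nu> (eta (x n)) ((\<Union>i<k. E i) \<times> {h}) \<le> (\<Sum>i<k. mass \<nu> (eta (x n)) (E i \<times> {h}))"
      proof -
        have "(\<Union>i<k. E i) \<times> {h} = (\<Union>i\<in>{..<k}. E i \<times> {h})" by auto
        then show ?thesis
          using finite_measure.finite_measure_subadditive_finite[OF fin, of "{..<k}" "\<lambda>i. E i \<times> {h}"]
            rectangle_sets[OF Es, of "{h}"] h
          by (auto simp: mass_def)
      qed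
      finally have "mass \<nu> (eta (x n)) (space \<mu> \<times> {h}) < e" using k N[OF n] by simp
      then show ?thesis using mass_nonneg[of \<nu> "eta (x n)"] by simp
    qed
    then show "\<exists>N. \<forall>n\<ge>N. norm (mass \<nu> (eta (x n)) (space \<mu> \<times> {h}) - 0) < e" by blast
  qed
qed


subsection \<open>Isometries close to the abelian subalgebra almost commute\<close>

text \<open>The coefficient at the unit, cut off so that it is bounded by \<open>1\<close> everywhere. For an isometry the cut off
  part lives on a null set.\<close>

definition diagonal where
  "diagonal x t = (if cmod (eta x (t, \<one>)) \<le> 1 then eta x (t, \<one>) else 0)"

definition defect where
  "defect x = 1 - mass \<nu> (eta x) (space \<mu> \<times> {\<one>})"

lemma diagonal_bounded:
  assumes x: "x \<in> M"
  shows "diagonal x \<in> essentially_bounded \<mu>" and "cmod (diagonal x t) \<le> 1"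
proof -
  have "(\<lambda>t. eta x (t, \<one>)) \<in> borel_measurable \<mu>"
    by (rule l2_measurable[OF l2_section[OF countable eta_l2[OF x] one_closed]])
  then have "diagonal x \<in> borel_measurable \<mu>"
    unfolding diagonal_def[abs_def] by measurable
  moreover show "cmod (diagonal x t) \<le> 1" for t by (simp add: diagonal_def)
  ultimately show "diagonal x \<in> essentially_bounded \<mu>" by (auto simp: essentially_bounded_def)
qed

lemma diagonal_close:
  assumes x: "x \<in> M" "isometric x"
  shows "vnorm (L2 \<nu>) (L2.vsub \<nu> (x \<xi>) (mul (diagonal x) \<xi>)) = sqrt (defect x)"
proof -
  note m = mul_\<xi>_class[OF diagonal_bounded(1)[OF x(1)]]
  define d where "d p = eta x p - diagonal x (fst p) * \<xi>0 p" for p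
  have d: "d \<in> l2_functions \<nu>" using l2_diff[OF eta_l2[OF x(1)] m(2)] by (simp add: d_def[abs_def])
  have E: "space \<mu> \<times> {\<one>} \<in> sets \<nu>" by (intro rectangle_sets) auto
  have "L2.vsub \<nu> (x \<xi>) (mul (diagonal x) \<xi>) = l2_class \<nu> d"
    unfolding L2.vsub_def m(1) eta_class[OF x(1), symmetric] L2_vsub[OF eta_l2[OF x(1)] m(2)]
    by (simp add: d_def[abs_def])
  then have "Re (vinner (L2 \<nu>) (L2.vsub \<nu> (x \<xi>) (mul (diagonal x) \<xi>)) (L2.vsub \<nu> (x \<xi>) (mul (diagonal x) \<xi>)))
      = (\<integral>p. (cmod (d p))\<^sup>2 \<partial>\<nu>)"
    by (simp add: L2_norm_sq[OF d])
  also have "\<dots> = (\<integral>p. (cmod (eta x p))\<^sup>2 - (cmod (eta x p))\<^sup>2 * indicator (space \<mu> \<times> {\<one>}) p \<partial>\<nu>)"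
  proof (rule integral_cong_AE)
    show "AE p in \<nu>. (cmod (d p))\<^sup>2
        = (cmod (eta x p))\<^sup>2 - (cmod (eta x p))\<^sup>2 * indicator (space \<mu> \<times> {\<one>}) p"
      using AE_fst[OF \<gamma> eta_slice_bounded[OF x one_closed]] AE_space
    proof eventually_elim
      case (elim p)
      then show ?case
        by (cases p) (auto simp: d_def diagonal_def \<xi>0_def space_\<nu> indicator_def)
    qed
  qed (use l2_integrable[OF d] l2_integrable[OF eta_l2[OF x(1)]] mass_integrable[OF eta_l2[OF x(1)] E] in
      \<open>auto intro!: borel_measurable_diff borel_measurable_integrable\<close>)
  also have "\<dots> = defect x"
    using Bochner_Integration.integral_diff[OF l2_integrable[OF eta_l2[OF x(1)]] mass_integrable[OF eta_l2[OF x(1)] E]]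
    by (simp add: defect_def mass_eq[OF eta_l2[OF x(1)] E] eta_norm[OF x])
  finally show ?thesis by (simp add: vnorm_def)
qed

lemma rmult_contraction:
  assumes "a \<in> essentially_bounded \<mu>" "\<And>t. cmod (a t) \<le> 1" and F: "F \<in> vecs (L2 \<nu>)"
  shows "vnorm (L2 \<nu>) (rmult a \<one> F) \<le> vnorm (L2 \<nu>) F"
proof -
  obtain f where f: "f \<in> l2_functions \<nu>" "F = l2_class \<nu> f" using L2_vec_cases[OF F] .
  have w: "weight a \<in> borel_measurable \<nu>" "AE p in \<nu>. cmod (weight a p) \<le> 1"
    using weight_bounded[OF assms(1)] assms(2) by (auto simp: essentially_bounded_def weight_def split_beta)
  note b = weighted_composition_bound[OF right_preserving[OF one_closed] w f(1)]
  show ?thesis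
    unfolding f(2) vnorm_def rmult_def wcomp_apply[OF right_preserving[OF one_closed] f(1)]
      L2_norm_sq[OF b(1)] L2_norm_sq[OF f(1)] using b(2) by simp
qed

text \<open>First \<open>y \<xi>\<close> is replaced by \<open>b \<xi> = \<xi> b\<close> for the coefficient \<open>b\<close> of \<open>y\<close>. Then \<open>b\<close>, acting on the right,
  commutes with \<open>x\<close>, and \<open>x \<xi>\<close> is replaced by the coefficient of \<open>x\<close>.\<close>

lemma product_close:
  assumes x: "x \<in> M" "isometric x" and y: "y \<in> M" "isometric y"
  shows "vnorm (L2 \<nu>) (L2.vsub \<nu> (x (y \<xi>)) (rmult (diagonal y) \<one> (rmult (diagonal x) \<one> \<xi>)))
    \<le> sqrt (defect x) + sqrt (defect y)"
proof -
  note a = diagonal_bounded[OF x(1)] and b = diagonal_bounded[OF y(1)]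
  have xo: "x \<in> bounded_ops (L2 \<nu>)" and yo: "y \<in> bounded_ops (L2 \<nu>)"
    using L2.vn_ops[OF M_vn] x y by auto
  note Ca = rmult_ops[OF a(1) one_closed] and Cb = rmult_ops[OF b(1) one_closed]
  note v = L2.op_closed[OF xo \<xi>_in] L2.op_closed[OF yo \<xi>_in] L2.op_closed[OF Ca \<xi>_in] L2.op_closed[OF Cb \<xi>_in]
  have "vnorm (L2 \<nu>) (L2.vsub \<nu> (x (y \<xi>)) (x (rmult (diagonal y) \<one> \<xi>)))
      = vnorm (L2 \<nu>) (x (L2.vsub \<nu> (y \<xi>) (rmult (diagonal y) \<one> \<xi>)))"
    by (simp add: L2.op_vsub[OF xo v(2,4)])
  also have "\<dots> = sqrt (defect y)"
    using x(2) L2.vsub_closed[OF v(2,4)] diagonal_close[OF y] unfolding isometric_def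
    by (simp add: vnorm_def mul_\<xi>)
  finally have 1: "vnorm (L2 \<nu>) (L2.vsub \<nu> (x (y \<xi>)) (x (rmult (diagonal y) \<one> \<xi>))) = sqrt (defect y)" .
  have "L2.vsub \<nu> (x (rmult (diagonal y) \<one> \<xi>)) (rmult (diagonal y) \<one> (rmult (diagonal x) \<one> \<xi>))
      = rmult (diagonal y) \<one> (L2.vsub \<nu> (x \<xi>) (rmult (diagonal x) \<one> \<xi>))"
    using L2.commutantD[OF rmult_commutant[OF b(1) one_closed] x(1) \<xi>_in]
    by (simp add: L2.op_vsub[OF Cb v(1,3)])
  then have 2: "vnorm (L2 \<nu>) (L2.vsub \<nu> (x (rmult (diagonal y) \<one> \<xi>)) (rmult (diagonal y) \<one> (rmult (diagonal x) \<one> \<xi>)))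
      \<le> sqrt (defect x)"
    using rmult_contraction[OF b L2.vsub_closed[OF v(1,3)]] diagonal_close[OF x] by (simp add: mul_\<xi>)
  show ?thesis
    using L2.norm_vsub_triangle[OF L2.op_closed[OF xo v(2)] L2.op_closed[OF xo v(4)] L2.op_closed[OF Cb v(3)]] 1 2
    by linarith
qed

lemma commutator_le_defects:
  assumes x: "x \<in> M" "isometric x" and y: "y \<in> M" "isometric y"
  shows "vnorm (L2 \<nu>) (commutator x y) \<le> 2 * (sqrt (defect x) + sqrt (defect y))"
proof -
  note a = diagonal_bounded[OF x(1)] and b = diagonal_bounded[OF y(1)]
  let ?A = "rmult (diagonal x) \<one>" and ?B = "rmult (diagonal y) \<one>"
  have AB: "?A (?B \<xi>) = ?B (?A \<xi>)"
    unfolding rmult_def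
    by (rule wcomp_commute[OF right_preserving[OF one_closed] right_preserving[OF one_closed]
          weight_bounded[OF a(1)] weight_bounded[OF b(1)] _ _ \<xi>_in])
      (rule AE_I2, simp_all only: right_one mult.commute)
  have xo: "x \<in> bounded_ops (L2 \<nu>)" and yo: "y \<in> bounded_ops (L2 \<nu>)"
    using L2.vn_ops[OF M_vn] x y by auto
  note v = L2.op_closed[OF xo L2.op_closed[OF yo \<xi>_in]] L2.op_closed[OF yo L2.op_closed[OF xo \<xi>_in]]
    L2.op_closed[OF rmult_ops[OF b(1) one_closed] L2.op_closed[OF rmult_ops[OF a(1) one_closed] \<xi>_in]]
  have sym: "vnorm (L2 \<nu>) (L2.vsub \<nu> p q) = vnorm (L2 \<nu>) (L2.vsub \<nu> q p)"
    if "p \<in> vecs (L2 \<nu>)" "q \<in> vecs (L2 \<nu>)" for p q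
    using that by (simp add: vnorm_def L2.inner_sub_left L2.inner_sub_right L2.vsub_closed)
  show ?thesis
    unfolding commutator_def
    using L2.norm_vsub_triangle[OF v(1,3,2)] product_close[OF x y] product_close[OF y x]
      sym[OF v(2,3)] AB by simp
qed

end

section \<open>From central sequences to a mean\<close>

text \<open>By compactness of \<open>[0, 1]\<^sup>I\<close> a sequence of functions into \<open>[0, 1]\<close> has a cluster point, which satisfies all
  continuous relations that hold in the limit.\<close>

lemma cluster_point_functional:
  fixes m :: "nat \<Rightarrow> 'i \<Rightarrow> real" and F :: "nat filter"
  assumes F: "F \<noteq> bot" and m: "\<And>n i. 0 \<le> m n i" "\<And>n i. m n i \<le> 1"
  obtains L where "\<And>i. 0 \<le> L i" "\<And>\<Phi> (c :: real). \<lbrakk>continuous_on UNIV \<Phi>; ((\<lambda>n. \<Phi> (m n)) \<longlongrightarrow> c) F\<rbrakk> \<Longrightarrow> \<Phi> L = c"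
proof -
  let ?S = "PiE UNIV (\<lambda>_. {0..1}) :: ('i \<Rightarrow> real) set"
  have "compactin (product_topology (\<lambda>i. euclidean) UNIV) ?S"
    by (simp add: compactin_PiE)
  then have "compact ?S" by (simp add: euclidean_product_topology)
  moreover have "filtermap m F \<noteq> bot" using F by (simp add: filtermap_bot_iff)
  moreover have "eventually (\<lambda>x. x \<in> ?S) (filtermap m F)"
    using m by (auto simp: eventually_filtermap PiE_iff)
  ultimately obtain L where L: "L \<in> ?S" "inf (nhds L) (filtermap m F) \<noteq> bot"
    unfolding compact_filter by blast
  have "\<Phi> L = c" if \<Phi>: "continuous_on UNIV \<Phi>" "((\<lambda>n. \<Phi> (m n)) \<longlongrightarrow> c) F" for \<Phi> and c :: real
  proof (rule tendsto_unique[OF L(2)])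
    have "(\<Phi> \<longlongrightarrow> \<Phi> L) (at L)" using \<Phi>(1) unfolding continuous_on_def by blast
    then have "(\<Phi> \<longlongrightarrow> \<Phi> L) (nhds L)" by (simp add: tendsto_at_iff_tendsto_nhds)
    then show "(\<Phi> \<longlongrightarrow> \<Phi> L) (inf (nhds L) (filtermap m F))" by (rule tendsto_mono[OF inf_le1])
    have "(\<Phi> \<longlongrightarrow> c) (filtermap m F)" using \<Phi>(2) by (simp add: filterlim_filtermap)
    then show "(\<Phi> \<longlongrightarrow> c) (inf (nhds L) (filtermap m F))" by (rule tendsto_mono[OF inf_le2])
  qed
  moreover have "0 \<le> L i" for i using PiE_mem[OF L(1), of i] by simp
  ultimately show ?thesis using that by blast
qed

text \<open>The only point mass is at the unit, which is a conjugacy class of its own: it is removed, and the rest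
  is normalized.\<close>

lemma inner_amenable_from_cluster_point:
  fixes G (structure) and L :: "'g set \<Rightarrow> real"
  assumes "group G" and nonneg: "\<And>A. 0 \<le> L A" and total: "L (carrier G) = 1"
    and additive: "\<And>A B. \<lbrakk>A \<subseteq> carrier G; B \<subseteq> carrier G; A \<inter> B = {}\<rbrakk> \<Longrightarrow> L (A \<union> B) = L A + L B"
    and invariant: "\<And>g A. \<lbrakk>g \<in> carrier G; A \<subseteq> carrier G\<rbrakk> \<Longrightarrow> L ((\<lambda>x. g \<otimes> x \<otimes> inv g) ` A) = L A"
    and singleton: "\<And>h. \<lbrakk>h \<in> carrier G; h \<noteq> \<one>\<rbrakk> \<Longrightarrow> L {h} = 0" and unit: "L {\<one>} < 1"
  shows "inner_amenable G"
proof -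
  interpret group G by fact
  define m where "m A = L (A - {\<one>}) / (1 - L {\<one>})" for A
  have empty: "L {} = 0" using additive[of "{}" "{}"] by simp
  have split: "L (A - {\<one>}) + L {\<one>} = L A" if "A \<subseteq> carrier G" "\<one> \<in> A" for A
  proof -
    have "(A - {\<one>}) \<union> {\<one>} = A" "A - {\<one>} \<subseteq> carrier G" using that by auto
    then show ?thesis using additive[of "A - {\<one>}" "{\<one>}"] by simp
  qed
  have finite0: "L U = 0" if "finite U" "U \<subseteq> carrier G" "\<one> \<notin> U" for U
    using that
  proof (induction U)
    case (insert h U)
    then have "L ({h} \<union> U) = L {h} + L U" by (intro additive) auto
    moreover have "L {h} = 0" using insert.prems by (intro singleton) auto
    ultimately show ?case using insert by simp
  qed (simp add: empty)
  show ?thesis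
    unfolding inner_amenable_def
  proof (intro exI[of _ m] conjI ballI impI)
    show "0 \<le> m A" for A using nonneg unit by (simp add: m_def)
    show "m (carrier G) = 1" using split[of "carrier G"] total unit by (simp add: m_def field_simps)
    show "m (A \<union> B) = m A + m B" if "A \<in> Pow (carrier G)" "B \<in> Pow (carrier G)" "A \<inter> B = {}" for A B
    proof -
      have "L ((A - {\<one>}) \<union> (B - {\<one>})) = L (A - {\<one>}) + L (B - {\<one>})"
        using that by (intro additive) auto
      then show ?thesis by (simp add: m_def Un_Diff add_divide_distrib)
    qed
    show "m ((\<lambda>x. g \<otimes> x \<otimes> inv g) ` A) = m A" if g: "g \<in> carrier G" and A: "A \<in> Pow (carrier G)" for g A
    proof -
      have "g \<otimes> x \<otimes> inv g = \<one> \<longleftrightarrow> x = \<one>" if "x \<in> carrier G" for x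
        using that g by (metis inv_equality inv_inv inv_closed m_closed r_inv r_one right_cancel l_cancel_one)
      then have "(\<lambda>x. g \<otimes> x \<otimes> inv g) ` A - {\<one>} = (\<lambda>x. g \<otimes> x \<otimes> inv g) ` (A - {\<one>})"
        using A by auto
      then show ?thesis using invariant[OF g, of "A - {\<one>}"] A by (auto simp: m_def)
    qed
    show "m V = 0" if "V \<in> Pow (carrier G)" "finite V" for V
      using finite0[of "V - {\<one>}"] that by (auto simp: m_def)
  qed
qed

context crossed
begin

text \<open>The cluster point is taken along the indices where at least \<open>\<delta>\<close> of the mass is off the unit. The bound
  passes to the limit through the continuous function \<open>max (l {\<one>}) (1 - \<delta>)\<close>, which is constant there.\<close>

lemma inner_amenable_from_central:
  assumes x: "central x" and free: "essentially_free G \<mu> \<phi>" and \<delta>: "0 < \<delta>"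
    and freq: "\<exists>\<^sub>F n in sequentially. \<delta> \<le> defect (x n)"
  shows "inner_amenable G"
proof -
  have xM: "x n \<in> M" "isometric (x n)" for n using x by (auto simp: central_def)
  note el2 = eta_l2[OF xM(1)]
  define F where "F = inf sequentially (principal {n. \<delta> \<le> defect (x n)})"
  have F: "F \<noteq> bot"
    using freq by (simp add: F_def trivial_limit_def eventually_inf_principal frequently_def)
  have F_le: "F \<le> sequentially" by (simp add: F_def)
  define m where "m n A = mass \<nu> (eta (x n)) (space \<mu> \<times> (A \<inter> carrier G))" for n A
  have total: "m n (carrier G) = 1" for n
    using mass_space[OF el2] eta_norm[OF xM] by (simp add: m_def space_\<nu>[symmetric])
  have m1: "m n A \<le> 1" for n A
    using mass_mono[OF el2 sets.top, of "space \<mu> \<times> (A \<inter> carrier G)" n] total[of n]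
    by (auto simp: m_def space_\<nu>)
  obtain L where L: "\<And>A. 0 \<le> L A"
      "\<And>\<Phi> (c :: real). \<lbrakk>continuous_on UNIV \<Phi>; ((\<lambda>n. \<Phi> (m n)) \<longlongrightarrow> c) F\<rbrakk> \<Longrightarrow> \<Phi> L = c"
    using cluster_point_functional[OF F, of m] m1 by (auto simp: m_def mass_nonneg)
  note coord = continuous_on_product_coordinates
  show ?thesis
  proof (rule inner_amenable_from_cluster_point[OF is_group, of L])
    show "0 \<le> L A" for A by (rule L(1))
    show "L (carrier G) = 1"
      by (rule L(2)[OF coord]) (simp add: total)
    show "L (A \<union> B) = L A + L B" if AB: "A \<subseteq> carrier G" "B \<subseteq> carrier G" "A \<inter> B = {}" for A B
    proof -
      have "m n (A \<union> B) - (m n A + m n B) = 0" for n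
      proof -
        have eqs: "A \<inter> carrier G = A" "B \<inter> carrier G = B" "(A \<union> B) \<inter> carrier G = A \<union> B"
          "space \<mu> \<times> (A \<union> B) = space \<mu> \<times> A \<union> space \<mu> \<times> B" using AB by auto
        have "(space \<mu> \<times> A) \<inter> (space \<mu> \<times> B) = {}" using AB(3) by auto
        from mass_union[OF el2 rectangle_sets[OF sets.top AB(1)] rectangle_sets[OF sets.top AB(2)] this]
        show ?thesis unfolding m_def eqs by (simp only: diff_self)
      qed
      then have "((\<lambda>n. m n (A \<union> B) - (m n A + m n B)) \<longlongrightarrow> 0) F" by (simp only: tendsto_const)
      moreover have "continuous_on UNIV (\<lambda>l :: 'a set \<Rightarrow> real. l (A \<union> B) - (l A + l B))"
        by (rule continuous_on_diff[OF coord continuous_on_add[OF coord coord]])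
      ultimately have "L (A \<union> B) - (L A + L B) = 0" by (rule L(2)[rotated])
      then show ?thesis by simp
    qed
    show "L ((\<lambda>h. g \<otimes> h \<otimes> inv g) ` A) = L A" if g: "g \<in> carrier G" and A: "A \<subseteq> carrier G" for g A
    proof -
      let ?W = "(\<lambda>h. g \<otimes> h \<otimes> inv g) ` A"
      have "?W \<inter> carrier G = ?W" "A \<inter> carrier G = A" using g A by auto
      then have "(\<lambda>n. m n ?W - m n A) \<longlonglongrightarrow> 0"
        using central_mass_conjugation[OF x g A] by (simp only: m_def)
      then have "((\<lambda>n. m n ?W - m n A) \<longlongrightarrow> 0) F" by (rule tendsto_mono[OF F_le])
      moreover have "continuous_on UNIV (\<lambda>l :: 'a set \<Rightarrow> real. l ?W - l A)"
        by (rule continuous_on_diff[OF coord coord])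
      ultimately have "L ?W - L A = 0" by (rule L(2)[rotated])
      then show ?thesis by simp
    qed
    show "L {h} = 0" if h: "h \<in> carrier G" "h \<noteq> \<one>" for h
    proof (rule L(2)[OF coord])
      have "{h} \<inter> carrier G = {h}" using h by auto
      then have "(\<lambda>n. m n {h}) \<longlonglongrightarrow> 0"
        using central_mass_singleton[OF x free h] by (simp only: m_def)
      then show "((\<lambda>n. m n {h}) \<longlongrightarrow> 0) F" by (rule tendsto_mono[OF F_le])
    qed
    have "max (L {\<one>}) (1 - \<delta>) = 1 - \<delta>"
    proof (rule L(2)[of "\<lambda>l. max (l {\<one>}) (1 - \<delta>)"])
      show "continuous_on UNIV (\<lambda>l :: 'a set \<Rightarrow> real. max (l {\<one>}) (1 - \<delta>))"
        by (intro continuous_on_max coord continuous_on_const)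
      have "\<forall>\<^sub>F n in F. max (m n {\<one>}) (1 - \<delta>) = 1 - \<delta>"
        unfolding F_def eventually_inf_principal
        by (rule always_eventually) (auto simp: m_def defect_def)
      then show "((\<lambda>n. max (m n {\<one>}) (1 - \<delta>)) \<longlongrightarrow> 1 - \<delta>) F" by (rule tendsto_eventually)
    qed
    then show "L {\<one>} < 1" using \<delta> by (simp add: max_def split: if_splits)
  qed
qed

lemma defect_nonneg:
  assumes "x \<in> M" "isometric x" shows "0 \<le> defect x"
proof -
  have "mass \<nu> (eta x) (space \<mu> \<times> {\<one>}) \<le> mass \<nu> (eta x) (space \<nu>)"
    by (intro mass_mono eta_l2 assms sets.top) (auto simp: space_\<nu>)
  also have "\<dots> = 1" using mass_space[OF eta_l2[OF assms(1)]] eta_norm[OF assms] by simp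
  finally show ?thesis by (simp add: defect_def)
qed

lemma defect_dichotomy:
  assumes "central x"
  shows "(\<exists>\<delta>>0. \<exists>\<^sub>F n in sequentially. \<delta> \<le> defect (x n)) \<or> (\<lambda>n. sqrt (defect (x n))) \<longlonglongrightarrow> 0"
proof (rule disjCI)
  assume "\<not> (\<lambda>n. sqrt (defect (x n))) \<longlonglongrightarrow> 0"
  then have "\<not> (\<lambda>n. defect (x n)) \<longlonglongrightarrow> 0" using tendsto_real_sqrt[of "\<lambda>n. defect (x n)" 0] by auto
  then obtain \<delta> where \<delta>: "0 < \<delta>" "\<And>N. \<exists>n\<ge>N. \<not> dist (defect (x n)) 0 < \<delta>"
    unfolding LIMSEQ_def by blast
  have "0 \<le> defect (x n)" for n using assms by (intro defect_nonneg) (auto simp: central_def)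
  then have "\<exists>\<^sub>F n in sequentially. \<delta> \<le> defect (x n)"
    using \<delta>(2) unfolding frequently_sequentially by (auto simp: dist_real_def not_less)
  then show "\<exists>\<delta>>0. \<exists>\<^sub>F n in sequentially. \<delta> \<le> defect (x n)" using \<delta>(1) by blast
qed

text \<open>If neither of the two central sequences yields a mean, then both are asymptotically contained in the
  abelian algebra \<open>L\<^sup>\<infinity>(X)\<close>, which contradicts their not commuting.\<close>

theorem McDuff_imp_inner_amenable:
  assumes free: "essentially_free G \<mu> \<phi>" and McDuff: "star_isomorphic (L2 \<nu>) M (L2 K) N"
  shows "inner_amenable G"
proof (rule ccontr)
  assume not: "\<not> inner_amenable G"
  obtain x y where x: "central x" and y: "central y"
    and noncomm: "\<not> (\<lambda>n. Re (vinner (L2 \<nu>) (commutator (x n) (y n)) (commutator (x n) (y n)))) \<longlonglongrightarrow> 0"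
    using McDuff_central_sequences[OF McDuff] by blast
  have small: "(\<lambda>n. sqrt (defect (z n))) \<longlonglongrightarrow> 0" if "central z" for z
    using defect_dichotomy[OF that] inner_amenable_from_central[OF that free] not by blast
  have xM: "x n \<in> M" "isometric (x n)" and yM: "y n \<in> M" "isometric (y n)" for n
    using x y by (auto simp: central_def)
  let ?c = "\<lambda>n. commutator (x n) (y n)"
  have cin: "?c n \<in> vecs (L2 \<nu>)" for n
    using L2.vn_ops[OF M_vn xM(1)] L2.vn_ops[OF M_vn yM(1)] \<xi>_in
    by (simp add: commutator_def L2.vsub_closed L2.op_closed)
  have "(\<lambda>n. 2 * (sqrt (defect (x n)) + sqrt (defect (y n)))) \<longlonglongrightarrow> 2 * (0 + 0)"
    by (intro tendsto_intros small x y)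
  then have lim: "(\<lambda>n. 2 * (sqrt (defect (x n)) + sqrt (defect (y n)))) \<longlonglongrightarrow> 0" by simp
  have "(\<lambda>n. vnorm (L2 \<nu>) (?c n)) \<longlonglongrightarrow> 0"
  proof (rule Lim_null_comparison[OF _ lim], rule always_eventually, rule allI)
    fix n show "norm (vnorm (L2 \<nu>) (?c n)) \<le> 2 * (sqrt (defect (x n)) + sqrt (defect (y n)))"
      using commutator_le_defects[OF xM yM] L2.norm_nonneg[OF cin] by simp
  qed
  then have "(\<lambda>n. (vnorm (L2 \<nu>) (?c n))\<^sup>2) \<longlonglongrightarrow> 0\<^sup>2" by (rule tendsto_power)
  then show False using noncomm by (simp add: L2.norm_sq[OF cin])
qed

end

theorem proposition4p1:
  fixes G (structure)
  assumes "group G" and "countable (carrier G)"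
    and "McDuff_group TYPE('x) G"
  shows "inner_amenable G"
proof -
  obtain \<mu> :: "'x measure" and \<phi> where pmp: "pmp_action G \<mu> \<phi>" and free: "essentially_free G \<mu> \<phi>"
    and McDuff: "McDuff_factor (crossed_space G \<mu>) (crossed_product G \<mu> \<phi>)"
    using assms(3) unfolding McDuff_group_def by blast
  interpret crossed G \<mu> \<phi>
    using assms(1,2) pmp by (simp add: crossed_def crossed_axioms_def)
  show ?thesis
    using McDuff by (intro McDuff_imp_inner_amenable free) (simp add: McDuff_factor_def)
qed

end
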